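(* Let $d=2$ and let $\alpha:\mathbb R^2\to U(m)$ be a family of matching matrices (with $\varepsilon=\mathbf 1$ or $\varepsilon=J$). Then there exists a sequence $(\widehat\alpha_n)_{n\in\mathbb N}$ of continuous, $\mathbb Z^2$-periodic maps $\widehat\alpha_n:\mathbb R^2\to U(m)$ such that $\sup_{\mathbf k\in\mathbb R^2}\|\widehat\alpha_n(\mathbf k)-\alpha(\mathbf k)\|\to 0$ as $n\to\infty$, and for every $n$ and every $\mathbf k\in\mathbb R^2$ the matrix $\widehat\alpha_n(\mathbf k)$ has completely non-degenerate spectrum, with $\sigma(\widehat\alpha_n(\mathbf k))=\sigma(\widehat\alpha_n(-\mathbf k))$.
   Context: $\varepsilon$ is either the $m\times m$ identity $\mathbf 1$ or, for $m$ even, $J=\begin{pmatrix}0&\mathbf 1\\-\mathbf 1&0\end{pmatrix}$. A family of matching matrices is a continuous, $\mathbb Z^2$-periodic map $\alpha:\mathbb R^2\to U(m)$ with $\varepsilon\alpha(\mathbf k)=\alpha(-\mathbf k)^t\varepsilon$ for all $\mathbf k$. No homotopy assumption on $\alpha$ is made, and the approximants are not required to satisfy the time-reversal relation. *)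

theory Defs
  imports "HOL-Analysis.Analysis" "Jordan_Normal_Form.Matrix" "Jordan_Normal_Form.Char_Poly"
    "Jordan_Normal_Form.Schur_Decomposition"
begin

definition unitary_mat :: "nat \<Rightarrow> complex mat \<Rightarrow> bool" where
  "unitary_mat m U \<longleftrightarrow> U \<in> carrier_mat m m \<and> mat_adjoint U * U = 1\<^sub>m m \<and> U * mat_adjoint U = 1\<^sub>m m"

definition J_mat :: "nat \<Rightarrow> complex mat" where
  "J_mat m = (let k = m div 2 in four_block_mat (0\<^sub>m k k) (1\<^sub>m k) (- (1\<^sub>m k)) (0\<^sub>m k k))"

text \<open>Continuity of a matrix-valued map on R^2 (entrywise = in any matrix norm).\<close>
definition mat_continuous :: "nat \<Rightarrow> (real^2 \<Rightarrow> complex mat) \<Rightarrow> bool" where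
  "mat_continuous m f \<longleftrightarrow> (\<forall>i<m. \<forall>j<m. continuous_on UNIV (\<lambda>k. f k $$ (i, j)))"

definition Z2_periodic :: "(real^2 \<Rightarrow> 'a) \<Rightarrow> bool" where
  "Z2_periodic f \<longleftrightarrow> (\<forall>k z. (\<forall>i. z $ i \<in> \<int>) \<longrightarrow> f (k + z) = f k)"

definition matching_family :: "nat \<Rightarrow> complex mat \<Rightarrow> (real^2 \<Rightarrow> complex mat) \<Rightarrow> bool" where
  "matching_family m \<epsilon> \<alpha> \<longleftrightarrow>
     mat_continuous m \<alpha> \<and> Z2_periodic \<alpha> \<and> (\<forall>k. unitary_mat m (\<alpha> k)) \<and>
     (\<forall>k. \<epsilon> * \<alpha> k = transpose_mat (\<alpha> (- k)) * \<epsilon>)"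

definition spectrum_mat :: "complex mat \<Rightarrow> complex set" where
  "spectrum_mat A = {c. eigenvalue A c}"

definition completely_nondegenerate :: "nat \<Rightarrow> complex mat \<Rightarrow> bool" where
  "completely_nondegenerate m A \<longleftrightarrow> card (spectrum_mat A) = m"

definition mat_norm :: "complex mat \<Rightarrow> real" where
  "mat_norm A = sqrt (\<Sum>i<dim_row A. \<Sum>j<dim_col A. (cmod (A $$ (i, j)))\<^sup>2)"

end

theory Submission
  imports Defs
begin

text \<open>The matching relation is used only through its consequence that \<open>\<alpha> k\<close> and
  \<open>\<alpha> (- k)\<close> have the same characteristic polynomial.

  Degenerate spectrum has codimension three in the unitary group while the torus has dimension two.
  Hence, after replacing \<open>\<alpha>\<close> by a Lipschitz family, a suitable constant unitary matrix \<open>A\<close> close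
  to the identity makes \<open>\<beta> k = \<alpha> k * A\<close> completely non-degenerate for every \<open>k\<close>. Instead of
  Sard's theorem, a pigeonhole argument on a fine grid of hermitian matrices, mapped to unitary
  matrices by the Cayley transform, provides \<open>A\<close>.

  The spectrum of \<open>\<beta>\<close> is then made symmetric without touching the eigenprojections. Let
  \<open>S\<close> be a continuous increasing approximation of the staircase that jumps by \<open>2 pi\<close> at the
  multiples of \<open>2 pi\<close>, and let \<open>\<theta>\<^sub>j\<close> be the angles of the eigenvalues of \<open>\<alpha> k\<close>. The
  function \<open>(1 - t) m x + t (\<Sum>j. S (x - \<theta>\<^sub>j) + \<theta>\<^sub>j)\<close> of \<open>x\<close> induces a covering of degree
  \<open>m\<close> of the circle, and the \<open>m\<close> points over \<open>(- 1) ^ (m - 1) * det (\<alpha> k)\<close>, the middle of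
  every jump, are distinct, close to the spectrum of \<open>\<alpha> k\<close> and depend on that spectrum only.
  They replace the eigenvalues of \<open>\<beta> k\<close>.\<close>

section \<open>Unitary diagonalisation\<close>

text \<open>Eigenvalues and eigenvectors are chosen pointwise and may jump with \<open>k\<close>.
  Everything passed to a limit is therefore symmetric in them (sums, products, functional calculus),
  and for the same reason the new spectrum is described as a level set of a circle map rather than
  through labelled eigenvalues. The order of choices shapes the symmetrisation: the closeness
  demanded of \<open>\<beta>\<close> must be fixed before \<open>\<beta>\<close>, hence before its
  eigenvalue gap is known. So two staircases occur, a wide one for \<open>\<alpha>\<close>, whose
  width depends on the tolerated error only, and a sharp one for \<open>\<beta>\<close>, whose width
  lies below its gap. In the perturbation step the Lipschitz property is what turns a dimension
  count into a proof: \<open>k\<close> known up to order 1/N then fixes the matrix up to order 1/N,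
  which mere continuity does not give. The Cayley transform is the chart of choice because it makes
  the eigenvalue equation linear in the hermitian matrix, so two bad grid points can be compared by
  subtracting their equations.\<close>

lemma mult_entry:
  assumes "A \<in> carrier_mat n k" "B \<in> carrier_mat k p" "i < n" "j < p"
  shows "(A * B) $$ (i, j) = (\<Sum>l<k. A $$ (i, l) * B $$ (l, j))"
  using assms by (simp add: scalar_prod_def atLeast0LessThan)

lemma mat_adjoint_carrier: "A \<in> carrier_mat n k \<Longrightarrow> mat_adjoint A \<in> carrier_mat k n"
  by (auto simp: mat_adjoint_def)

lemma mat_adjoint_entry:
  fixes A :: "complex mat"
  assumes "A \<in> carrier_mat n k" "i < k" "j < n"
  shows "mat_adjoint A $$ (i, j) = cnj (A $$ (j, i))"
  using assms by (simp add: mat_adjoint_def mat_of_rows_def)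

lemma unitary_mat_iff:
  "unitary_mat m U \<longleftrightarrow> U \<in> carrier_mat m m \<and>
     (\<forall>i<m. \<forall>j<m. (\<Sum>l<m. cnj (U $$ (l, i)) * U $$ (l, j)) = (if i = j then 1 else 0))"
proof (cases "U \<in> carrier_mat m m")
  case U: True
  note A = mat_adjoint_carrier[OF U]
  have ent: "(mat_adjoint U * U) $$ (i, j) = (\<Sum>l<m. cnj (U $$ (l, i)) * U $$ (l, j))"
    if "i < m" "j < m" for i j
    using that mult_entry[OF A U that] by (simp add: mat_adjoint_entry[OF U])
  have "mat_adjoint U * U = 1\<^sub>m m \<longleftrightarrow>
     (\<forall>i<m. \<forall>j<m. (\<Sum>l<m. cnj (U $$ (l, i)) * U $$ (l, j)) = (if i = j then 1 else 0))"
    (is "?L \<longleftrightarrow> ?R")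
  proof
    assume ?L then show ?R using ent by (metis index_one_mat(1))
  next
    assume ?R then show ?L using U A ent by (intro eq_matI) auto
  qed
  then show ?thesis
    using U A mat_mult_left_right_inverse[OF A U] by (auto simp: unitary_mat_def)
qed (auto simp: unitary_mat_def)

lemma unitary_matD:
  assumes "unitary_mat m U"
  shows "U \<in> carrier_mat m m"
    and "i < m \<Longrightarrow> j < m \<Longrightarrow> (\<Sum>l<m. cnj (U $$ (l, i)) * U $$ (l, j)) = (if i = j then 1 else 0)"
    and "i < m \<Longrightarrow> j < m \<Longrightarrow> (\<Sum>l<m. U $$ (i, l) * cnj (U $$ (j, l))) = (if i = j then 1 else 0)"
proof -
  show U: "U \<in> carrier_mat m m" using assms by (simp add: unitary_mat_def)
  show "i < m \<Longrightarrow> j < m \<Longrightarrow> (\<Sum>l<m. cnj (U $$ (l, i)) * U $$ (l, j)) = (if i = j then 1 else 0)"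
    using assms by (simp add: unitary_mat_iff)
  assume ij: "i < m" "j < m"
  have "(U * mat_adjoint U) $$ (i, j) = (\<Sum>l<m. U $$ (i, l) * cnj (U $$ (j, l)))"
    using ij by (simp add: mult_entry[OF U mat_adjoint_carrier[OF U]] mat_adjoint_entry[OF U])
  then show "(\<Sum>l<m. U $$ (i, l) * cnj (U $$ (j, l))) = (if i = j then 1 else 0)"
    using assms ij by (simp add: unitary_mat_def)
qed

lemma unitary_mat_entry_le_1:
  assumes "unitary_mat m U" "i < m" "j < m"
  shows "cmod (U $$ (i, j)) \<le> 1"
proof -
  have "(\<Sum>l<m. complex_of_real ((cmod (U $$ (l, j)))\<^sup>2)) = 1"
    using unitary_matD(2)[OF assms(1,3,3)]
    by (simp add: mult.commute complex_norm_square[symmetric] flip: of_real_power)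
  then have "(\<Sum>l<m. (cmod (U $$ (l, j)))\<^sup>2) = 1"
    by (metis of_real_eq_1_iff of_real_sum)
  moreover have "(cmod (U $$ (i, j)))\<^sup>2 \<le> (\<Sum>l<m. (cmod (U $$ (l, j)))\<^sup>2)"
    using assms(2) by (intro member_le_sum) auto
  ultimately show ?thesis by (simp add: power_le_one_iff)
qed

lemma mat_adjoint_mult:
  fixes A B :: "complex mat"
  assumes A: "A \<in> carrier_mat n k" and B: "B \<in> carrier_mat k p"
  shows "mat_adjoint (A * B) = mat_adjoint B * mat_adjoint A"
proof -
  note AB = mult_carrier_mat[OF A B]
  show ?thesis
  proof (rule eq_matI)
    show "dim_row (mat_adjoint (A * B)) = dim_row (mat_adjoint B * mat_adjoint A)"
      "dim_col (mat_adjoint (A * B)) = dim_col (mat_adjoint B * mat_adjoint A)"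
      using mat_adjoint_carrier[OF AB] mat_adjoint_carrier[OF A] mat_adjoint_carrier[OF B] by auto
    fix i j assume "i < dim_row (mat_adjoint B * mat_adjoint A)" "j < dim_col (mat_adjoint B * mat_adjoint A)"
    then have ij: "i < p" "j < n"
      using mat_adjoint_carrier[OF A] mat_adjoint_carrier[OF B] by auto
    then show "mat_adjoint (A * B) $$ (i, j) = (mat_adjoint B * mat_adjoint A) $$ (i, j)"
      by (simp add: mat_adjoint_entry[OF AB] mult_entry[OF A B] mat_adjoint_entry[OF A] mat_adjoint_entry[OF B]
        mult_entry[OF mat_adjoint_carrier[OF B] mat_adjoint_carrier[OF A]] mult.commute)
  qed
qed

lemma mat_adjoint_adjoint: "mat_adjoint (mat_adjoint A) = (A :: complex mat)"
proof -
  have A: "A \<in> carrier_mat (dim_row A) (dim_col A)" by simp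
  show ?thesis
    using mat_adjoint_carrier[OF mat_adjoint_carrier[OF A]]
    by (intro eq_matI) (auto simp: mat_adjoint_entry[OF A] mat_adjoint_entry[OF mat_adjoint_carrier[OF A]])
qed

lemma unitary_mat_adjoint: "unitary_mat m U \<Longrightarrow> unitary_mat m (mat_adjoint U)"
  by (auto simp: unitary_mat_def mat_adjoint_adjoint intro: mat_adjoint_carrier)

lemma mult_adjoint_cancel:
  assumes "unitary_mat m U" "B \<in> carrier_mat m k"
  shows "mat_adjoint U * (U * B) = B" "U * (mat_adjoint U * B) = B"
  using assms assoc_mult_mat[of U m m "mat_adjoint U" m B k] assoc_mult_mat[of "mat_adjoint U" m m U m B k]
  by (auto simp: unitary_mat_def mat_adjoint_carrier)

lemma unitary_mat_mult:
  assumes "unitary_mat m U" "unitary_mat m V"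
  shows "unitary_mat m (U * V)"
proof -
  note U = unitary_matD(1)[OF assms(1)] and V = unitary_matD(1)[OF assms(2)]
  have "mat_adjoint (U * V) * (U * V) = 1\<^sub>m m"
    using assms assoc_mult_mat[OF mat_adjoint_carrier[OF V] mat_adjoint_carrier[OF U] mult_carrier_mat[OF U V]]
      mult_adjoint_cancel(1)[OF assms(1) V]
    by (simp add: mat_adjoint_mult[OF U V] unitary_mat_def)
  moreover have "(U * V) * mat_adjoint (U * V) = 1\<^sub>m m"
    using assms assoc_mult_mat[OF U V mult_carrier_mat[OF mat_adjoint_carrier[OF V] mat_adjoint_carrier[OF U]]]
      mult_adjoint_cancel(2)[OF assms(2) mat_adjoint_carrier[OF U]]
    by (simp add: mat_adjoint_mult[OF U V] unitary_mat_def)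
  ultimately show ?thesis using U V by (simp add: unitary_mat_def)
qed

section \<open>Diagonal matrices in a unitary frame\<close>

definition diag_of :: "nat \<Rightarrow> (nat \<Rightarrow> complex) \<Rightarrow> complex mat" where
  "diag_of m d = mat m m (\<lambda>(i, j). if i = j then d i else 0)"

definition conj_diag :: "nat \<Rightarrow> complex mat \<Rightarrow> (nat \<Rightarrow> complex) \<Rightarrow> complex mat" where
  "conj_diag m V d = V * diag_of m d * mat_adjoint V"

lemma diag_of_carrier[simp]: "diag_of m d \<in> carrier_mat m m"
  by (simp add: diag_of_def)

lemma conj_diag_carrier: "V \<in> carrier_mat m m \<Longrightarrow> conj_diag m V d \<in> carrier_mat m m"
  by (auto simp: conj_diag_def intro!: mult_carrier_mat mat_adjoint_carrier)

lemma conj_diag_entry: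
  assumes V: "V \<in> carrier_mat m m" and i: "i < m" and l: "l < m"
  shows "conj_diag m V d $$ (i, l) = (\<Sum>j<m. V $$ (i, j) * d j * cnj (V $$ (l, j)))"
proof -
  have "(V * diag_of m d) $$ (i, j) = V $$ (i, j) * d j" if j: "j < m" for j
  proof -
    have "(V * diag_of m d) $$ (i, j) = (\<Sum>k<m. V $$ (i, k) * (if k = j then d k else 0))"
      using i j by (simp add: mult_entry[OF V diag_of_carrier]) (simp add: diag_of_def)
    also have "\<dots> = V $$ (i, j) * d j"
      using j by (simp add: if_distrib[of "\<lambda>x. _ * x"] sum.delta cong: if_cong)
    finally show ?thesis .
  qed
  then show ?thesis
    using i l by (simp add: conj_diag_def mat_adjoint_entry[OF V]
        mult_entry[OF mult_carrier_mat[OF V diag_of_carrier] mat_adjoint_carrier[OF V]])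
qed

lemma unitary_conj_diag:
  assumes V: "unitary_mat m V" and d: "\<And>j. j < m \<Longrightarrow> cmod (d j) = 1"
  shows "unitary_mat m (conj_diag m V d)"
proof -
  have "unitary_mat m (diag_of m d)"
    unfolding unitary_mat_iff
  proof (intro conjI allI impI)
    fix i j assume ij: "i < m" "j < m"
    have "(\<Sum>l<m. cnj (diag_of m d $$ (l, i)) * diag_of m d $$ (l, j)) = 
      (\<Sum>l<m. if l = i then (if i = j then d i * cnj (d i) else 0) else 0)"
      using ij by (intro sum.cong) (auto simp: diag_of_def)
    also have "\<dots> = (if i = j then 1 else 0)"
      using ij d by (simp add: complex_norm_square[symmetric])
    finally show "(\<Sum>l<m. cnj (diag_of m d $$ (l, i)) * diag_of m d $$ (l, j)) = (if i = j then 1 else 0)" .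
  qed simp
  then show ?thesis
    unfolding conj_diag_def by (intro unitary_mat_mult unitary_mat_adjoint V)
qed

lemma char_poly_conj_diag:
  assumes V: "unitary_mat m V"
  shows "char_poly (conj_diag m V d) = (\<Prod>j<m. [:- d j, 1:])"
proof -
  note Vc = unitary_matD(1)[OF V]
  have "similar_mat (conj_diag m V d) (diag_of m d)"
    unfolding similar_mat_def
  proof (intro exI)
    show "similar_mat_wit (conj_diag m V d) (diag_of m d) V (mat_adjoint V)"
      by (rule similar_mat_witI[of _ _ m])
        (use V Vc conj_diag_carrier[OF Vc] in \<open>auto simp: unitary_mat_def mat_adjoint_carrier conj_diag_def\<close>)
  qed
  then have "char_poly (conj_diag m V d) = char_poly (diag_of m d)"
    by (rule char_poly_similar)
  also have "\<dots> = (\<Prod>a\<leftarrow>diag_mat (diag_of m d). [:- a, 1:])"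
    by (rule char_poly_upper_triangular[OF diag_of_carrier]) (auto simp: diag_of_def)
  also have "diag_mat (diag_of m d) = map d [0..<m]"
    by (auto simp: diag_mat_def diag_of_def)
  finally show ?thesis
    by (simp add: prod.list_conv_set_nth o_def prod.distinct_set_conv_list[symmetric] atLeast0LessThan)
qed

lemma spectrum_conj_diag:
  assumes V: "unitary_mat m V"
  shows "spectrum_mat (conj_diag m V d) = d ` {..<m}"
  by (auto simp: spectrum_mat_def eigenvalue_root_char_poly[OF conj_diag_carrier[OF unitary_matD(1)[OF V]]]
      char_poly_conj_diag[OF V] poly_prod)

lemma conj_diag_eigen:
  assumes V: "unitary_mat m V" and i: "i < m" and j: "j < m"
  shows "(\<Sum>l<m. conj_diag m V d $$ (i, l) * V $$ (l, j)) = d j * V $$ (i, j)"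
proof -
  note Vc = unitary_matD(1)[OF V]
  have "(\<Sum>l<m. conj_diag m V d $$ (i, l) * V $$ (l, j))
     = (\<Sum>l<m. \<Sum>k<m. V $$ (i, k) * d k * (cnj (V $$ (l, k)) * V $$ (l, j)))"
    using i by (simp add: conj_diag_entry[OF Vc] sum_distrib_right mult.assoc)
  also have "\<dots> = (\<Sum>k<m. V $$ (i, k) * d k * (\<Sum>l<m. cnj (V $$ (l, k)) * V $$ (l, j)))"
    by (subst sum.swap) (simp add: sum_distrib_left)
  also have "\<dots> = (\<Sum>k<m. if k = j then V $$ (i, j) * d j else 0)"
    using j by (intro sum.cong) (auto simp: unitary_matD(2)[OF V])
  also have "\<dots> = d j * V $$ (i, j)"
    using j by simp
  finally show ?thesis .
qed

lemma mset_eq_if_prod_linear_eq: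
  fixes d d' :: "nat \<Rightarrow> complex"
  assumes "(\<Prod>j<m. [:- d j, 1:]) = (\<Prod>j<m. [:- d' j, 1:])"
  shows "image_mset d (mset_set {..<m}) = image_mset d' (mset_set {..<m})"
proof -
  have *: "proots (\<Prod>j<k. [:- d j, 1:]) = image_mset d (mset_set {..<k})" for k and d :: "nat \<Rightarrow> complex"
  proof (induction k)
    case (Suc k)
    have "(\<Prod>j<k. [:- d j, 1:]) \<noteq> 0" by simp
    moreover have "proots [:- d k, 1:] = {#d k#}"
      using proots_linear_factor[of "d k"] by simp
    ultimately show ?case
      using Suc proots_mult[of "[:- d k, 1:]" "\<Prod>j<k. [:- d j, 1:]"]
      by (simp add: lessThan_Suc del: mult_pCons_left)
  qed simp
  show ?thesis using assms * by metis
qed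

text \<open>Symmetric functions of the eigenvalues see only the characteristic polynomial. This
  removes the ambiguity in their ordering and is also the channel through which the relation between
  \<open>\<alpha> k\<close> and \<open>\<alpha> (- k)\<close> enters.\<close>

lemma sum_prod_eq_if_char_poly_eq:
  assumes "unitary_mat m V" "unitary_mat m V'"
    and "char_poly (conj_diag m V d) = char_poly (conj_diag m V' d')"
  shows "(\<Sum>j<m. g (d j)) = (\<Sum>j<m. g (d' j) :: real)" "(\<Prod>j<m. d j) = (\<Prod>j<m. d' j)"
proof -
  have *: "image_mset d (mset_set {..<m}) = image_mset d' (mset_set {..<m})"
    using assms by (intro mset_eq_if_prod_linear_eq) (simp add: char_poly_conj_diag)
  have "sum_mset (image_mset g (image_mset d (mset_set {..<m})))
      = sum_mset (image_mset g (image_mset d' (mset_set {..<m})))"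
    by (simp only: *)
  then show "(\<Sum>j<m. g (d j)) = (\<Sum>j<m. g (d' j) :: real)"
    by (simp add: sum_unfold_sum_mset image_mset.compositionality o_def)
  show "(\<Prod>j<m. d j) = (\<Prod>j<m. d' j)"
    using arg_cong[OF *, of prod_mset] by (simp add: prod_unfold_prod_mset)
qed

lemma conj_diag_mult:
  assumes W: "W \<in> carrier_mat m m" and V: "V \<in> carrier_mat m m"
  shows "conj_diag m (W * V) d = W * conj_diag m V d * mat_adjoint W"
proof -
  note aW = mat_adjoint_carrier[OF W] and aV = mat_adjoint_carrier[OF V]
  note D = diag_of_carrier[of m d]
  have "conj_diag m (W * V) d = W * V * diag_of m d * (mat_adjoint V * mat_adjoint W)"
    by (simp add: conj_diag_def mat_adjoint_mult[OF W V])
  also have "\<dots> = W * V * diag_of m d * mat_adjoint V * mat_adjoint W"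
    using W V aW aV D by (simp add: assoc_mult_mat[of _ m m _ m _ m] mult_carrier_mat[of _ m m _ m])
  also have "W * V * diag_of m d * mat_adjoint V = W * conj_diag m V d"
    using W V aW aV D unfolding conj_diag_def by (simp add: assoc_mult_mat[of _ m m _ m _ m] mult_carrier_mat[of _ m m _ m])
  finally show ?thesis .
qed

text \<open>Functional calculus is well defined. The change of frame \<open>W\<close> intertwines
  the two diagonal matrices, so \<open>W $$ (i, j)\<close> vanishes unless
  \<open>d' i = d j\<close>; hence it intertwines \<open>f'\<close> and \<open>f\<close> as well.
  Eigenvalues may be multiple, and the frames may differ by rotations inside eigenspaces.\<close>

lemma conj_diag_fun_cong:
  assumes V: "unitary_mat m V" and V': "unitary_mat m V'"
    and eq: "conj_diag m V d = conj_diag m V' d'"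
    and f: "\<And>i j. i < m \<Longrightarrow> j < m \<Longrightarrow> d i = d' j \<Longrightarrow> f i = f' j"
  shows "conj_diag m V f = conj_diag m V' f'"
proof -
  note Vc = unitary_matD(1)[OF V] and V'c = unitary_matD(1)[OF V']
  define U where "U = conj_diag m V d"
  have U': "U = conj_diag m V' d'" using eq U_def by simp
  define W where "W = mat_adjoint V' * V"
  note aV = mat_adjoint_carrier[OF Vc] and aV' = mat_adjoint_carrier[OF V'c]
  have Wc: "W \<in> carrier_mat m m" using Vc V'c aV' unfolding W_def by auto
  have UV: "U * V = V * diag_of m d"
    using Vc aV V unfolding U_def conj_diag_def
    by (simp add: assoc_mult_mat[of _ m m _ m _ m] mult_carrier_mat[of _ m m _ m] right_mult_one_mat[of _ m m] unitary_mat_def)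
  have V'U: "mat_adjoint V' * U = diag_of m d' * mat_adjoint V'"
    using V'c aV' mult_adjoint_cancel(1)[OF V', of "diag_of m d' * mat_adjoint V'" m] unfolding U' conj_diag_def
    by (simp add: assoc_mult_mat[of _ m m _ m _ m] mult_carrier_mat[of _ m m _ m])
  have Uc: "U \<in> carrier_mat m m" unfolding U_def by (rule conj_diag_carrier[OF Vc])
  have "diag_of m d' * W = mat_adjoint V' * U * V"
    unfolding W_def V'U using Vc aV' by (simp add: assoc_mult_mat[of _ m m _ m _ m] mult_carrier_mat[of _ m m _ m])
  also have "\<dots> = W * diag_of m d"
    unfolding W_def using Vc aV' Uc UV by (simp add: assoc_mult_mat[of _ m m _ m _ m] mult_carrier_mat[of _ m m _ m])
  finally have comm: "diag_of m d' * W = W * diag_of m d" .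
  have diag_l: "(diag_of m g * W) $$ (i, j) = g i * W $$ (i, j)" if "i < m" "j < m" for g i j
  proof -
    have "(diag_of m g * W) $$ (i, j) = (\<Sum>l<m. if l = i then g i * W $$ (i, j) else 0)"
      unfolding mult_entry[OF diag_of_carrier Wc that] using that
      by (intro sum.cong) (auto simp: diag_of_def)
    then show ?thesis using that by simp
  qed
  have diag_r: "(W * diag_of m g) $$ (i, j) = W $$ (i, j) * g j" if "i < m" "j < m" for g i j
  proof -
    have "(W * diag_of m g) $$ (i, j) = (\<Sum>l<m. if l = j then W $$ (i, j) * g j else 0)"
      unfolding mult_entry[OF Wc diag_of_carrier that] using that
      by (intro sum.cong) (auto simp: diag_of_def)
    then show ?thesis using that by simp
  qed
  have commf: "diag_of m f' * W = W * diag_of m f"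
  proof (rule eq_matI)
    fix i j assume "i < dim_row (W * diag_of m f)" "j < dim_col (W * diag_of m f)"
    then have ij: "i < m" "j < m" using Wc by (auto simp: diag_of_def)
    have "d' i * W $$ (i, j) = W $$ (i, j) * d j"
      unfolding diag_l[OF ij, symmetric] diag_r[OF ij, symmetric] comm ..
    then have "W $$ (i, j) = 0 \<or> d j = d' i" by auto
    then show "(diag_of m f' * W) $$ (i, j) = (W * diag_of m f) $$ (i, j)"
      using f[OF ij(2,1)] unfolding diag_l[OF ij] diag_r[OF ij] by auto
  qed (use Wc in \<open>auto simp: diag_of_def\<close>)
  have V_W: "V = V' * W"
    unfolding W_def using mult_adjoint_cancel(2)[OF V' Vc] by simp
  have "conj_diag m V f = V' * (W * diag_of m f) * mat_adjoint V"
    unfolding conj_diag_def using V'c Wc by (subst V_W) (simp add: assoc_mult_mat[OF V'c Wc diag_of_carrier])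
  also have "\<dots> = V' * (diag_of m f' * W) * mat_adjoint V" by (simp add: commf)
  also have "\<dots> = V' * diag_of m f' * (W * mat_adjoint V)"
    using V'c Wc aV by (simp add: assoc_mult_mat[of _ m m _ m _ m] mult_carrier_mat[of _ m m _ m])
  also have "W * mat_adjoint V = mat_adjoint V'"
    unfolding W_def using V Vc aV aV'
    by (simp add: assoc_mult_mat[of _ m m _ m _ m] mult_carrier_mat[of _ m m _ m] right_mult_one_mat[of _ m m] unitary_mat_def)
  finally show ?thesis by (simp add: conj_diag_def)
qed

text \<open>Gram-Schmidt started at \<open>v\<close> keeps \<open>v\<close> as its first vector. The
  vectors it returns are orthogonal but not normalised, so each column is divided by its norm; this
  is where the factor \<open>c\<close> comes from.\<close>

lemma unitary_mat_with_first_column: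
  fixes v :: "complex vec"
  assumes v: "v \<in> carrier_vec n" and v0: "v \<noteq> 0\<^sub>v n" and n: "0 < n"
  obtains W c where "unitary_mat n W" "\<And>i. i < n \<Longrightarrow> W $$ (i, 0) = c * v $ i"
proof -
  interpret cof_vec_space n "TYPE(complex)" .
  define b where "b = basis_completion v"
  define ws where "ws = gram_schmidt n b"
  from basis_completion[OF v v0, folded b_def]
  have span_b: "span (set b) = carrier_vec n" and dist_b: "distinct b" 
    and indep: "\<not> lin_dep (set b)" and b: "set b \<subseteq> carrier_vec n" and hdb: "hd b = v" 
    and len_b: "length b = n" by auto
  from hdb len_b n obtain vs where bv: "b = v # vs" by (cases b, auto)
  from gram_schmidt_result[OF b dist_b indep refl, folded ws_def]
  have ws: "set ws \<subseteq> carrier_vec n" "corthogonal ws" "length ws = n" 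
    by (auto simp: len_b)
  from gram_schmidt_hd[OF v, of vs, folded bv] have hdws: "hd ws = v" unfolding ws_def .
  then have ws0: "ws ! 0 = v" using ws(3) n by (cases ws) auto
  have dimw: "dim_vec (ws ! j) = n" if "j < n" for j
    using ws that by (metis carrier_vecD nth_mem subsetD)
  have ip: "(\<Sum>l<n. ws ! i $ l * cnj (ws ! j $ l)) = ws ! i \<bullet>c ws ! j" if "i < n" "j < n" for i j
    using that dimw by (simp add: scalar_prod_def atLeast0LessThan)
  define N where "N j = (\<Sum>l<n. (cmod (ws ! j $ l))\<^sup>2)" for j
  have ipN: "(\<Sum>l<n. ws ! j $ l * cnj (ws ! j $ l)) = complex_of_real (N j)" for j
    by (simp add: N_def complex_norm_square[symmetric] flip: of_real_power)
  have Npos: "N j > 0" if "j < n" for j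
  proof -
    have "complex_of_real (N j) \<noteq> 0"
      using ip[OF that that] ipN[of j] corthogonalD[OF ws(2), of j j] that ws(3) by auto
    moreover have "N j \<ge> 0" by (auto simp: N_def intro: sum_nonneg)
    ultimately show ?thesis by simp
  qed
  define W where "W = mat n n (\<lambda>(i, j). (ws ! j) $ i / complex_of_real (sqrt (N j)))"
  have "unitary_mat n W"
    unfolding unitary_mat_iff
  proof (intro conjI allI impI)
    fix i j assume ij: "i < n" "j < n"
    have "(\<Sum>l<n. cnj (W $$ (l, i)) * W $$ (l, j))
       = (\<Sum>l<n. ws ! j $ l * cnj (ws ! i $ l)) / (complex_of_real (sqrt (N i)) * complex_of_real (sqrt (N j)))"
      using ij by (simp add: W_def sum_divide_distrib mult.commute)
    also have "\<dots> = (if i = j then 1 else 0)"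
    proof (cases "i = j")
      case True
      have "complex_of_real (sqrt (N j)) * complex_of_real (sqrt (N j)) = complex_of_real (N j)"
        using Npos[OF ij(2)] by (simp flip: of_real_mult)
      then show ?thesis using True Npos[OF ij(2)] by (simp add: ipN)
    next
      case False
      then have "ws ! j \<bullet>c ws ! i = 0" using corthogonalD[OF ws(2)] ij ws(3) by auto
      then show ?thesis using False by (simp only: ip[OF ij(2,1)] if_False) simp
    qed
    finally show "(\<Sum>l<n. cnj (W $$ (l, i)) * W $$ (l, j)) = (if i = j then 1 else 0)" .
  qed (simp add: W_def)
  moreover have "W $$ (i, 0) = (1 / complex_of_real (sqrt (N 0))) * v $ i" if "i < n" for i
    using that n by (simp add: W_def ws0)
  ultimately show ?thesis using that by blast
qed

text \<open>Deflation: in a unitary frame that begins with an eigenvector the matrix splits off a 1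
  x 1 block, and the remaining block is again unitary.\<close>

theorem unitary_spectral_decomposition:
  assumes "unitary_mat m U"
  shows "\<exists>V d. unitary_mat m V \<and> (\<forall>j<m. cmod (d j) = 1) \<and> U = conj_diag m V d"
  using assms
proof (induction m arbitrary: U)
  case 0
  have "unitary_mat 0 (1\<^sub>m 0)" by (simp add: unitary_mat_iff)
  moreover have "U = conj_diag 0 (1\<^sub>m 0) (\<lambda>_. 1)"
    using unitary_matD(1)[OF 0] conj_diag_carrier[of "1\<^sub>m 0 :: complex mat" 0 "\<lambda>_. 1"] by (intro eq_matI) auto
  ultimately show ?case by blast
next
  case (Suc n U)
  note U = unitary_matD(1)[OF Suc.prems]
  obtain as where as: "char_poly U = (\<Prod>a\<leftarrow>as. [:- a, 1:])" "length as = Suc n"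
    using char_poly_factorized[OF U] by blast
  then obtain e as' where "as = e # as'" by (cases as) auto
  then have "eigenvalue U e"
    using as by (simp add: eigenvalue_root_char_poly[OF U])
  then obtain v where v: "v \<in> carrier_vec (Suc n)" "v \<noteq> 0\<^sub>v (Suc n)" "U *\<^sub>v v = e \<cdot>\<^sub>v v"
    using U by (auto simp: eigenvalue_def eigenvector_def)
  obtain W c where W: "unitary_mat (Suc n) W" and W0: "\<And>i. i < Suc n \<Longrightarrow> W $$ (i, 0) = c * v $ i"
    using unitary_mat_with_first_column[OF v(1,2)] by blast
  note Wc = unitary_matD(1)[OF W]
  note aW = mat_adjoint_carrier[OF Wc]
  define A where "A = mat_adjoint W * (U * W)"
  have A: "unitary_mat (Suc n) A"
    unfolding A_def by (intro unitary_mat_mult unitary_mat_adjoint W Suc.prems)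
  have UW0: "(U * W) $$ (i, 0) = e * W $$ (i, 0)" if i: "i < Suc n" for i
  proof -
    have "(U *\<^sub>v v) $ i = (\<Sum>l<Suc n. U $$ (i, l) * v $ l)"
      using U v(1) i by (simp add: mult_mat_vec_def scalar_prod_def atLeast0LessThan del: sum.lessThan_Suc)
    then have "(\<Sum>l<Suc n. U $$ (i, l) * v $ l) = e * v $ i"
      using v i by simp
    then have "c * (\<Sum>l<Suc n. U $$ (i, l) * v $ l) = e * (c * v $ i)"
      by simp
    then show ?thesis
      using i by (simp add: mult_entry[OF U Wc] W0 sum_distrib_left algebra_simps del: sum.lessThan_Suc)
  qed
  have A0: "A $$ (i, 0) = (if i = 0 then e else 0)" if i: "i < Suc n" for i
  proof -
    have "A $$ (i, 0) = e * (\<Sum>l<Suc n. cnj (W $$ (l, i)) * W $$ (l, 0))"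
      using i unfolding A_def
      by (simp add: mult_entry[OF aW mult_carrier_mat[OF U Wc]] mat_adjoint_entry[OF Wc] UW0
          sum_distrib_left algebra_simps del: sum.lessThan_Suc)
    then show ?thesis using unitary_matD(2)[OF W i, of 0] by simp
  qed
  have "cnj e * e = 1"
    using unitary_matD(2)[OF A, of 0 0] A0 by (simp add: sum.lessThan_Suc_shift del: sum.lessThan_Suc)
  then have "complex_of_real ((cmod e)\<^sup>2) = 1"
    by (simp only: complex_norm_square mult.commute)
  then have "(cmod e)\<^sup>2 = 1" by (simp only: of_real_eq_1_iff)
  then have e: "cmod e = 1" by (simp add: power2_eq_1_iff) (smt (verit) norm_ge_zero)
  then have e0: "e \<noteq> 0" by auto
  \<comment> \<open>Column 0 is \<open>e\<close> times the first basis vector with \<open>e\<close>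
    nonzero, so orthogonality of the columns clears row 0 and the matrix becomes block
    diagonal.\<close>
  have A0': "A $$ (0, Suc j) = 0" if j: "j < n" for j
    using unitary_matD(2)[OF A, of 0 "Suc j"] A0 j e0
    by (simp add: sum.lessThan_Suc_shift del: sum.lessThan_Suc)
  define B where "B = mat n n (\<lambda>(i, j). A $$ (Suc i, Suc j))"
  have "unitary_mat n B"
    unfolding unitary_mat_iff
  proof (intro conjI allI impI)
    fix i j assume ij: "i < n" "j < n"
    then show "(\<Sum>l<n. cnj (B $$ (l, i)) * B $$ (l, j)) = (if i = j then 1 else 0)"
      using unitary_matD(2)[OF A, of "Suc i" "Suc j"] A0'
      by (simp add: B_def sum.lessThan_Suc_shift del: sum.lessThan_Suc)
  qed (simp add: B_def)
  then obtain V d where V: "unitary_mat n V" and d: "\<forall>j<n. cmod (d j) = 1" and B_eq: "B = conj_diag n V d"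
    using Suc.IH by blast
  define d' where "d' = case_nat e d"
  define V' where "V' = mat (Suc n) (Suc n) (\<lambda>(i, j). case i of 0 \<Rightarrow> (if j = 0 then 1 else 0)
     | Suc i' \<Rightarrow> (case j of 0 \<Rightarrow> 0 | Suc j' \<Rightarrow> V $$ (i', j')))"
  have V'c: "V' \<in> carrier_mat (Suc n) (Suc n)" by (simp add: V'_def)
  have V'e: "V' $$ (0, 0) = 1" "j < n \<Longrightarrow> V' $$ (0, Suc j) = 0" "j < n \<Longrightarrow> V' $$ (Suc j, 0) = 0"
    "i < n \<Longrightarrow> j < n \<Longrightarrow> V' $$ (Suc i, Suc j) = V $$ (i, j)" for i j
    by (auto simp: V'_def)
  have V': "unitary_mat (Suc n) V'"
    unfolding unitary_mat_iff
  proof (intro conjI allI impI)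
    fix i j assume ij: "i < Suc n" "j < Suc n"
    show "(\<Sum>l<Suc n. cnj (V' $$ (l, i)) * V' $$ (l, j)) = (if i = j then 1 else 0)"
      using ij unitary_matD(2)[OF V]
      by (cases i; cases j) (auto simp: sum.lessThan_Suc_shift V'e simp del: sum.lessThan_Suc)
  qed (rule V'c)
  have "A = conj_diag (Suc n) V' d'"
  proof (rule eq_matI)
    fix i j assume "i < dim_row (conj_diag (Suc n) V' d')" "j < dim_col (conj_diag (Suc n) V' d')"
    then have ij: "i < Suc n" "j < Suc n" using conj_diag_carrier[OF V'c, of d'] by auto
    have "A $$ (Suc i', Suc j') = (\<Sum>l<n. V $$ (i', l) * d l * cnj (V $$ (j', l)))" if "i' < n" "j' < n" for i' j'
      using that conj_diag_entry[OF unitary_matD(1)[OF V] that, of d, folded B_eq] by (simp add: B_def)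
    then show "A $$ (i, j) = conj_diag (Suc n) V' d' $$ (i, j)"
      using ij A0[of i] A0'
      by (cases i; cases j)
         (auto simp: conj_diag_entry[OF V'c] sum.lessThan_Suc_shift V'e d'_def simp del: sum.lessThan_Suc)
  qed (use unitary_matD(1)[OF A] conj_diag_carrier[OF V'c, of d'] in auto)
  then have "conj_diag (Suc n) (W * V') d' = W * A * mat_adjoint W"
    by (simp add: conj_diag_mult[OF Wc V'c])
  also have "W * A = U * W"
    unfolding A_def by (rule mult_adjoint_cancel(2)[OF W mult_carrier_mat[OF U Wc]])
  also have "U * W * mat_adjoint W = U"
    using assoc_mult_mat[OF U Wc aW] W U by (simp add: unitary_mat_def)
  finally have "U = conj_diag (Suc n) (W * V') d'" ..
  moreover have "\<forall>j<Suc n. cmod (d' j) = 1"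
    using d e by (auto simp: d'_def split: nat.splits)
  ultimately show ?case using unitary_mat_mult[OF W V'] by blast
qed

section \<open>Compactness of spectral decompositions\<close>

lemma bounded_convergent_subsequence_finite:
  fixes x :: "nat \<Rightarrow> 'i \<Rightarrow> complex"
  assumes "finite I" "\<And>n i. i \<in> I \<Longrightarrow> norm (x n i) \<le> B"
  shows "\<exists>r l. strict_mono (r :: nat \<Rightarrow> nat) \<and> (\<forall>i\<in>I. (\<lambda>n. x (r n) i) \<longlonglongrightarrow> l i)"
  using assms
proof (induction I rule: finite_induct)
  case empty
  show ?case by (intro exI[of _ id]) (auto simp: strict_mono_def)
next
  case (insert a I)
  have "\<exists>r l. strict_mono (r :: nat \<Rightarrow> nat) \<and> (\<forall>i\<in>I. (\<lambda>n. x (r n) i) \<longlonglongrightarrow> l i)"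
    by (rule insert.IH) (use insert.prems in auto)
  then obtain r l where r: "strict_mono (r :: nat \<Rightarrow> nat)" "\<And>i. i \<in> I \<Longrightarrow> (\<lambda>n. x (r n) i) \<longlonglongrightarrow> l i"
    by blast
  have "bounded (range (\<lambda>n. x (r n) a))"
    using insert.prems by (auto simp: bounded_iff)
  then obtain y r' where r': "strict_mono (r' :: nat \<Rightarrow> nat)" "((\<lambda>n. x (r n) a) \<circ> r') \<longlonglongrightarrow> y"
    using bounded_imp_convergent_subsequence by blast
  have "(\<lambda>n. x ((r \<circ> r') n) i) \<longlonglongrightarrow> (l(a := y)) i" if "i \<in> insert a I" for i
  proof (cases "i = a")
    case True then show ?thesis using r' by (simp add: o_def)
  next
    case False
    then have "((\<lambda>n. x (r n) i) \<circ> r') \<longlonglongrightarrow> l i"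
      using that r(2) r'(1) by (intro LIMSEQ_subseq_LIMSEQ) auto
    then show ?thesis using False by (simp add: o_def)
  qed
  then show ?case using strict_mono_o[OF r(1) r'(1)] by blast
qed

lemma spectral_decomposition_subsequence:
  assumes V: "\<And>n. unitary_mat m (V n)" and d: "\<And>n j. j < m \<Longrightarrow> cmod (d n j) = 1"
  shows "\<exists>r V' d'. strict_mono (r :: nat \<Rightarrow> nat) \<and> unitary_mat m V' \<and> (\<forall>j<m. cmod (d' j) = 1) \<and>
    (\<forall>i<m. \<forall>j<m. (\<lambda>n. V (r n) $$ (i, j)) \<longlonglongrightarrow> V' $$ (i, j)) \<and> (\<forall>j<m. (\<lambda>n. d (r n) j) \<longlonglongrightarrow> d' j)"
proof -
  \<comment> \<open>Pairs with first component \<open>m\<close> are free as matrix positions and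
    hold the eigenvalues, so a single extraction serves eigenvectors and eigenvalues
    together.\<close>
  define x where "x n p = (if fst p = m then d n (snd p) else V n $$ p)" for n and p :: "nat \<times> nat"
  have "\<exists>r l. strict_mono (r :: nat \<Rightarrow> nat) \<and> (\<forall>p\<in>{..m}\<times>{..<m}. (\<lambda>n. x (r n) p) \<longlonglongrightarrow> l p)"
    by (rule bounded_convergent_subsequence_finite[where B = 1])
       (auto simp: x_def d intro!: unitary_mat_entry_le_1[OF V])
  then obtain r l where r: "strict_mono (r :: nat \<Rightarrow> nat)"
    and l: "\<And>i j. i \<le> m \<Longrightarrow> j < m \<Longrightarrow> (\<lambda>n. x (r n) (i, j)) \<longlonglongrightarrow> l (i, j)"
    by force
  define V' where "V' = mat m m l"
  define d' where "d' j = l (m, j)" for j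
  have Vl: "(\<lambda>n. V (r n) $$ (i, j)) \<longlonglongrightarrow> V' $$ (i, j)" if "i < m" "j < m" for i j
    using l[of i j] that by (simp add: x_def V'_def)
  have dl: "(\<lambda>n. d (r n) j) \<longlonglongrightarrow> d' j" if "j < m" for j
    using l[of m j] that by (simp add: x_def d'_def)
  have "unitary_mat m V'"
    unfolding unitary_mat_iff
  proof (intro conjI allI impI)
    fix i j assume ij: "i < m" "j < m"
    have "(\<lambda>n. \<Sum>l<m. cnj (V (r n) $$ (l, i)) * V (r n) $$ (l, j)) \<longlonglongrightarrow> (\<Sum>l<m. cnj (V' $$ (l, i)) * V' $$ (l, j))"
      using ij by (intro tendsto_intros Vl) auto
    then show "(\<Sum>l<m. cnj (V' $$ (l, i)) * V' $$ (l, j)) = (if i = j then 1 else 0)"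
      using ij by (simp add: unitary_matD(2)[OF V] LIMSEQ_const_iff)
  qed (simp add: V'_def)
  moreover have "cmod (d' j) = 1" if "j < m" for j
    using tendsto_norm[OF dl[OF that]] that by (simp add: d LIMSEQ_const_iff)
  ultimately show ?thesis using r Vl dl by blast
qed

lemma tendsto_conj_diag:
  assumes "\<And>n. V n \<in> carrier_mat m m" "V' \<in> carrier_mat m m" "i < m" "l < m"
    and "\<And>i j. i < m \<Longrightarrow> j < m \<Longrightarrow> (\<lambda>n. V n $$ (i, j)) \<longlonglongrightarrow> V' $$ (i, j)"
    and "\<And>j. j < m \<Longrightarrow> (\<lambda>n. d n j) \<longlonglongrightarrow> d' j"
  shows "(\<lambda>n. conj_diag m (V n) (d n) $$ (i, l)) \<longlonglongrightarrow> conj_diag m V' d' $$ (i, l)"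
  using assms by (simp add: conj_diag_entry) (intro tendsto_intros; simp)

section \<open>Staircase functions on the circle\<close>

text \<open>The real lift of the circle map \<open>w \<mapsto> w * cis (angular_step s w)\<close> is a continuous staircase
  that rises by \<open>2 pi\<close> over the interval \<open>{- s .. s}\<close> and its translates, and is constant
  elsewhere.\<close>

definition angular_step :: "real \<Rightarrow> complex \<Rightarrow> real" where
  "angular_step s w = max (- pi) (min pi (pi * Arg w / s)) - Arg w"

definition lifted_step :: "real \<Rightarrow> real \<Rightarrow> real" where
  "lifted_step s u = u + angular_step s (cis u)"

lemma cis_add_2pi_int: "cis (x + 2 * pi * of_int n) = cis x"
  by (metis cis_mult cis_multiple_2pi Ints_of_int mult.right_neutral)

lemma lifted_step_add_2pi: "lifted_step s (u + 2 * pi * of_int n) = lifted_step s u + 2 * pi * of_int n"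
  by (simp add: lifted_step_def cis_add_2pi_int)

lemma exists_principal_representative:
  obtains n :: int and a where "u = a + 2 * pi * of_int n" "- pi < a" "a \<le> pi"
proof -
  define n where "n = \<lceil>(u - pi) / (2 * pi)\<rceil>"
  have "of_int n < (u - pi) / (2 * pi) + 1" "(u - pi) / (2 * pi) \<le> of_int n"
    unfolding n_def by linarith+
  then have "2 * pi * of_int n < (u - pi) + 2 * pi" "u - pi \<le> 2 * pi * of_int n"
    by (simp_all add: field_simps)
  then show ?thesis using that[of "u - 2 * pi * of_int n" n] by simp
qed

context
  fixes s :: real
  assumes s: "0 < s" "s < pi"
begin

lemma lifted_step_principal:
  assumes "- pi \<le> u" "u \<le> pi"
  shows "lifted_step s u = max (- pi) (min pi (pi * u / s))"
proof (cases "u = - pi")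
  case True
  have "pi * pi / s \<ge> pi" using s by (simp add: field_simps)
  then have "lifted_step s pi = pi"
    by (simp add: lifted_step_def angular_step_def Arg_cis del: cis_pi)
  \<comment> \<open>\<open>Arg\<close> takes the value pi but never - pi, so the left endpoint is
    obtained from the right one by translation.\<close>
  then have "lifted_step s (- pi) = - pi"
    using lifted_step_add_2pi[of s "- pi" 1] by simp
  then show ?thesis using True \<open>pi * pi / s \<ge> pi\<close> by simp
next
  case False
  then show ?thesis using assms by (simp add: lifted_step_def angular_step_def Arg_cis)
qed

lemma lifted_step_mono: "u \<le> v \<Longrightarrow> lifted_step s u \<le> lifted_step s v"
proof -
  assume uv: "u \<le> v"
  obtain n a where u: "u = a + 2 * pi * of_int n" "- pi < a" "a \<le> pi"
    by (rule exists_principal_representative)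
  obtain k b where v: "v = b + 2 * pi * of_int k" "- pi < b" "b \<le> pi"
    by (rule exists_principal_representative)
  have *: "lifted_step s u = max (- pi) (min pi (pi * a / s)) + 2 * pi * of_int n"
    "lifted_step s v = max (- pi) (min pi (pi * b / s)) + 2 * pi * of_int k"
    using u v by (simp_all add: lifted_step_add_2pi lifted_step_principal)
  have "2 * pi * real_of_int n < 2 * pi * real_of_int (k + 1)"
    using u v uv by (simp add: algebra_simps)
  then have "real_of_int n < real_of_int (k + 1)" by (subst (asm) mult_less_cancel_left_pos) auto
  then have "n \<le> k" by linarith
  then consider "n = k" | "n + 1 \<le> k" by linarith
  then show ?thesis
  proof cases
    case 1
    then have "pi * a / s \<le> pi * b / s"
      using u v uv s by (simp add: divide_right_mono)
    then show ?thesis using 1 unfolding * by auto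
  next
    case 2
    have "2 * pi * real_of_int (n + 1) \<le> 2 * pi * real_of_int k"
      by (rule mult_left_mono) (use 2 in auto)
    then have "2 * pi * real_of_int n + 2 * pi \<le> 2 * pi * real_of_int k"
      by (simp add: algebra_simps)
    moreover have "max (- pi) (min pi (pi * a / s)) \<le> pi" "- pi \<le> max (- pi) (min pi (pi * b / s))"
      by auto
    ultimately show ?thesis unfolding * by linarith
  qed
qed

lemma lifted_step_minus: "lifted_step s (- u) = - lifted_step s u"
proof -
  obtain n a where u: "u = a + 2 * pi * of_int n" "- pi < a" "a \<le> pi"
    by (rule exists_principal_representative)
  have eq: "- u = - a + 2 * pi * of_int (- n)" using u by simp
  have "lifted_step s (- a) = - lifted_step s a"
    using u by (simp add: lifted_step_principal max_def min_def)
  then show ?thesis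
    unfolding eq unfolding lifted_step_add_2pi using u by (simp add: lifted_step_add_2pi)
qed

lemma lifted_step_0: "lifted_step s 0 = 0"
  using lifted_step_minus[of 0] by simp

lemma lifted_step_ge_pi: "s \<le> u \<Longrightarrow> pi \<le> lifted_step s u"
  using lifted_step_mono[of s u] s by (simp add: lifted_step_principal)

lemma lifted_step_pos: "0 < u \<Longrightarrow> 0 < lifted_step s u"
proof -
  assume u: "0 < u"
  define v where "v = min u s"
  have v: "0 < v" "v \<le> s" "v \<le> u" using u s by (auto simp: v_def)
  then have "0 < pi * v / s" using s by simp
  then have "0 < lifted_step s v" using v s by (simp add: lifted_step_principal less_max_iff_disj)
  also have "\<dots> \<le> lifted_step s u" by (rule lifted_step_mono) (rule v)
  finally show ?thesis .
qed

lemma abs_angular_step_le: "\<bar>angular_step s w\<bar> \<le> pi"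
proof -
  have "- pi < Arg w" "Arg w \<le> pi" using Arg_bounded by auto
  moreover have "0 \<le> pi * Arg w / s \<longleftrightarrow> 0 \<le> Arg w"
    using s by (simp add: zero_le_divide_iff zero_le_mult_iff)
  ultimately show ?thesis by (auto simp: angular_step_def max_def min_def)
qed

text \<open>Across the negative axis \<open>Arg\<close> jumps by 2 pi, but so does the clamped term:
  it already equals pi or - pi once the angle exceeds \<open>s\<close>. Near the axis the two jumps
  cancel and the function is \<open>- Arg (- z)\<close>.\<close>

lemma isCont_angular_step:
  assumes "w \<noteq> 0"
  shows "isCont (angular_step s) w"
proof (cases "w \<in> \<real>\<^sub>\<le>\<^sub>0")
  case False
  then show ?thesis
    unfolding angular_step_def using continuous_at_Arg[OF False] s by (intro continuous_intros) auto
next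
  case True
  then have neg: "- w \<notin> \<real>\<^sub>\<le>\<^sub>0" using assms
    by (auto simp: complex_nonpos_Reals_iff complex_eq_iff)
  have c: "isCont (\<lambda>z. Arg (- z)) w"
    by (rule isCont_o2[where f = uminus and g = Arg]) (use continuous_at_Arg[OF neg] in \<open>auto intro: continuous_intros\<close>)
  have "Arg (- w) = 0"
    using True assms by (auto simp: Arg_eq_0 complex_nonpos_Reals_iff complex_is_Real_iff)
  moreover have "((\<lambda>z. Arg (- z)) \<longlongrightarrow> Arg (- w)) (nhds w)"
    using tendsto_at_iff_tendsto_nhds[where g = "\<lambda>z. Arg (- z)" and l = w] c by (simp add: isCont_def)
  ultimately have "\<forall>\<^sub>F z in nhds w. \<bar>Arg (- z)\<bar> < pi - s"
    using s by (auto dest!: tendstoD[where e = "pi - s"])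
  moreover have "\<forall>\<^sub>F z in nhds w. z \<noteq> 0"
    using assms by (intro t1_space_nhds) auto
  ultimately have "\<forall>\<^sub>F z in nhds w. angular_step s z = - Arg (- z)"
  proof eventually_elim
    case (elim z)
    then have A: "Arg (- z) = (if Arg z \<le> 0 then Arg z + pi else Arg z - pi)"
      by (intro Arg_minus)
    have B: "- pi < Arg z" "Arg z \<le> pi" using Arg_bounded by auto
    show ?case
    proof (cases "Arg z \<le> 0")
      case True
      then have "Arg z \<le> - s" using elim A by auto
      then have "pi * Arg z / s \<le> - pi" using s mult_left_mono[of "Arg z" "- s" pi] by (simp add: field_simps)
      then show ?thesis using True A by (auto simp: angular_step_def)
    next
      case False
      then have "s \<le> Arg z" using elim A by auto
      then have "pi \<le> pi * Arg z / s" using s by (simp add: field_simps)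
      then show ?thesis using False A by (auto simp: angular_step_def)
    qed
  qed
  then have "isCont (angular_step s) w \<longleftrightarrow> isCont (\<lambda>z. - Arg (- z)) w"
    by (rule isCont_cong)
  then show ?thesis using c by simp
qed

end

text \<open>Both staircases make their whole jump within distance \<open>s\<close> of 0. If
  \<open>u\<close> (reduced to the principal interval) is at least \<open>- s\<close>, then
  \<open>u + \<omega>\<close> lies beyond the jump of the wide staircase; otherwise the sharp one
  has not yet left its lower level. Oddness gives the second inequality.\<close>

lemma lifted_step_shift:
  assumes "0 < s'" "s' \<le> s" "s < pi" "2 * s \<le> \<omega>"
  shows "lifted_step s' u \<le> lifted_step s (u + \<omega>)" "lifted_step s (u - \<omega>) \<le> lifted_step s' u"
proof -
  have up: "lifted_step s' u \<le> lifted_step s (u + \<omega>)" for u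
  proof -
    obtain n a where u: "u = a + 2 * pi * of_int n" "- pi < a" "a \<le> pi"
      by (rule exists_principal_representative)
    have "lifted_step s' a \<le> lifted_step s (a + \<omega>)"
    proof (cases "- s \<le> a")
      case True
      then have "pi \<le> lifted_step s (a + \<omega>)" using assms by (intro lifted_step_ge_pi) auto
      moreover have "lifted_step s' a \<le> pi" using u assms by (simp add: lifted_step_principal)
      ultimately show ?thesis by linarith
    next
      case False
      then have "a \<le> - s'" using assms by auto
      then have "pi * a / s' \<le> - pi" using assms mult_left_mono[of a "- s'" pi] by (simp add: field_simps)
      then have "lifted_step s' a = - pi" using u assms by (simp add: lifted_step_principal)
      also have "- pi \<le> lifted_step s (- pi)" using assms by (simp add: lifted_step_principal)
      also have "\<dots> \<le> lifted_step s (a + \<omega>)" using assms u by (intro lifted_step_mono) auto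
      finally show ?thesis .
    qed
    moreover have "u + \<omega> = (a + \<omega>) + 2 * pi * of_int n" using u by simp
    ultimately show ?thesis using u by (simp only: lifted_step_add_2pi)
  qed
  show "lifted_step s' u \<le> lifted_step s (u + \<omega>)" by (rule up)
  have "- lifted_step s' u \<le> - lifted_step s (u - \<omega>)"
    using up[of "- u"] assms lifted_step_minus[of s' u] lifted_step_minus[of s "u - \<omega>"] by simp
  then show "lifted_step s (u - \<omega>) \<le> lifted_step s' u" by simp
qed

text \<open>A lift of a circle map of degree \<open>m\<close>. The summands involve the points
  \<open>d j\<close> of the circle rather than their angles, so the value depends on the spectrum as
  a multiset only. The case \<open>t = 1\<close> is the sum of staircases; \<open>t < 1\<close>
  mixes in the rotation part \<open>m * x\<close>, which makes it strictly increasing.\<close>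

definition step_phase :: "nat \<Rightarrow> real \<Rightarrow> real \<Rightarrow> (nat \<Rightarrow> complex) \<Rightarrow> real \<Rightarrow> real" where
  "step_phase m t s d x = real m * x + t * (\<Sum>j<m. angular_step s (cis x * cnj (d j)))"

lemma step_phase_add_2pi: "step_phase m t s d (x + 2 * pi * of_int n) = step_phase m t s d x + 2 * pi * of_int (int m * n)"
  by (simp only: step_phase_def cis_add_2pi_int) (simp add: algebra_simps)

lemma cnj_eq_cis: "cmod z = 1 \<Longrightarrow> cnj z = cis (- Arg z)"
proof -
  assume z: "cmod z = 1"
  then have "cis (Arg z) = z" by (subst cis_Arg) (auto simp: sgn_eq)
  then show ?thesis by (metis cis_cnj)
qed
lemma step_phase_interpolate:
  "step_phase m t s d x = (1 - t) * (real m * x) + t * step_phase m 1 s d x"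
  by (simp add: step_phase_def algebra_simps)

context
  fixes m :: nat and d :: "nat \<Rightarrow> complex"
  assumes d: "\<And>j. j < m \<Longrightarrow> cmod (d j) = 1"
begin

lemma step_phase_conv_lifted:
  "step_phase m 1 s d x = (\<Sum>j<m. lifted_step s (x - Arg (d j)) + Arg (d j))"
proof -
  have "(\<Sum>j<m. lifted_step s (x - Arg (d j)) + Arg (d j)) = (\<Sum>j<m. x + angular_step s (cis x * cnj (d j)))"
    using d by (intro sum.cong) (simp_all add: lifted_step_def cnj_eq_cis cis_mult)
  then show ?thesis by (simp add: step_phase_def sum.distrib)
qed

lemma step_phase_strict_mono:
  assumes "0 < s" "s < pi" "0 \<le> t" "t < 1" "0 < m" "x < y"
  shows "step_phase m t s d x < step_phase m t s d y"
proof -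
  have "step_phase m 1 s d x \<le> step_phase m 1 s d y"
    unfolding step_phase_conv_lifted
    using assms lifted_step_mono[OF assms(1,2)] by (intro sum_mono) auto
  moreover have "(1 - t) * (real m * x) < (1 - t) * (real m * y)"
    using assms by simp
  ultimately show ?thesis
    unfolding step_phase_interpolate[of m t] using assms by (intro add_less_le_mono mult_left_mono) auto
qed

lemma step_phase_dist:
  assumes "0 < s" "s < pi" "t \<le> 1"
  shows "\<bar>step_phase m t s d x - step_phase m 1 s d x\<bar> \<le> (1 - t) * (real m * pi)"
proof -
  have "\<bar>\<Sum>j<m. angular_step s (cis x * cnj (d j))\<bar> \<le> (\<Sum>j<m. pi)"
    by (rule order_trans[OF sum_abs sum_mono]) (rule abs_angular_step_le[OF assms(1,2)])
  then have "(1 - t) * \<bar>\<Sum>j<m. angular_step s (cis x * cnj (d j))\<bar> \<le> (1 - t) * (real m * pi)"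
    using assms by (intro mult_left_mono) auto
  moreover have "step_phase m t s d x - step_phase m 1 s d x
      = - ((1 - t) * (\<Sum>j<m. angular_step s (cis x * cnj (d j))))"
    by (simp add: step_phase_def algebra_simps)
  ultimately show ?thesis using assms by (simp add: abs_mult)
qed

lemma cis_eq_imp_diff:
  assumes "i < m" "cis x = d i"
  obtains n where "x - Arg (d i) = 2 * pi * of_int n"
proof -
  have "Arg (d i) = Arg (cis x)" using assms by simp
  obtain n a where x: "x = a + 2 * pi * of_int n" "- pi < a" "a \<le> pi"
    by (rule exists_principal_representative)
  then have "d i = cis a" using assms by (simp add: cis_add_2pi_int flip: assms(2))
  then have "Arg (d i) = a" using x by (simp add: Arg_cis)
  then show ?thesis using x that by simp
qed

text \<open>At an eigenangle \<open>x\<close> the summand of \<open>d i\<close> sits in the middle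
  of its jump and gains at least pi when moved by \<open>\<omega>\<close>, while by
  \<open>lifted_step_shift\<close> no other summand loses anything. This margin pi absorbs all
  errors in the comparison of \<open>\<alpha>\<close> with \<open>\<beta>\<close>.\<close>

lemma step_phase_shift:
  assumes s: "0 < s'" "s' \<le> s" "s < pi" "2 * s \<le> \<omega>" and i: "i < m" "cis x = d i"
  shows "step_phase m 1 s' d x + pi \<le> step_phase m 1 s d (x + \<omega>)"
    and "step_phase m 1 s d (x - \<omega>) + pi \<le> step_phase m 1 s' d x"
proof -
  obtain n where n: "x - Arg (d i) = 2 * pi * of_int n" using cis_eq_imp_diff[OF i] .
  have s': "0 < s" "s' < pi" using s by auto
  have at: "lifted_step s' (x - Arg (d i)) = 2 * pi * of_int n"
    using lifted_step_add_2pi[of s' 0 n] lifted_step_0[OF s(1) s'(2)] by (simp add: n)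
  have "pi \<le> lifted_step s \<omega>" using s by (intro lifted_step_ge_pi) auto
  moreover have "lifted_step s (- \<omega>) = - lifted_step s \<omega>" using s by (intro lifted_step_minus) auto
  moreover have "lifted_step s (x + \<omega> - Arg (d i)) = lifted_step s \<omega> + 2 * pi * of_int n"
    "lifted_step s (x - \<omega> - Arg (d i)) = lifted_step s (- \<omega>) + 2 * pi * of_int n"
    using lifted_step_add_2pi[of s \<omega> n] lifted_step_add_2pi[of s "- \<omega>" n] n by (simp_all add: algebra_simps)
  ultimately have own: "lifted_step s' (x - Arg (d i)) + pi \<le> lifted_step s (x + \<omega> - Arg (d i))"
    "lifted_step s (x - \<omega> - Arg (d i)) + pi \<le> lifted_step s' (x - Arg (d i))"
    unfolding at by linarith+
  have mem: "i \<in> {..<m}" using i by simp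
  have "(\<Sum>j<m. (lifted_step s' (x - Arg (d j)) + Arg (d j)) + (if j = i then pi else 0))
      \<le> (\<Sum>j<m. lifted_step s (x + \<omega> - Arg (d j)) + Arg (d j))"
  proof (rule sum_mono)
    fix j
    show "lifted_step s' (x - Arg (d j)) + Arg (d j) + (if j = i then pi else 0)
        \<le> lifted_step s (x + \<omega> - Arg (d j)) + Arg (d j)"
      using own(1) lifted_step_shift(1)[OF s, of "x - Arg (d j)"] by (auto simp: algebra_simps)
  qed
  then show "step_phase m 1 s' d x + pi \<le> step_phase m 1 s d (x + \<omega>)"
    using mem by (simp add: step_phase_conv_lifted sum.distrib)
  have "(\<Sum>j<m. (lifted_step s (x - \<omega> - Arg (d j)) + Arg (d j)) + (if j = i then pi else 0))
      \<le> (\<Sum>j<m. lifted_step s' (x - Arg (d j)) + Arg (d j))"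
  proof (rule sum_mono)
    fix j
    show "lifted_step s (x - \<omega> - Arg (d j)) + Arg (d j) + (if j = i then pi else 0)
        \<le> lifted_step s' (x - Arg (d j)) + Arg (d j)"
      using own(2) lifted_step_shift(2)[OF s, of "x - Arg (d j)"] by (auto simp: algebra_simps)
  qed
  then show "step_phase m 1 s d (x - \<omega>) + pi \<le> step_phase m 1 s' d x"
    using mem by (simp add: step_phase_conv_lifted sum.distrib)
qed

text \<open>The phase with \<open>t = 1\<close> may be constant on arcs free of eigenvalues, but it
  leaves every eigenangle strictly upwards, because there one staircase is in the middle of its
  rise.\<close>

lemma step_phase_less:
  assumes s: "0 < s" "s < pi" and i: "i < m" "cis x = d i" and xy: "x < y"
  shows "step_phase m 1 s d x < step_phase m 1 s d y"
proof -
  obtain n where n: "x - Arg (d i) = 2 * pi * of_int n" using cis_eq_imp_diff[OF i] .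
  have y: "y - Arg (d i) = (y - x) + 2 * pi * of_int n" using n by simp
  have "lifted_step s (2 * pi * of_int n) = 2 * pi * of_int n"
    using lifted_step_add_2pi[of s 0 n] lifted_step_0[OF s] by simp
  then have "lifted_step s (x - Arg (d i)) < lifted_step s (y - Arg (d i))"
    using lifted_step_pos[OF s, of "y - x"] xy
    unfolding y lifted_step_add_2pi unfolding n by simp
  then show ?thesis
    unfolding step_phase_conv_lifted
    using i xy lifted_step_mono[OF s] by (intro sum_strict_mono2[where b = i] sum_strict_mono_ex1) auto
qed

text \<open>At the eigenvalue \<open>d i\<close> its own staircase contributes the factor
  \<open>d i\<close>. An eigenvalue \<open>d j\<close> at chordal distance at least \<open>s\<close>
  is also at angular distance at least \<open>s\<close>, so its jump is not in progress and the
  factor is \<open>- d j\<close>. The value is thus the same at all eigenvalues.\<close>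

lemma cis_step_phase:
  assumes s: "0 < s" "s < pi" and i: "i < m" "cis x = d i"
    and gap: "\<And>j. j < m \<Longrightarrow> j \<noteq> i \<Longrightarrow> s \<le> cmod (d i - d j)"
  shows "cis (step_phase m 1 s d x) = (- 1) ^ (m - 1) * (\<Prod>j<m. d j)"
proof -
  have cis_sum: "cis (\<Sum>j\<in>A. f j) = (\<Prod>j\<in>A. cis (f j))" if "finite A" for A :: "nat set" and f
    using that by (induction A rule: finite_induct) (auto simp: cis_mult[symmetric])
  have fac: "cis (x + angular_step s (cis x * cnj (d j))) = (if j = i then d j else - d j)" if j: "j < m" for j
  proof (cases "j = i")
    case True
    have "d i * cnj (d i) = 1" using d[OF i(1)] by (simp add: complex_norm_square[symmetric])
    then show ?thesis using True i s by (simp add: angular_step_def)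
  next
    case False
    define w where "w = cis x * cnj (d j)"
    have w1: "cmod w = 1" using d[OF j] by (simp add: w_def norm_mult)
    have dj: "d j * cnj (d j) = 1" using d[OF j] by (simp add: complex_norm_square[symmetric])
    have "cmod (d i - d j) = cmod ((d i - d j) * cnj (d j))"
      using d[OF j] by (simp add: norm_mult)
    also have "(d i - d j) * cnj (d j) = w - 1" using dj i by (simp add: w_def algebra_simps)
    finally have "s \<le> cmod (w - 1)" using gap[OF j False] by simp
    also have "w = cis (Arg w)" using w1 by (subst cis_Arg) (auto simp: sgn_eq)
    also have "cmod (cis (Arg w) - 1) = 2 * \<bar>sin (Arg w / 2)\<bar>"
      using dist_exp_i_1[of "Arg w"] by (simp add: cis_conv_exp)
    also have "\<dots> \<le> \<bar>Arg w\<bar>" using abs_sin_le_one abs_sin_x_le_abs_x[of "Arg w / 2"] by simp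
    finally have "s \<le> \<bar>Arg w\<bar>" .
    then consider "s \<le> Arg w" | "Arg w \<le> - s" by linarith
    then have "cis (angular_step s w) = - cis (- Arg w)"
    proof cases
      case 1
      then have "pi \<le> pi * Arg w / s" using s by (simp add: field_simps)
      then have "angular_step s w = pi + (- Arg w)" by (simp add: angular_step_def)
      then show ?thesis by (simp only: cis_mult[symmetric]) simp
    next
      case 2
      then have "pi * Arg w / s \<le> - pi" using s mult_left_mono[of "Arg w" "- s" pi] by (simp add: field_simps)
      then have "angular_step s w = - pi + (- Arg w)" by (simp add: angular_step_def)
      moreover have "cis (- pi) = -1" by (simp add: complex_eq_iff)
      ultimately show ?thesis by (simp only: cis_mult[symmetric]) simp
    qed
    also have "cis (- Arg w) = cnj w" using w1 by (simp add: cnj_eq_cis)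
    also have "cnj w = cnj (cis x) * d j" by (simp add: w_def)
    finally have "cis (x + angular_step s w) = - (cis x * cnj (cis x)) * d j"
      by (simp add: cis_mult[symmetric])
    also have "cis x * cnj (cis x) = 1" by (simp add: complex_norm_square[symmetric])
    finally show ?thesis using False by (simp add: w_def)
  qed
  have "cis (step_phase m 1 s d x) = (\<Prod>j<m. cis (x + angular_step s (cis x * cnj (d j))))"
    by (subst cis_sum[symmetric]) (simp_all add: step_phase_def sum.distrib)
  also have "\<dots> = (\<Prod>j<m. if j = i then d j else - d j)"
    by (intro prod.cong) (auto simp: fac)
  also have "\<dots> = d i * (\<Prod>j\<in>{..<m} - {i}. - d j)"
    using i by (subst prod.remove[of _ i]) (auto intro!: prod.cong)
  also have "\<dots> = (- 1) ^ (m - 1) * (d i * (\<Prod>j\<in>{..<m} - {i}. d j))"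
    using i by (subst prod_uminus) simp
  also have "d i * (\<Prod>j\<in>{..<m} - {i}. d j) = (\<Prod>j<m. d j)"
    using i by (subst prod.remove[of _ i, symmetric]) auto
  finally show ?thesis .
qed

end

section \<open>Dependence of spectral data on the matrix\<close>

lemma LIMSEQ_if_subsequences:
  fixes X :: "nat \<Rightarrow> 'a :: metric_space"
  assumes "\<And>r :: nat \<Rightarrow> nat. strict_mono r \<Longrightarrow> \<exists>r' :: nat \<Rightarrow> nat. strict_mono r' \<and> (\<lambda>n. X (r (r' n))) \<longlonglongrightarrow> l"
  shows "X \<longlonglongrightarrow> l"
proof (rule ccontr)
  assume "\<not> X \<longlonglongrightarrow> l"
  then obtain e where e: "e > 0" "\<not> (\<exists>N. \<forall>n\<ge>N. dist (X n) l < e)"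
    by (auto simp: lim_sequentially)
  have "infinite {n. e \<le> dist (X n) l}"
    unfolding infinite_nat_iff_unbounded_le using e(2) by (auto simp: not_less)
  then obtain r :: "nat \<Rightarrow> nat" where r: "strict_mono r" "\<And>n. e \<le> dist (X (r n)) l"
    using infinite_enumerate by blast
  then obtain r' :: "nat \<Rightarrow> nat" where "(\<lambda>n. X (r (r' n))) \<longlonglongrightarrow> l" using assms by blast
  then have "\<exists>N. \<forall>n\<ge>N. dist (X (r (r' n))) l < e" using e(1) by (auto simp: lim_sequentially)
  then show False using r(2) by (meson le_refl not_less)
qed

definition is_spectral :: "nat \<Rightarrow> complex mat \<Rightarrow> complex mat \<Rightarrow> (nat \<Rightarrow> complex) \<Rightarrow> bool" where
  "is_spectral m U V d \<longleftrightarrow> unitary_mat m V \<and> (\<forall>j<m. cmod (d j) = 1) \<and> U = conj_diag m V d"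

text \<open>An arbitrary choice, with no continuity in \<open>U\<close>. The frame
  \<open>eig_vecs\<close> is chosen afterwards so as to match this very ordering.\<close>

definition eig_vals :: "nat \<Rightarrow> complex mat \<Rightarrow> nat \<Rightarrow> complex" where
  "eig_vals m U = (SOME d. \<exists>V. is_spectral m U V d)"

definition eig_vecs :: "nat \<Rightarrow> complex mat \<Rightarrow> complex mat" where
  "eig_vecs m U = (SOME V. is_spectral m U V (eig_vals m U))"

lemma is_spectral_eig:
  assumes "unitary_mat m U"
  shows "is_spectral m U (eig_vecs m U) (eig_vals m U)"
proof -
  have "\<exists>d V. is_spectral m U V d"
    using unitary_spectral_decomposition[OF assms] by (auto simp: is_spectral_def)
  then have "\<exists>V. is_spectral m U V (eig_vals m U)"
    unfolding eig_vals_def by (rule someI_ex)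
  then show ?thesis unfolding eig_vecs_def by (rule someI_ex)
qed

lemma
  assumes "unitary_mat m U"
  shows unitary_eig_vecs: "unitary_mat m (eig_vecs m U)"
    and norm_eig_vals: "j < m \<Longrightarrow> cmod (eig_vals m U j) = 1"
    and conj_diag_eig: "conj_diag m (eig_vecs m U) (eig_vals m U) = U"
proof -
  note * = is_spectral_eig[OF assms, unfolded is_spectral_def]
  show "unitary_mat m (eig_vecs m U)" by (rule conjunct1[OF *])
  show "j < m \<Longrightarrow> cmod (eig_vals m U j) = 1"
    using conjunct1[OF conjunct2[OF *]] by blast
  show "conj_diag m (eig_vecs m U) (eig_vals m U) = U"
    by (rule conjunct2[OF conjunct2[OF *], symmetric])
qed

lemma spectrum_eq_eig_vals: "unitary_mat m U \<Longrightarrow> spectrum_mat U = eig_vals m U ` {..<m}"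
  by (metis spectrum_conj_diag conj_diag_eig unitary_eig_vecs)

lemma inj_on_eig_vals_iff:
  "unitary_mat m U \<Longrightarrow> completely_nondegenerate m U \<longleftrightarrow> inj_on (eig_vals m U) {..<m}"
  unfolding completely_nondegenerate_def
  using inj_on_iff_eq_card[of "{..<m}" "eig_vals m U"] spectrum_eq_eig_vals[of m U] by (metis card_lessThan finite_lessThan)

definition mat_tendsto :: "nat \<Rightarrow> (nat \<Rightarrow> complex mat) \<Rightarrow> complex mat \<Rightarrow> bool" where
  "mat_tendsto m U L \<longleftrightarrow> (\<forall>i<m. \<forall>j<m. (\<lambda>n. U n $$ (i, j)) \<longlonglongrightarrow> L $$ (i, j))"

lemma mat_tendsto_subseq: "mat_tendsto m U L \<Longrightarrow> strict_mono r \<Longrightarrow> mat_tendsto m (\<lambda>n. U (r n)) L"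
  by (auto simp: mat_tendsto_def intro: LIMSEQ_subseq_LIMSEQ[unfolded o_def, of "\<lambda>n. U n $$ _"])

text \<open>The chosen data need not converge, and a limit along a subsequence need not be the data
  chosen for \<open>L\<close>; but it is some decomposition of \<open>L\<close>. So every quantity
  that does not depend on the decomposition is sequentially continuous.\<close>

lemma spectral_subsequence:
  assumes U: "\<And>n. unitary_mat m (U n)" and L: "L \<in> carrier_mat m m" "mat_tendsto m U L"
  shows "\<exists>r V d. strict_mono (r :: nat \<Rightarrow> nat) \<and> is_spectral m L V d \<and>
    mat_tendsto m (\<lambda>n. eig_vecs m (U (r n))) V \<and> (\<forall>j<m. (\<lambda>n. eig_vals m (U (r n)) j) \<longlonglongrightarrow> d j)"
proof -
  obtain r V d where r: "strict_mono (r :: nat \<Rightarrow> nat)" and V: "unitary_mat m V"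
    and d: "\<forall>j<m. cmod (d j) = 1"
    and lim: "\<forall>i<m. \<forall>j<m. (\<lambda>n. eig_vecs m (U (r n)) $$ (i, j)) \<longlonglongrightarrow> V $$ (i, j)"
      "\<forall>j<m. (\<lambda>n. eig_vals m (U (r n)) j) \<longlonglongrightarrow> d j"
    using spectral_decomposition_subsequence[of m "\<lambda>n. eig_vecs m (U n)" "\<lambda>n. eig_vals m (U n)"]
      unitary_eig_vecs[OF U] norm_eig_vals[OF U] by blast
  have "L $$ (i, l) = conj_diag m V d $$ (i, l)" if "i < m" "l < m" for i l
  proof -
    have "(\<lambda>n. conj_diag m (eig_vecs m (U (r n))) (eig_vals m (U (r n))) $$ (i, l)) \<longlonglongrightarrow> conj_diag m V d $$ (i, l)"
      using that lim unitary_matD(1)[OF unitary_eig_vecs[OF U]] unitary_matD(1)[OF V]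
      by (intro tendsto_conj_diag) auto
    then have "(\<lambda>n. U (r n) $$ (i, l)) \<longlonglongrightarrow> conj_diag m V d $$ (i, l)"
      by (simp add: conj_diag_eig[OF U])
    moreover have "(\<lambda>n. U (r n) $$ (i, l)) \<longlonglongrightarrow> L $$ (i, l)"
      using mat_tendsto_subseq[OF L(2) r] that by (simp add: mat_tendsto_def)
    ultimately show ?thesis using LIMSEQ_unique by blast
  qed
  then have "L = conj_diag m V d"
    using L(1) conj_diag_carrier[OF unitary_matD(1)[OF V], of d] by (intro eq_matI) auto
  then show ?thesis
    using r V d lim unfolding is_spectral_def mat_tendsto_def by blast
qed

lemma step_phase_unique:
  assumes "is_spectral m U V d" "is_spectral m U V' d'"
  shows "step_phase m t s d x = step_phase m t s d' x" "(\<Prod>j<m. d j) = (\<Prod>j<m. d' j)"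
proof -
  have "char_poly (conj_diag m V d) = char_poly (conj_diag m V' d')"
    using assms by (simp add: is_spectral_def)
  note * = sum_prod_eq_if_char_poly_eq[OF _ _ this]
  show "step_phase m t s d x = step_phase m t s d' x"
    using *(1)[where g = "\<lambda>z. angular_step s (cis x * cnj z)"] assms by (simp add: step_phase_def is_spectral_def)
  show "(\<Prod>j<m. d j) = (\<Prod>j<m. d' j)" using *(2) assms by (simp add: is_spectral_def)
qed

lemma step_phase_char_poly_cong:
  assumes U: "unitary_mat m U" and U': "unitary_mat m U'" and eq: "char_poly U = char_poly U'"
  shows "step_phase m t s (eig_vals m U) x = step_phase m t s (eig_vals m U') x"
    "(\<Prod>j<m. eig_vals m U j) = (\<Prod>j<m. eig_vals m U' j)"
proof -
  have "char_poly (conj_diag m (eig_vecs m U) (eig_vals m U)) = char_poly (conj_diag m (eig_vecs m U') (eig_vals m U'))"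
    using eq by (simp add: conj_diag_eig U U')
  note * = sum_prod_eq_if_char_poly_eq[OF unitary_eig_vecs[OF U] unitary_eig_vecs[OF U'] this]
  show "step_phase m t s (eig_vals m U) x = step_phase m t s (eig_vals m U') x"
    using *(1)[where g = "\<lambda>z. angular_step s (cis x * cnj z)"] by (simp add: step_phase_def)
  show "(\<Prod>j<m. eig_vals m U j) = (\<Prod>j<m. eig_vals m U' j)" by (rule *(2))
qed

lemma tendsto_step_phase:
  assumes s: "0 < s" "s < pi"
    and U: "\<And>n. unitary_mat m (U n)" and L: "unitary_mat m L" "mat_tendsto m U L" and x: "x \<longlonglongrightarrow> l"
  shows "(\<lambda>n. step_phase m t s (eig_vals m (U n)) (x n)) \<longlonglongrightarrow> step_phase m t s (eig_vals m L) l"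
proof (rule LIMSEQ_if_subsequences)
  fix r :: "nat \<Rightarrow> nat" assume r: "strict_mono r"
  obtain r' V d where r': "strict_mono (r' :: nat \<Rightarrow> nat)" and d: "is_spectral m L V d"
    and lim: "\<And>j. j < m \<Longrightarrow> (\<lambda>n. eig_vals m (U (r (r' n))) j) \<longlonglongrightarrow> d j"
    using spectral_subsequence[of m "\<lambda>n. U (r n)" L, OF U unitary_matD(1)[OF L(1)] mat_tendsto_subseq[OF L(2) r]] by blast
  have "(\<lambda>n. x (r (r' n))) \<longlonglongrightarrow> l"
    using LIMSEQ_subseq_LIMSEQ[OF x strict_mono_o[OF r r']] by (simp add: o_def)
  moreover have "(\<lambda>n. cis (x (r (r' n)))) \<longlonglongrightarrow> cis l"
    by (rule continuous_on_tendsto_compose[of UNIV cis]) (auto intro: continuous_intros calculation)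
  moreover have "(\<lambda>n. angular_step s (cis (x (r (r' n))) * cnj (eig_vals m (U (r (r' n))) j)))
      \<longlonglongrightarrow> angular_step s (cis l * cnj (d j))" if "j < m" for j
  proof (rule isCont_tendsto_compose[OF isCont_angular_step[OF s]])
    have "cmod (d j) = 1" using d that by (simp add: is_spectral_def)
    then have "d j \<noteq> 0" by auto
    then show "cis l * cnj (d j) \<noteq> 0" by simp
  qed (intro tendsto_intros calculation lim that)
  ultimately have "(\<lambda>n. step_phase m t s (eig_vals m (U (r (r' n)))) (x (r (r' n)))) \<longlonglongrightarrow> step_phase m t s d l"
    unfolding step_phase_def by (intro tendsto_intros) auto
  also have "step_phase m t s d l = step_phase m t s (eig_vals m L) l"
    by (rule step_phase_unique(1)[OF d is_spectral_eig[OF L(1)]])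
  finally show "\<exists>r'. strict_mono r' \<and> (\<lambda>n. step_phase m t s (eig_vals m (U (r (r' n)))) (x (r (r' n))))
      \<longlonglongrightarrow> step_phase m t s (eig_vals m L) l" using r' by blast
qed

lemma tendsto_prod_eig_vals:
  assumes U: "\<And>n. unitary_mat m (U n)" and L: "unitary_mat m L" "mat_tendsto m U L"
  shows "(\<lambda>n. \<Prod>j<m. eig_vals m (U n) j) \<longlonglongrightarrow> (\<Prod>j<m. eig_vals m L j)"
proof (rule LIMSEQ_if_subsequences)
  fix r :: "nat \<Rightarrow> nat" assume r: "strict_mono r"
  obtain r' V d where r': "strict_mono (r' :: nat \<Rightarrow> nat)" and d: "is_spectral m L V d"
    and lim: "\<And>j. j < m \<Longrightarrow> (\<lambda>n. eig_vals m (U (r (r' n))) j) \<longlonglongrightarrow> d j"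
    using spectral_subsequence[of m "\<lambda>n. U (r n)" L, OF U unitary_matD(1)[OF L(1)] mat_tendsto_subseq[OF L(2) r]] by blast
  have "(\<lambda>n. \<Prod>j<m. eig_vals m (U (r (r' n))) j) \<longlonglongrightarrow> (\<Prod>j<m. d j)"
    by (intro tendsto_intros lim) auto
  then show "\<exists>r'. strict_mono r' \<and> (\<lambda>n. \<Prod>j<m. eig_vals m (U (r (r' n))) j) \<longlonglongrightarrow> (\<Prod>j<m. eig_vals m L j)"
    using r' step_phase_unique(2)[OF d is_spectral_eig[OF L(1)]] by auto
qed

text \<open>Compactness of the unitary group times a bounded interval turns joint sequential
  continuity into uniform continuity in the matrix. Uniformity is needed because one \<delta> must
  serve all \<open>k\<close> and all later choices of \<open>\<beta>\<close>.\<close>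

lemma uniform_on_unitary:
  fixes Q :: "complex mat \<Rightarrow> real \<Rightarrow> 'b :: real_normed_vector"
  assumes Q: "\<And>U L x l. (\<And>n. unitary_mat m (U n)) \<Longrightarrow> unitary_mat m L \<Longrightarrow> mat_tendsto m U L \<Longrightarrow> x \<longlonglongrightarrow> l \<Longrightarrow>
      (\<lambda>n. Q (U n) (x n)) \<longlonglongrightarrow> Q L l"
    and eta: "0 < \<eta>"
  shows "\<exists>\<delta>>0. \<forall>U U' x. unitary_mat m U \<longrightarrow> unitary_mat m U' \<longrightarrow> \<bar>x\<bar> \<le> B \<longrightarrow>
    (\<forall>i<m. \<forall>j<m. cmod (U $$ (i, j) - U' $$ (i, j)) < \<delta>) \<longrightarrow> norm (Q U x - Q U' x) < \<eta>"
proof (rule ccontr)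
  assume neg: "\<not> ?thesis"
  have "\<exists>U U' x. unitary_mat m U \<and> unitary_mat m U' \<and> \<bar>x\<bar> \<le> B \<and>
    (\<forall>i<m. \<forall>j<m. cmod (U $$ (i, j) - U' $$ (i, j)) < inverse (real (Suc n))) \<and> \<eta> \<le> norm (Q U x - Q U' x)" for n
  proof -
    have "0 < inverse (real (Suc n))" by simp
    then have "\<not> (\<forall>U U' x. unitary_mat m U \<longrightarrow> unitary_mat m U' \<longrightarrow> \<bar>x\<bar> \<le> B \<longrightarrow>
      (\<forall>i<m. \<forall>j<m. cmod (U $$ (i, j) - U' $$ (i, j)) < inverse (real (Suc n))) \<longrightarrow> norm (Q U x - Q U' x) < \<eta>)"
      using neg by blast
    then show ?thesis by (simp only: not_all not_imp not_less)
  qed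
  then obtain U U' x where U: "\<And>n. unitary_mat m (U n)" and U': "\<And>n. unitary_mat m (U' n)"
    and x: "\<And>n. \<bar>x n\<bar> \<le> B"
    and close: "\<And>n i j. i < m \<Longrightarrow> j < m \<Longrightarrow> cmod (U n $$ (i, j) - U' n $$ (i, j)) < inverse (real (Suc n))"
    and far: "\<And>n. \<eta> \<le> norm (Q (U n) (x n) - Q (U' n) (x n))"
    by metis
  have "bounded (range x)" using x by (auto simp: bounded_iff)
  then obtain l r0 where r0: "strict_mono (r0 :: nat \<Rightarrow> nat)" "(x \<circ> r0) \<longlonglongrightarrow> l"
    using bounded_imp_convergent_subsequence by blast
  obtain r1 V d where r1: "strict_mono (r1 :: nat \<Rightarrow> nat)" and V: "unitary_mat m V" and d: "\<forall>j<m. cmod (d j) = 1"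
    and lim: "\<forall>i<m. \<forall>j<m. (\<lambda>n. eig_vecs m (U (r0 (r1 n))) $$ (i, j)) \<longlonglongrightarrow> V $$ (i, j)"
      "\<forall>j<m. (\<lambda>n. eig_vals m (U (r0 (r1 n))) j) \<longlonglongrightarrow> d j"
    using spectral_decomposition_subsequence[of m "\<lambda>n. eig_vecs m (U (r0 n))" "\<lambda>n. eig_vals m (U (r0 n))"]
      unitary_eig_vecs[OF U] norm_eig_vals[OF U] by blast
  \<comment> \<open>Assembling the limit matrix from limits of the spectral data makes it unitary at
    once.\<close>
  define L where "L = conj_diag m V d"
  define r where "r = r0 \<circ> r1"
  have r: "strict_mono r" unfolding r_def using r0 r1 by (intro strict_mono_o)
  have L: "unitary_mat m L" unfolding L_def using V d by (intro unitary_conj_diag) auto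
  have UL: "mat_tendsto m (\<lambda>n. U (r n)) L"
    unfolding mat_tendsto_def
  proof (intro allI impI)
    fix i j assume ij: "i < m" "j < m"
    have "(\<lambda>n. conj_diag m (eig_vecs m (U (r n))) (eig_vals m (U (r n))) $$ (i, j)) \<longlonglongrightarrow> L $$ (i, j)"
      unfolding L_def using ij lim unitary_matD(1)[OF unitary_eig_vecs[OF U]] unitary_matD(1)[OF V]
      by (intro tendsto_conj_diag) (auto simp: r_def)
    then show "(\<lambda>n. U (r n) $$ (i, j)) \<longlonglongrightarrow> L $$ (i, j)"
      by (simp add: conj_diag_eig[OF U])
  qed
  have U'L: "mat_tendsto m (\<lambda>n. U' (r n)) L"
    unfolding mat_tendsto_def
  proof (intro allI impI)
    fix i j assume ij: "i < m" "j < m"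
    have "(\<lambda>n. U n $$ (i, j) - U' n $$ (i, j)) \<longlonglongrightarrow> 0"
      by (rule Lim_null_comparison[OF _ LIMSEQ_inverse_real_of_nat])
         (use close[OF ij] in \<open>auto intro!: always_eventually less_imp_le\<close>)
    then have "(\<lambda>n. U (r n) $$ (i, j) - U' (r n) $$ (i, j)) \<longlonglongrightarrow> 0"
      using LIMSEQ_subseq_LIMSEQ[OF _ r, of "\<lambda>n. U n $$ (i, j) - U' n $$ (i, j)"] by (simp add: o_def)
    then have "(\<lambda>n. U (r n) $$ (i, j) - (U (r n) $$ (i, j) - U' (r n) $$ (i, j))) \<longlonglongrightarrow> L $$ (i, j) - 0"
      using UL ij by (intro tendsto_diff) (auto simp: mat_tendsto_def)
    then show "(\<lambda>n. U' (r n) $$ (i, j)) \<longlonglongrightarrow> L $$ (i, j)" by simp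
  qed
  have xl: "(\<lambda>n. x (r n)) \<longlonglongrightarrow> l"
    using LIMSEQ_subseq_LIMSEQ[OF r0(2) r1] by (simp add: o_def r_def)
  have "(\<lambda>n. norm (Q (U (r n)) (x (r n)) - Q (U' (r n)) (x (r n)))) \<longlonglongrightarrow> norm (Q L l - Q L l)"
    by (intro tendsto_norm tendsto_diff Q U U' L UL U'L xl)
  then have "\<eta> \<le> norm (Q L l - Q L l)"
    by (rule LIMSEQ_le_const) (use far in auto)
  then show False using eta by simp
qed

lemma spectral_data_uniform:
  assumes s: "0 < s" "s < pi" and eta: "0 < \<eta>"
  obtains \<delta> where "\<delta> > 0"
    "\<And>U U' x. unitary_mat m U \<Longrightarrow> unitary_mat m U' \<Longrightarrow>
      (\<And>i j. i < m \<Longrightarrow> j < m \<Longrightarrow> cmod (U $$ (i, j) - U' $$ (i, j)) < \<delta>) \<Longrightarrow>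
      \<bar>step_phase m t s (eig_vals m U) x - step_phase m t s (eig_vals m U') x\<bar> < \<eta>"
    "\<And>U U'. unitary_mat m U \<Longrightarrow> unitary_mat m U' \<Longrightarrow>
      (\<And>i j. i < m \<Longrightarrow> j < m \<Longrightarrow> cmod (U $$ (i, j) - U' $$ (i, j)) < \<delta>) \<Longrightarrow>
      cmod ((\<Prod>j<m. eig_vals m U j) - (\<Prod>j<m. eig_vals m U' j)) < \<eta>"
proof -
  obtain \<delta>1 where d1: "\<delta>1 > 0" "\<And>U U' x. unitary_mat m U \<Longrightarrow> unitary_mat m U' \<Longrightarrow> \<bar>x\<bar> \<le> pi \<Longrightarrow>
      (\<And>i j. i < m \<Longrightarrow> j < m \<Longrightarrow> cmod (U $$ (i, j) - U' $$ (i, j)) < \<delta>1) \<Longrightarrow>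
      \<bar>step_phase m t s (eig_vals m U) x - step_phase m t s (eig_vals m U') x\<bar> < \<eta>"
  proof -
    have "\<exists>\<delta>>0. \<forall>U U' x. unitary_mat m U \<longrightarrow> unitary_mat m U' \<longrightarrow> \<bar>x\<bar> \<le> pi \<longrightarrow>
      (\<forall>i<m. \<forall>j<m. cmod (U $$ (i, j) - U' $$ (i, j)) < \<delta>) \<longrightarrow>
      norm (step_phase m t s (eig_vals m U) x - step_phase m t s (eig_vals m U') x) < \<eta>"
      by (rule uniform_on_unitary[where Q = "\<lambda>U. step_phase m t s (eig_vals m U)"])
         (use eta in \<open>auto intro: tendsto_step_phase[OF s]\<close>)
    then obtain \<delta> where "\<delta> > 0" and *: "\<forall>U U' x. unitary_mat m U \<longrightarrow> unitary_mat m U' \<longrightarrow> \<bar>x\<bar> \<le> pi \<longrightarrow>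
      (\<forall>i<m. \<forall>j<m. cmod (U $$ (i, j) - U' $$ (i, j)) < \<delta>) \<longrightarrow>
      norm (step_phase m t s (eig_vals m U) x - step_phase m t s (eig_vals m U') x) < \<eta>" by blast
    show ?thesis
      by (rule that[OF \<open>\<delta> > 0\<close>]) (use *[rule_format] in auto)
  qed
  obtain \<delta>2 where d2: "\<delta>2 > 0" "\<And>U U'. unitary_mat m U \<Longrightarrow> unitary_mat m U' \<Longrightarrow>
      (\<And>i j. i < m \<Longrightarrow> j < m \<Longrightarrow> cmod (U $$ (i, j) - U' $$ (i, j)) < \<delta>2) \<Longrightarrow>
      cmod ((\<Prod>j<m. eig_vals m U j) - (\<Prod>j<m. eig_vals m U' j)) < \<eta>"
  proof -
    have "\<exists>\<delta>>0. \<forall>U U' x. unitary_mat m U \<longrightarrow> unitary_mat m U' \<longrightarrow> \<bar>x\<bar> \<le> pi \<longrightarrow>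
      (\<forall>i<m. \<forall>j<m. cmod (U $$ (i, j) - U' $$ (i, j)) < \<delta>) \<longrightarrow>
      cmod ((\<Prod>j<m. eig_vals m U j) - (\<Prod>j<m. eig_vals m U' j)) < \<eta>"
      by (rule uniform_on_unitary[where Q = "\<lambda>U x. (\<Prod>j<m. eig_vals m U j)"])
         (use eta in \<open>auto intro: tendsto_prod_eig_vals\<close>)
    then obtain \<delta> where "\<delta> > 0" and *: "\<forall>U U' x. unitary_mat m U \<longrightarrow> unitary_mat m U' \<longrightarrow> \<bar>x\<bar> \<le> pi \<longrightarrow>
      (\<forall>i<m. \<forall>j<m. cmod (U $$ (i, j) - U' $$ (i, j)) < \<delta>) \<longrightarrow>
      cmod ((\<Prod>j<m. eig_vals m U j) - (\<Prod>j<m. eig_vals m U' j)) < \<eta>" by blast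
    show ?thesis
      by (rule that[OF \<open>\<delta> > 0\<close>]) (use *[rule_format, where x = 0] in auto)
  qed
  show ?thesis
  proof (rule that[of "min \<delta>1 \<delta>2"])
    show "min \<delta>1 \<delta>2 > 0" using d1 d2 by simp
    fix U U' x
    assume U: "unitary_mat m U" "unitary_mat m U'"
      "\<And>i j. i < m \<Longrightarrow> j < m \<Longrightarrow> cmod (U $$ (i, j) - U' $$ (i, j)) < min \<delta>1 \<delta>2"
    show "cmod ((\<Prod>j<m. eig_vals m U j) - (\<Prod>j<m. eig_vals m U' j)) < \<eta>"
      using U by (intro d2) auto
    \<comment> \<open>Uniformity was obtained for bounded \<open>x\<close> only. It extends to all
      \<open>x\<close> because both phases gain the same amount under a translation by a multiple of
      2 pi, so their difference is periodic.\<close>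
    obtain n a where x: "x = a + 2 * pi * of_int n" "- pi < a" "a \<le> pi"
      by (rule exists_principal_representative)
    have "\<bar>step_phase m t s (eig_vals m U) a - step_phase m t s (eig_vals m U') a\<bar> < \<eta>"
      using U x by (intro d1) auto
    then show "\<bar>step_phase m t s (eig_vals m U) x - step_phase m t s (eig_vals m U') x\<bar> < \<eta>"
      unfolding x(1) step_phase_add_2pi by simp
  qed
qed

lemma Z2_periodic_fundamental_domain:
  fixes k :: "real^2"
  obtains z :: "real^2" where "\<And>i. z $ i \<in> \<int>" "\<And>i. 0 \<le> (k + z) $ i" "\<And>i. (k + z) $ i < 1"
proof
  define z :: "real^2" where "z = (\<chi> i. - of_int \<lfloor>k $ i\<rfloor>)"
  fix i
  show "z $ i \<in> \<int>" "0 \<le> (k + z) $ i" "(k + z) $ i < 1"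
    by (auto simp: z_def) linarith+
qed

lemma bounded_unit_square:
  fixes k :: "real^2"
  assumes "\<And>i. 0 \<le> k $ i" "\<And>i. k $ i < 1"
  shows "norm k \<le> 2"
proof -
  have "norm k \<le> (\<Sum>i\<in>UNIV. \<bar>k $ i\<bar>)" by (rule norm_le_l1_cart)
  also have "\<dots> \<le> (\<Sum>i\<in>(UNIV :: 2 set). 1)"
    using assms by (intro sum_mono) (simp add: less_imp_le)
  finally show ?thesis by simp
qed

lemma mat_continuous_tendsto:
  assumes "mat_continuous m f" "k \<longlonglongrightarrow> l"
  shows "mat_tendsto m (\<lambda>n. f (k n)) (f l)"
  using assms continuous_on_tendsto_compose[of UNIV "\<lambda>k. f k $$ (_, _)" k l]
  by (auto simp: mat_continuous_def mat_tendsto_def)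

text \<open>If the distance of two eigenvalues became arbitrarily small, periodicity would allow the
  points \<open>k\<close> to be moved into a compact set, and a limit point would carry a double
  eigenvalue.\<close>

lemma eigenvalue_gap:
  assumes cont: "mat_continuous m \<beta>" and per: "Z2_periodic \<beta>" and U: "\<And>k. unitary_mat m (\<beta> k)"
    and nd: "\<And>k. completely_nondegenerate m (\<beta> k)"
  obtains g where "g > 0"
    "\<And>k i j. i < m \<Longrightarrow> j < m \<Longrightarrow> i \<noteq> j \<Longrightarrow> g \<le> cmod (eig_vals m (\<beta> k) i - eig_vals m (\<beta> k) j)"
proof -
  have pair: "\<exists>g>0. \<forall>k. g \<le> cmod (eig_vals m (\<beta> k) i - eig_vals m (\<beta> k) j)"
    if ij: "i < m" "j < m" "i \<noteq> j" for i j
  proof (rule ccontr)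
    assume neg: "\<not> ?thesis"
    have "\<exists>k. cmod (eig_vals m (\<beta> k) i - eig_vals m (\<beta> k) j) < inverse (real (Suc n))" for n
      proof -
      have "0 < inverse (real (Suc n))" by simp
      with neg have "\<not> (\<forall>k. inverse (real (Suc n)) \<le> cmod (eig_vals m (\<beta> k) i - eig_vals m (\<beta> k) j))"
        by blast
      then show ?thesis by (simp only: not_all not_le)
    qed
    then obtain k where k: "\<And>n. cmod (eig_vals m (\<beta> (k n)) i - eig_vals m (\<beta> (k n)) j) < inverse (real (Suc n))"
      by metis
    have "\<exists>z :: real^2. (\<forall>i. z $ i \<in> \<int>) \<and> (\<forall>i. 0 \<le> (k n + z) $ i) \<and> (\<forall>i. (k n + z) $ i < 1)" for n
      using Z2_periodic_fundamental_domain[of "k n"] by metis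
    then obtain z :: "nat \<Rightarrow> real^2" where z: "\<And>n. \<forall>i. z n $ i \<in> \<int>" "\<And>n. norm (k n + z n) \<le> 2"
      using bounded_unit_square by metis
    have "bounded (range (\<lambda>n. k n + z n))" using z(2) by (auto simp: bounded_iff)
    then obtain l r where r: "strict_mono (r :: nat \<Rightarrow> nat)" "(\<lambda>n. k (r n) + z (r n)) \<longlonglongrightarrow> l"
      using bounded_imp_convergent_subsequence[of "\<lambda>n. k n + z n"] by (auto simp: o_def)
    have "mat_tendsto m (\<lambda>n. \<beta> (k (r n) + z (r n))) (\<beta> l)"
      by (rule mat_continuous_tendsto[OF cont r(2)])
    then have "mat_tendsto m (\<lambda>n. \<beta> (k (r n))) (\<beta> l)"
      using per z(1) by (simp add: Z2_periodic_def)
    note bl = this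
    obtain r' V d where r': "strict_mono (r' :: nat \<Rightarrow> nat)" and d: "is_spectral m (\<beta> l) V d"
      and lim: "\<And>j. j < m \<Longrightarrow> (\<lambda>n. eig_vals m (\<beta> (k (r (r' n)))) j) \<longlonglongrightarrow> d j"
      using spectral_subsequence[of m "\<lambda>n. \<beta> (k (r n))" "\<beta> l", OF U unitary_matD(1)[OF U] bl] by blast
    have "(\<lambda>n. eig_vals m (\<beta> (k n)) i - eig_vals m (\<beta> (k n)) j) \<longlonglongrightarrow> 0"
      by (rule Lim_null_comparison[OF _ LIMSEQ_inverse_real_of_nat])
         (use k in \<open>auto intro!: always_eventually less_imp_le\<close>)
    then have "(\<lambda>n. eig_vals m (\<beta> (k (r (r' n)))) i - eig_vals m (\<beta> (k (r (r' n)))) j) \<longlonglongrightarrow> 0"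
      using LIMSEQ_subseq_LIMSEQ[OF _ strict_mono_o[OF r(1) r'],
          of "\<lambda>n. eig_vals m (\<beta> (k n)) i - eig_vals m (\<beta> (k n)) j" 0] by (simp add: o_def)
    moreover have "(\<lambda>n. eig_vals m (\<beta> (k (r (r' n)))) i - eig_vals m (\<beta> (k (r (r' n)))) j) \<longlonglongrightarrow> d i - d j"
      using ij by (intro tendsto_diff lim)
    ultimately have "0 = d i - d j" by (rule LIMSEQ_unique)
    then have "d i = d j" by simp
    then have "\<not> inj_on d {..<m}" using ij by (auto simp: inj_on_def)
    moreover have "spectrum_mat (\<beta> l) = d ` {..<m}"
      using d spectrum_conj_diag[of m V d] by (simp add: is_spectral_def)
    ultimately show False
      using nd[of l] inj_on_iff_eq_card[of "{..<m}" d]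
      by (metis card_lessThan completely_nondegenerate_def finite_lessThan)
  qed
  define P where "P = {(i, j). i < m \<and> j < m \<and> i \<noteq> j}"
  have "finite P" by (rule finite_subset[of _ "{..<m} \<times> {..<m}"]) (auto simp: P_def)
  have "\<exists>g. \<forall>p\<in>P. g p > 0 \<and> (\<forall>k. g p \<le> cmod (eig_vals m (\<beta> k) (fst p) - eig_vals m (\<beta> k) (snd p)))"
    by (rule bchoice) (use pair in \<open>auto simp: P_def\<close>)
  then obtain g where g: "\<And>p. p \<in> P \<Longrightarrow> g p > 0"
    "\<And>p k. p \<in> P \<Longrightarrow> g p \<le> cmod (eig_vals m (\<beta> k) (fst p) - eig_vals m (\<beta> k) (snd p))"
    by blast
  show ?thesis
  \<comment> \<open>The inserted 1 keeps the set nonempty when \<open>P\<close> is empty, that is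
    for \<open>m \<le> 1\<close>.\<close>
  proof (rule that[of "Min (insert 1 (g ` P))"])
    show "Min (insert 1 (g ` P)) > 0" using \<open>finite P\<close> g by auto
    fix k i j assume "i < m" "j < m" "i \<noteq> j"
    then have p: "(i, j) \<in> P" by (simp add: P_def)
    have "Min (insert 1 (g ` P)) \<le> g (i, j)" using \<open>finite P\<close> p by (intro Min_le) auto
    then show "Min (insert 1 (g ` P)) \<le> cmod (eig_vals m (\<beta> k) i - eig_vals m (\<beta> k) j)"
      using g(2)[OF p, of k] by simp
  qed
qed

text \<open>The frame jumps with \<open>k\<close>, yet the matrix does not: along a subsequence
  frame and eigenvalues converge to some decomposition of \<open>\<beta> l\<close>, and by
  \<open>conj_diag_fun_cong\<close> that decomposition yields the same matrix as the chosen
  one.\<close>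

lemma mat_continuous_functional_calculus:
  assumes cont: "mat_continuous m \<beta>" and U: "\<And>k. unitary_mat m (\<beta> k)"
    and f: "\<And>k l z w. k \<longlonglongrightarrow> l \<Longrightarrow> z \<longlonglongrightarrow> w \<Longrightarrow> (\<And>n. cmod (z n) = 1) \<Longrightarrow> (\<lambda>n. f (k n) (z n)) \<longlonglongrightarrow> f l w"
  shows "mat_continuous m (\<lambda>k. conj_diag m (eig_vecs m (\<beta> k)) (\<lambda>j. f k (eig_vals m (\<beta> k) j)))"
  unfolding mat_continuous_def
proof (intro allI impI)
  fix i j assume ij: "i < m" "j < m"
  define G where "G k = conj_diag m (eig_vecs m (\<beta> k)) (\<lambda>j. f k (eig_vals m (\<beta> k) j)) $$ (i, j)" for k
  have "(\<lambda>n. G (k n)) \<longlonglongrightarrow> G l" if kl: "k \<longlonglongrightarrow> l" for k l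
  proof (rule LIMSEQ_if_subsequences)
    fix r :: "nat \<Rightarrow> nat" assume r: "strict_mono r"
    have "mat_tendsto m (\<lambda>n. \<beta> (k (r n))) (\<beta> l)"
      using mat_tendsto_subseq[OF mat_continuous_tendsto[OF cont kl] r] .
    note bl = this
    obtain r' V d where r': "strict_mono (r' :: nat \<Rightarrow> nat)" and d: "is_spectral m (\<beta> l) V d"
      and V: "mat_tendsto m (\<lambda>n. eig_vecs m (\<beta> (k (r (r' n))))) V"
      and lim: "\<And>j. j < m \<Longrightarrow> (\<lambda>n. eig_vals m (\<beta> (k (r (r' n)))) j) \<longlonglongrightarrow> d j"
      using spectral_subsequence[of m "\<lambda>n. \<beta> (k (r n))" "\<beta> l", OF U unitary_matD(1)[OF U] bl] by blast
    have k': "(\<lambda>n. k (r (r' n))) \<longlonglongrightarrow> l"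
      using LIMSEQ_subseq_LIMSEQ[OF kl strict_mono_o[OF r r']] by (simp add: o_def)
    have "(\<lambda>n. G (k (r (r' n)))) \<longlonglongrightarrow> conj_diag m V (\<lambda>j. f l (d j)) $$ (i, j)"
      unfolding G_def
    proof (rule tendsto_conj_diag)
      show "(\<lambda>n. f (k (r (r' n))) (eig_vals m (\<beta> (k (r (r' n)))) j)) \<longlonglongrightarrow> f l (d j)" if "j < m" for j
        using that norm_eig_vals[OF U] by (intro f k' lim) auto
    qed (use ij V d unitary_matD(1)[OF unitary_eig_vecs[OF U]] in \<open>auto simp: mat_tendsto_def is_spectral_def unitary_mat_def\<close>)
    also have "conj_diag m V (\<lambda>j. f l (d j)) $$ (i, j) = G l"
      unfolding G_def using d is_spectral_eig[OF U, of l]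
      by (subst conj_diag_fun_cong[of m V "eig_vecs m (\<beta> l)" d "eig_vals m (\<beta> l)"]) (auto simp: is_spectral_def)
    finally show "\<exists>r'. strict_mono r' \<and> (\<lambda>n. G (k (r (r' n)))) \<longlonglongrightarrow> G l" using r' by blast
  qed
  then have "continuous_on UNIV G"
    by (simp add: continuous_on_sequentially o_def)
  then show "continuous_on UNIV (\<lambda>k. conj_diag m (eig_vecs m (\<beta> k)) (\<lambda>j. f k (eig_vals m (\<beta> k) j)) $$ (i, j))"
    unfolding G_def .
qed

section \<open>Symmetrising a non-degenerate spectrum\<close>

lemma LIMSEQ_eventually_less:
  fixes f g :: "nat \<Rightarrow> real"
  assumes "f \<longlonglongrightarrow> a" "g \<longlonglongrightarrow> b" "a < b"
  shows "\<forall>\<^sub>F n in sequentially. f n < g n"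
proof -
  have "\<forall>\<^sub>F n in sequentially. 0 < g n - f n"
    using order_tendstoD(1)[OF tendsto_diff[OF assms(2,1)], of 0] assms(3) by simp
  then show ?thesis by eventually_elim simp
qed

lemma cis_eq_1_imp:
  assumes "cis u = 1"
  obtains n where "u = 2 * pi * of_int n"
proof -
  obtain n a where u: "u = a + 2 * pi * of_int n" "- pi < a" "a \<le> pi"
    by (rule exists_principal_representative)
  then have "cis a = 1" using assms by (simp add: cis_add_2pi_int)
  then have "a = 0" using Arg_cis[of a] u by simp
  then show ?thesis using u that by simp
qed

section \<open>Inverses of continuous families of degree \<open>m\<close> circle maps\<close>

definition phase_inv :: "('k \<Rightarrow> real \<Rightarrow> real) \<Rightarrow> 'k \<Rightarrow> real \<Rightarrow> real" where
  "phase_inv P k v = (THE x. P k x = v)"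

context
  fixes P :: "real^2 \<Rightarrow> real \<Rightarrow> real" and m :: nat
  assumes mono: "\<And>k x y. x < y \<Longrightarrow> P k x < P k y"
    and quasi: "\<And>k x n. P k (x + 2 * pi * of_int n) = P k x + 2 * pi * of_int (int m * n)"
    and cont: "\<And>k l x y. k \<longlonglongrightarrow> l \<Longrightarrow> x \<longlonglongrightarrow> y \<Longrightarrow> (\<lambda>n. P (k n) (x n)) \<longlonglongrightarrow> P l y"
    and m: "0 < m"
begin

lemma phase_inj: "P k x = P k y \<Longrightarrow> x = y"
  using mono[of x y k] mono[of y x k] by (cases x y rule: linorder_cases) auto

lemma phase_less_iff: "P k x < P k y \<longleftrightarrow> x < y"
  using mono[of x y k] mono[of y x k] by (cases x y rule: linorder_cases) auto

lemma phase_surj: "\<exists>x. P k x = v"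
proof -
  define N where "N = nat \<lceil>\<bar>v - P k 0\<bar>\<rceil>"
  have N: "\<bar>v - P k 0\<bar> \<le> real N" unfolding N_def by linarith
  have "1 * 1 \<le> 2 * pi * real m" using pi_ge_two m by (intro mult_mono) auto
  then have "1 * real N \<le> 2 * pi * real m * real N" by (intro mult_right_mono) auto
  then have N': "real N \<le> 2 * pi * (real m * real N)" by (simp add: algebra_simps)
  have "P k (2 * pi * of_int (int N)) = P k 0 + 2 * pi * (real m * real N)"
    "P k (2 * pi * of_int (- int N)) = P k 0 - 2 * pi * (real m * real N)"
    using quasi[of k 0 "int N"] quasi[of k 0 "- int N"] by simp_all
  then have "P k (2 * pi * of_int (- int N)) \<le> v" "v \<le> P k (2 * pi * of_int (int N))"
    using N N' by linarith+
  moreover have "continuous_on A (P k)" for A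
  proof (rule continuous_on_subset)
    show "continuous_on UNIV (P k)"
      by (simp add: continuous_on_sequentially o_def cont[OF tendsto_const])
  qed simp
  moreover have "2 * pi * real_of_int (- int N) \<le> 2 * pi * of_int (int N)" by simp
  ultimately show ?thesis using IVT'[of "P k"] by blast
qed

lemma phase_phase_inv [simp]: "P k (phase_inv P k v) = v"
proof -
  have "\<exists>!x. P k x = v" using phase_surj phase_inj by metis
  then show ?thesis unfolding phase_inv_def by (rule theI')
qed

lemma phase_inv_shift: "phase_inv P k (v + 2 * pi * of_int (int m * n)) = phase_inv P k v + 2 * pi * of_int n"
  by (rule phase_inj[of k]) (simp only: quasi phase_phase_inv)

text \<open>By strict monotonicity, a bound on the inverse amounts to a strict inequality between
  \<open>P (k n) a\<close> and \<open>v n\<close>, which persists along the sequence.\<close>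

lemma tendsto_phase_inv:
  assumes "k \<longlonglongrightarrow> l" "v \<longlonglongrightarrow> w"
  shows "(\<lambda>n. phase_inv P (k n) (v n)) \<longlonglongrightarrow> phase_inv P l w"
proof (rule order_tendstoI)
  fix a assume "a < phase_inv P l w"
  then have "P l a < w" by (metis mono phase_phase_inv)
  then have "\<forall>\<^sub>F n in sequentially. P (k n) a < v n"
    by (rule LIMSEQ_eventually_less[OF cont[OF assms(1) tendsto_const] assms(2)])
  then show "\<forall>\<^sub>F n in sequentially. a < phase_inv P (k n) (v n)"
    by eventually_elim (metis phase_less_iff phase_phase_inv)
next
  fix a assume "phase_inv P l w < a"
  then have "w < P l a" by (metis mono phase_phase_inv)
  then have "\<forall>\<^sub>F n in sequentially. v n < P (k n) a"
    by (rule LIMSEQ_eventually_less[OF assms(2) cont[OF assms(1) tendsto_const]])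
  then show "\<forall>\<^sub>F n in sequentially. phase_inv P (k n) (v n) < a"
    by eventually_elim (metis phase_less_iff phase_phase_inv)
qed

text \<open>On the level set the lifted value is \<open>Arg c + 2 * pi * n\<close>. Moving
  \<open>x\<close> by \<open>2 * pi * l\<close> changes \<open>n\<close> by \<open>m * l\<close>, so
  points of the circle in the level set are told apart by \<open>n\<close> modulo
  \<open>m\<close>.\<close>

lemma phase_level_set:
  assumes c: "cmod c = 1"
  shows "finite {cis x |x. cis (P k x) = c}" "card {cis x |x. cis (P k x) = c} \<le> m"
proof -
  define T where "T = {cis x |x. cis (P k x) = c}"
  define x where "x z = (SOME x. z = cis x \<and> cis (P k x) = c)" for z
  have x: "z = cis (x z)" "cis (P k (x z)) = c" if "z \<in> T" for z
    using someI_ex[of "\<lambda>x. z = cis x \<and> cis (P k x) = c"] that unfolding T_def x_def by auto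
  have "\<exists>n. P k (x z) = Arg c + 2 * pi * of_int n" if "z \<in> T" for z
  proof -
    obtain n a where a: "P k (x z) = a + 2 * pi * of_int n" "- pi < a" "a \<le> pi"
      by (rule exists_principal_representative)
    then have "c = cis a" using x(2)[OF that] by (simp add: cis_add_2pi_int)
    then have "Arg c = a" using a by (simp add: Arg_cis)
    then show ?thesis using a by blast
  qed
  then obtain N where N: "\<And>z. z \<in> T \<Longrightarrow> P k (x z) = Arg c + 2 * pi * of_int (N z)" by metis
  have "inj_on (\<lambda>z. N z mod int m) T"
  proof (rule inj_onI)
    fix z w assume zw: "z \<in> T" "w \<in> T" "N z mod int m = N w mod int m"
    then obtain l where l: "N w = N z + int m * l"
      by (metis mod_eqE mult.commute)
    have "P k (x z + 2 * pi * of_int l) = P k (x w)"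
      unfolding quasi N[OF zw(1)] N[OF zw(2)] l by (simp add: algebra_simps)
    then have "x w = x z + 2 * pi * of_int l" using phase_inj by metis
    then show "z = w" using x(1)[OF zw(1)] x(1)[OF zw(2)] by (metis cis_add_2pi_int)
  qed
  moreover have "(\<lambda>z. N z mod int m) ` T \<subseteq> {0..<int m}"
    using m by auto
  ultimately have "finite T" "card T \<le> card {0..<int m}"
    using card_inj_on_le[of "\<lambda>z. N z mod int m" T "{0..<int m}"] by (auto intro: inj_on_finite)
  then show "finite {cis x |x. cis (P k x) = c}" "card {cis x |x. cis (P k x) = c} \<le> m"
    unfolding T_def by auto
qed

end

text \<open>Two unit numbers at distance less than 1 have a quotient in the right half plane, away
  from the branch cut of \<open>Arg\<close>.\<close>

lemma tendsto_Arg_quotient: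
  assumes "a \<longlonglongrightarrow> a'" "b \<longlonglongrightarrow> b'" "cmod a' = 1" "cmod b' = 1" "cmod (a' - b') < 1"
  shows "(\<lambda>n. Arg (a n / b n)) \<longlonglongrightarrow> Arg (a' / b')" "\<bar>Arg (a' / b')\<bar> < pi / 2"
proof -
  have b0: "b' \<noteq> 0" using assms by auto
  have "cmod (a' / b' - 1) = cmod ((a' - b') / b')"
    using b0 by (simp add: diff_divide_distrib)
  then have "cmod (1 - a' / b') < 1" using assms by (simp add: norm_divide norm_minus_commute)
  then have Re: "Re (a' / b') > 0" using complex_Re_le_cmod[of "1 - a' / b'"] by simp
  then show "\<bar>Arg (a' / b')\<bar> < pi / 2" using Arg_Re_pos by blast
  have "isCont Arg (a' / b')"
    using Re by (intro continuous_at_Arg) (auto simp: complex_nonpos_Reals_iff)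
  then show "(\<lambda>n. Arg (a n / b n)) \<longlonglongrightarrow> Arg (a' / b')"
    by (rule isCont_tendsto_compose) (intro tendsto_divide assms b0)
qed

lemma cis_Arg_unit: "cmod z = 1 \<Longrightarrow> cis (Arg z) = z"
  by (subst cis_Arg) (auto simp: sgn_eq)

lemma norm_cis_diff_le: "cmod (cis x - cis y) \<le> \<bar>x - y\<bar>"
proof -
  have "cis x - cis y = cis y * (cis (x - y) - 1)" by (simp add: algebra_simps cis_mult)
  then have "cmod (cis x - cis y) = cmod (cis (x - y) - 1)" by (simp add: norm_mult)
  also have "\<dots> = 2 * \<bar>sin ((x - y) / 2)\<bar>"
    using dist_exp_i_1[of "x - y"] by (simp add: cis_conv_exp)
  also have "\<dots> \<le> \<bar>x - y\<bar>" using abs_sin_x_le_abs_x[of "(x - y) / 2"] by simp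
  finally show ?thesis .
qed

lemma conj_diag_dist:
  assumes V: "unitary_mat m V" and il: "i < m" "l < m" and w: "\<And>j. j < m \<Longrightarrow> cmod (f j - d j) \<le> \<omega>"
  shows "cmod (conj_diag m V f $$ (i, l) - conj_diag m V d $$ (i, l)) \<le> real m * \<omega>"
proof -
  note Vc = unitary_matD(1)[OF V]
  have "conj_diag m V f $$ (i, l) - conj_diag m V d $$ (i, l)
      = (\<Sum>j<m. V $$ (i, j) * (f j - d j) * cnj (V $$ (l, j)))"
    using il by (simp add: conj_diag_entry[OF Vc] algebra_simps sum_subtractf)
  also have "cmod \<dots> \<le> (\<Sum>j<m. \<omega>)"
  proof (rule order_trans[OF norm_sum sum_mono])
    fix j assume "j \<in> {..<m}"
    then have j: "j < m" by simp
    have "cmod (V $$ (i, j) * (f j - d j) * cnj (V $$ (l, j))) \<le> 1 * \<omega> * 1"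
      unfolding norm_mult using unitary_mat_entry_le_1[OF V il(1) j] unitary_mat_entry_le_1[OF V il(2) j] w[OF j]
      by (intro mult_mono mult_nonneg_nonneg) (auto intro: order_trans[OF norm_ge_zero])
    then show "cmod (V $$ (i, j) * (f j - d j) * cnj (V $$ (l, j))) \<le> \<omega>" by simp
  qed
  finally show ?thesis by simp
qed

text \<open>The new eigenvalues of \<open>\<beta> k\<close> are the points where the strictly increasing regularised counting
  function of \<open>\<alpha> k\<close> takes the value midway through its jumps, a condition on the spectrum of \<open>\<alpha> k\<close>
  alone; the sharp counting function of \<open>\<beta> k\<close> tells which of these points replaces a given
  eigenvalue.\<close>

lemma symmetric_spectrum_adjustment:
  assumes m: "0 < m" and \<omega>: "0 < \<omega>"
    and \<alpha>: "mat_continuous m \<alpha>" "Z2_periodic \<alpha>" "\<And>k. unitary_mat m (\<alpha> k)"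
    and sym: "\<And>k. char_poly (\<alpha> k) = char_poly (\<alpha> (- k))"
  shows "\<exists>\<delta>>0. \<forall>\<beta>. mat_continuous m \<beta> \<longrightarrow> Z2_periodic \<beta> \<longrightarrow> (\<forall>k. unitary_mat m (\<beta> k)) \<longrightarrow>
    (\<forall>k. completely_nondegenerate m (\<beta> k)) \<longrightarrow>
    (\<forall>k. \<forall>i<m. \<forall>j<m. cmod (\<alpha> k $$ (i, j) - \<beta> k $$ (i, j)) < \<delta>) \<longrightarrow>
    (\<exists>\<gamma>. mat_continuous m \<gamma> \<and> Z2_periodic \<gamma> \<and> (\<forall>k. unitary_mat m (\<gamma> k)) \<and>
      (\<forall>k. completely_nondegenerate m (\<gamma> k) \<and> spectrum_mat (\<gamma> k) = spectrum_mat (\<gamma> (- k))) \<and>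
      (\<forall>k. \<forall>i<m. \<forall>j<m. cmod (\<gamma> k $$ (i, j) - \<beta> k $$ (i, j)) \<le> real m * \<omega>))"
proof -
  \<comment> \<open>Half of \<omega>, so that a shift by \<omega> crosses a whole jump; the bound 1
    keeps \<open>s\<close> below pi.\<close>
  define s where "s = min (\<omega> / 2) 1"
  \<comment> \<open>The deviation \<open>(1 - t) * (real m * pi)\<close> from the pure staircase is
    then pi / 4, while \<open>t < 1\<close> preserves strict monotonicity.\<close>
  define t where "t = 1 - 1 / (4 * real m)"
  have s: "0 < s" "s < pi" "2 * s \<le> \<omega>" using \<omega> pi_gt3 by (auto simp: s_def)
  have t: "0 \<le> t" "t < 1" "t \<le> 1" "(1 - t) * (real m * pi) = pi / 4" using m by (auto simp: t_def field_simps)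
  obtain \<delta> where \<delta>: "\<delta> > 0"
    and near_phase: "\<And>U U' x. unitary_mat m U \<Longrightarrow> unitary_mat m U' \<Longrightarrow>
      (\<And>i j. i < m \<Longrightarrow> j < m \<Longrightarrow> cmod (U $$ (i, j) - U' $$ (i, j)) < \<delta>) \<Longrightarrow>
      \<bar>step_phase m t s (eig_vals m U) x - step_phase m t s (eig_vals m U') x\<bar> < 1 / 2"
    and near_prod: "\<And>U U'. unitary_mat m U \<Longrightarrow> unitary_mat m U' \<Longrightarrow>
      (\<And>i j. i < m \<Longrightarrow> j < m \<Longrightarrow> cmod (U $$ (i, j) - U' $$ (i, j)) < \<delta>) \<Longrightarrow>
      cmod ((\<Prod>j<m. eig_vals m U j) - (\<Prod>j<m. eig_vals m U' j)) < 1 / 2"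
    using spectral_data_uniform[OF s(1,2), of "1/2" m t] by auto
  show ?thesis
  proof (intro exI[of _ \<delta>] conjI allI impI)
    fix \<beta> :: "real^2 \<Rightarrow> complex mat"
    assume \<beta>: "mat_continuous m \<beta>" "Z2_periodic \<beta>" and "\<forall>k. unitary_mat m (\<beta> k)"
      and nd: "\<forall>k. completely_nondegenerate m (\<beta> k)"
      and close: "\<forall>k. \<forall>i<m. \<forall>j<m. cmod (\<alpha> k $$ (i, j) - \<beta> k $$ (i, j)) < \<delta>"
    then have U\<beta>: "\<And>k. unitary_mat m (\<beta> k)" by blast
    define a where "a k = eig_vals m (\<alpha> k)" for k
    define b where "b k = eig_vals m (\<beta> k)" for k
    have a1: "cmod (a k j) = 1" and b1: "cmod (b k j) = 1" if "j < m" for k j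
      using that norm_eig_vals[OF \<alpha>(3)] norm_eig_vals[OF U\<beta>] by (auto simp: a_def b_def)
    define ca where "ca k = (\<Prod>j<m. a k j)" for k
    define cb where "cb k = (\<Prod>j<m. b k j)" for k
    have ca1: "cmod (ca k) = 1" and cb1: "cmod (cb k) = 1" for k
      using a1 b1 by (simp_all add: ca_def cb_def prod_norm[symmetric])
    have cab: "cmod (ca k - cb k) < 1" for k
      using near_prod[OF \<alpha>(3) U\<beta>, of k k] close by (force simp: ca_def cb_def a_def b_def)
    obtain g where g: "g > 0" "\<And>k i j. i < m \<Longrightarrow> j < m \<Longrightarrow> i \<noteq> j \<Longrightarrow> g \<le> cmod (b k i - b k j)"
      using eigenvalue_gap[OF \<beta> U\<beta>] nd unfolding b_def by metis
    \<comment> \<open>The sharp width is allowed to depend on \<beta>: below its gap all jumps but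
      one are complete at every eigenvalue. The number \<delta> was fixed before and involves only
      the wide staircase.\<close>
    define s' where "s' = min g s"
    have s': "0 < s'" "s' < pi" "s' \<le> s" using s g by (auto simp: s'_def)
    have gap: "s' \<le> cmod (b k i - b k j)" if "i < m" "j < m" "i \<noteq> j" for k i j
      using g(2)[OF that, of k] by (simp add: s'_def)
    define P where "P k = step_phase m t s (a k)" for k
    \<comment> \<open>The target value for the phase of \<open>\<alpha> k\<close>. The sharp phase
      of \<open>\<beta> k\<close> meets the level belonging to the product \<open>cb k\<close> of
      its own eigenvalues; the added angle moves this level to the one belonging to
      \<open>ca k\<close>.\<close>
    define v where "v k x = step_phase m 1 s' (b k) x + Arg (ca k / cb k)" for k x
    have lim_a: "mat_tendsto m (\<lambda>n. \<alpha> (k n)) (\<alpha> l)" and lim_b: "mat_tendsto m (\<lambda>n. \<beta> (k n)) (\<beta> l)"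
      if "k \<longlonglongrightarrow> l" for k l
      using that mat_continuous_tendsto \<alpha>(1) \<beta>(1) by blast+
    have P_mono: "P k x < P k y" if "x < y" for k x y
      unfolding P_def using a1 s t m that by (intro step_phase_strict_mono) auto
    have P_quasi: "P k (x + 2 * pi * of_int n) = P k x + 2 * pi * of_int (int m * n)" for k x n
      unfolding P_def by (rule step_phase_add_2pi)
    have P_cont: "(\<lambda>n. P (k n) (x n)) \<longlonglongrightarrow> P l y" if "k \<longlonglongrightarrow> l" "x \<longlonglongrightarrow> y" for k l x y
      unfolding P_def a_def using that by (intro tendsto_step_phase s \<alpha>(3) lim_a)
    have v_cont: "(\<lambda>n. v (k n) (x n)) \<longlonglongrightarrow> v l y" if "k \<longlonglongrightarrow> l" "x \<longlonglongrightarrow> y" for k l x y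
      unfolding v_def
    proof (rule tendsto_add)
      show "(\<lambda>n. step_phase m 1 s' (b (k n)) (x n)) \<longlonglongrightarrow> step_phase m 1 s' (b l) y"
        unfolding b_def using that by (intro tendsto_step_phase s' U\<beta> lim_b)
      have "(\<lambda>n. ca (k n)) \<longlonglongrightarrow> ca l"
        unfolding ca_def a_def by (rule tendsto_prod_eig_vals[OF \<alpha>(3) \<alpha>(3) lim_a[OF that(1)]])
      moreover have "(\<lambda>n. cb (k n)) \<longlonglongrightarrow> cb l"
        unfolding cb_def b_def by (rule tendsto_prod_eig_vals[OF U\<beta> U\<beta> lim_b[OF that(1)]])
      ultimately show "(\<lambda>n. Arg (ca (k n) / cb (k n))) \<longlonglongrightarrow> Arg (ca l / cb l)"
        using ca1 cb1 cab by (intro tendsto_Arg_quotient(1))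
    qed
    note ctx = P_mono P_quasi P_cont m
    define X where "X k x = phase_inv P k (v k x)" for k x
    have PX: "P k (X k x) = v k x" for k x
      unfolding X_def by (rule phase_phase_inv[of P m, OF ctx])
    have X_shift: "X k (x + 2 * pi * of_int n) = X k x + 2 * pi * of_int n" for k x n
    proof -
      have "v k (x + 2 * pi * of_int n) = v k x + 2 * pi * of_int (int m * n)"
        unfolding v_def by (simp only: step_phase_add_2pi)
      then show ?thesis unfolding X_def by (simp only: phase_inv_shift[of P m, OF ctx])
    qed
    have X_cont: "(\<lambda>n. X (k n) (x n)) \<longlonglongrightarrow> X l y" if "k \<longlonglongrightarrow> l" "x \<longlonglongrightarrow> y" for k l x y
      unfolding X_def using that by (intro tendsto_phase_inv[of P m, OF ctx] v_cont)
    define f where "f k z = cis (X k (Arg z))" for k z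
    \<comment> \<open>\<open>X k\<close> commutes with translations by 2 pi, so the branch of
      \<open>Arg\<close> in the definition of \<open>f\<close> does not matter.\<close>
    have f_cis: "f k (cis x) = cis (X k x)" for k x
    proof -
      obtain n y where x: "x = y + 2 * pi * of_int n" "- pi < y" "y \<le> pi"
        by (rule exists_principal_representative)
      then show ?thesis unfolding f_def x(1) cis_add_2pi_int X_shift by (simp add: Arg_cis)
    qed
    have f_cont: "(\<lambda>n. f (k n) (z n)) \<longlonglongrightarrow> f l w"
      if kl: "k \<longlonglongrightarrow> l" and zw: "z \<longlonglongrightarrow> w" and z1: "\<And>n. cmod (z n) = 1" for k l z w
    proof -
      have w1: "cmod w = 1" using tendsto_norm[OF zw] z1 by (simp add: LIMSEQ_const_iff)
      \<comment> \<open>\<open>Arg (z n)\<close> need not converge when \<open>w\<close> is on the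
        branch cut; this lift of \<open>z n\<close>, taken relative to \<open>w\<close>,
        does.\<close>
      define x where "x n = Arg w + Arg (z n / w)" for n
      have "cis (x n) = z n" for n
        using z1[of n] w1 by (auto simp: x_def cis_mult[symmetric] cis_Arg_unit norm_divide)
      then have fz: "f (k n) (z n) = cis (X (k n) (x n))" for n by (metis f_cis)
      have "(\<lambda>n. Arg (z n / w)) \<longlonglongrightarrow> Arg (w / w)"
        using zw w1 by (intro tendsto_Arg_quotient) auto
      moreover have "w \<noteq> 0" using w1 by auto
      ultimately have "x \<longlonglongrightarrow> Arg w + 0"
        unfolding x_def by (intro tendsto_add) auto
      then have "(\<lambda>n. X (k n) (x n)) \<longlonglongrightarrow> X l (Arg w)" by (intro X_cont kl) simp
      then have "(\<lambda>n. cis (X (k n) (x n))) \<longlonglongrightarrow> cis (X l (Arg w))"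
        by (rule continuous_on_tendsto_compose[of UNIV cis, rotated]) (auto intro: continuous_intros)
      then show ?thesis by (simp only: fz) (simp add: f_def)
    qed
    have near: "\<bar>X k x - x\<bar> \<le> \<omega>" if i: "i < m" "cis x = b k i" for k x i
    proof -
      have q: "\<bar>P k y - step_phase m t s (b k) y\<bar> < 1 / 2" for y
        unfolding P_def a_def b_def using close by (intro near_phase \<alpha>(3) U\<beta>) auto
      have r: "\<bar>step_phase m t s (b k) y - step_phase m 1 s (b k) y\<bar> \<le> pi / 4" for y
        using step_phase_dist[of m "b k" s t y] b1 s t by simp
      have A: "\<bar>Arg (ca k / cb k)\<bar> < pi / 2"
        using tendsto_Arg_quotient(2)[OF tendsto_const tendsto_const ca1 cb1 cab] .
      note sh = step_phase_shift[of m "b k" s' s \<omega> i x, OF b1 s'(1,3) s(2,3) i]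
      \<comment> \<open>The margin pi of \<open>step_phase_shift\<close> pays for three errors: less
        than 1/2 for replacing \<alpha> by \<beta>, at most pi / 4 for \<open>t\<close>, and less
        than pi / 2 for the angle between the two products.\<close>
      have "v k x < P k (x + \<omega>)" "P k (x - \<omega>) < v k x"
        using q[of "x + \<omega>"] q[of "x - \<omega>"] r[of "x + \<omega>"] r[of "x - \<omega>"] A sh pi_gt3
        unfolding v_def by linarith+
      then have "P k (X k x) < P k (x + \<omega>)" "P k (x - \<omega>) < P k (X k x)" by (simp_all add: PX)
      then have "X k x < x + \<omega>" "x - \<omega> < X k x"
        using phase_less_iff[of P m, OF ctx] by blast+
      then show ?thesis by linarith
    qed
    have level: "cis (P k (X k x)) = (- 1) ^ (m - 1) * ca k" if i: "i < m" "cis x = b k i" for k x i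
    proof -
      have "cis (step_phase m 1 s' (b k) x) = (- 1) ^ (m - 1) * cb k"
        unfolding cb_def by (rule cis_step_phase[of m "b k" s' i x, OF b1 s'(1,2) i]) (use gap i in auto)
      moreover have "cis (Arg (ca k / cb k)) = ca k / cb k"
        using ca1 cb1 by (intro cis_Arg_unit) (simp add: norm_divide)
      moreover have "cb k \<noteq> 0" using cb1[of k] by auto
      ultimately show ?thesis by (simp add: PX v_def cis_mult[symmetric])
    qed
    have inj: "inj_on (\<lambda>j. f k (b k j)) {..<m}" for k
    proof (rule inj_onI, rule ccontr)
      fix i j assume ij: "i \<in> {..<m}" "j \<in> {..<m}" "f k (b k i) = f k (b k j)" "i \<noteq> j"
      \<comment> \<open>\<open>X k\<close> may be constant between eigenvalues, so strict growth is
        available only from an eigenangle. Used from \<open>x\<close> to \<open>y\<close> and from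
        \<open>y\<close> to \<open>x + 2 * pi\<close>, it confines \<open>X k y - X k x\<close>
        strictly between 0 and 2 pi.\<close>
      have lt: "X k x < X k y" if "l < m" "cis x = b k l" "x < y" for l x y
      proof -
        have "P k (X k x) < P k (X k y)"
          using step_phase_less[of m "b k" s' l x y, OF b1 s'(1,2) that] by (simp add: PX v_def)
        then show ?thesis using phase_less_iff[of P m, OF ctx] by blast
      qed
      have step: False if ij: "i < m" "j < m" "f k (b k i) = f k (b k j)" "Arg (b k i) < Arg (b k j)" for i j
      proof -
        define x y where "x = Arg (b k i)" and "y = Arg (b k j)"
        have xy: "cis x = b k i" "cis y = b k j" "x < y" "y < x + 2 * pi"
          using ij b1 Arg_bounded[of "b k i"] Arg_bounded[of "b k j"] by (auto simp: x_def y_def cis_Arg_unit)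
        have "X k x < X k y" using lt[OF ij(1) xy(1,3)] .
        moreover have "X k y < X k x + 2 * pi" using lt[OF ij(2) xy(2,4)] X_shift[of k x 1] by simp
        moreover have "cis (X k x) = cis (X k y)" using ij(3) xy f_cis by metis
        then have "cis (X k y - X k x) = 1" by (simp add: cis_divide[symmetric])
        then obtain n where "X k y - X k x = 2 * pi * of_int n" by (rule cis_eq_1_imp)
        ultimately have "0 < 2 * pi * real_of_int n" "2 * pi * real_of_int n < 2 * pi * 1" by linarith+
        then have "0 < n" "real_of_int n < 1" by (auto simp: zero_less_mult_iff mult_less_cancel_left)
        then show False by linarith
      qed
      have "b k i \<noteq> b k j" using gap[of i j k] ij s' by auto
      then have "Arg (b k i) \<noteq> Arg (b k j)"
        using ij b1 cis_Arg_unit by (metis lessThan_iff)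
      then show False using step[of i j] step[of j i] ij by fastforce
    qed
    define \<gamma> where "\<gamma> k = conj_diag m (eig_vecs m (\<beta> k)) (\<lambda>j. f k (eig_vals m (\<beta> k) j))" for k
    have \<gamma>_b: "\<gamma> k = conj_diag m (eig_vecs m (\<beta> k)) (\<lambda>j. f k (b k j))" for k
      by (simp add: \<gamma>_def b_def)
    have cont: "mat_continuous m \<gamma>"
      unfolding \<gamma>_def by (rule mat_continuous_functional_calculus[OF \<beta>(1) U\<beta> f_cont])
    have unit: "unitary_mat m (\<gamma> k)" for k
      unfolding \<gamma>_def by (rule unitary_conj_diag[OF unitary_eig_vecs[OF U\<beta>]]) (simp add: f_def)
    have per: "Z2_periodic \<gamma>"
      unfolding Z2_periodic_def
    proof (intro allI impI)
      fix k z :: "real^2" assume z: "\<forall>i. z $ i \<in> \<int>"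
      then have eq: "\<alpha> (k + z) = \<alpha> k" "\<beta> (k + z) = \<beta> k"
        using \<alpha>(2) \<beta>(2) by (auto simp: Z2_periodic_def)
      have "P (k + z) = P k" "v (k + z) = v k"
        by (auto simp: P_def v_def ca_def cb_def a_def b_def eq)
      then have "f (k + z) = f k" unfolding f_def X_def phase_inv_def by simp
      then show "\<gamma> (k + z) = \<gamma> k" by (simp add: \<gamma>_def eq)
    qed
    have spec: "spectrum_mat (\<gamma> k) = (\<lambda>j. f k (b k j)) ` {..<m}" for k
      unfolding \<gamma>_b by (rule spectrum_conj_diag[OF unitary_eig_vecs[OF U\<beta>]])
    then have card: "card (spectrum_mat (\<gamma> k)) = m" for k
      using card_image[OF inj, of k] by simp
    \<comment> \<open>The \<open>m\<close> distinct new eigenvalues lie in a level set with at most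
      \<open>m\<close> points, so they exhaust it. The right-hand side involves the spectrum of
      \<open>\<alpha> k\<close> alone, which gives the symmetry in \<open>k\<close>.\<close>
    have spec_level: "spectrum_mat (\<gamma> k) = {cis x |x. cis (P k x) = (- 1) ^ (m - 1) * ca k}" for k
    proof (rule card_subset_eq)
      have 1: "cmod ((- 1) ^ (m - 1) * ca k) = 1" using ca1 by (simp add: norm_mult norm_power)
      show fin: "finite {cis x |x. cis (P k x) = (- 1) ^ (m - 1) * ca k}"
        by (rule phase_level_set(1)[of P m, OF ctx 1])
      have le: "card {cis x |x. cis (P k x) = (- 1) ^ (m - 1) * ca k} \<le> m"
        by (rule phase_level_set(2)[of P m, OF ctx 1])
      show sub: "spectrum_mat (\<gamma> k) \<subseteq> {cis x |x. cis (P k x) = (- 1) ^ (m - 1) * ca k}"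
        unfolding spec
      proof (rule image_subsetI)
        fix j assume j: "j \<in> {..<m}"
        then have "cis (Arg (b k j)) = b k j" using b1 by (simp add: cis_Arg_unit)
        then show "f k (b k j) \<in> {cis x |x. cis (P k x) = (- 1) ^ (m - 1) * ca k}"
          unfolding f_def using j level[of j "Arg (b k j)" k] by blast
      qed
      show "card (spectrum_mat (\<gamma> k)) = card {cis x |x. cis (P k x) = (- 1) ^ (m - 1) * ca k}"
        using card_mono[OF fin sub] le card[of k] by simp
    qed
    have "P k = P (- k)" "ca k = ca (- k)" for k
      using step_phase_char_poly_cong[OF \<alpha>(3) \<alpha>(3) sym] by (auto simp: P_def ca_def a_def)
    then have symm: "spectrum_mat (\<gamma> k) = spectrum_mat (\<gamma> (- k))" for k
      unfolding spec_level by metis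
    have dist: "cmod (\<gamma> k $$ (i, j) - \<beta> k $$ (i, j)) \<le> real m * \<omega>" if "i < m" "j < m" for k i j
    proof -
      have "cmod (conj_diag m (eig_vecs m (\<beta> k)) (\<lambda>j. f k (b k j)) $$ (i, j)
          - conj_diag m (eig_vecs m (\<beta> k)) (b k) $$ (i, j)) \<le> real m * \<omega>"
      proof (rule conj_diag_dist[OF unitary_eig_vecs[OF U\<beta>] that])
        fix l assume l: "l < m"
        define x where "x = Arg (b k l)"
        have x: "cis x = b k l" using b1[OF l] by (simp add: x_def cis_Arg_unit)
        have "cmod (f k (b k l) - b k l) = cmod (cis (X k x) - cis x)"
          by (simp only: f_cis flip: x)
        also have "\<dots> \<le> \<bar>X k x - x\<bar>" by (rule norm_cis_diff_le)
        also have "\<dots> \<le> \<omega>" by (rule near[OF l x])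
        finally show "cmod (f k (b k l) - b k l) \<le> \<omega>" .
      qed
      then show ?thesis by (simp add: \<gamma>_b b_def conj_diag_eig[OF U\<beta>])
    qed
    show "\<exists>\<gamma>. mat_continuous m \<gamma> \<and> Z2_periodic \<gamma> \<and> (\<forall>k. unitary_mat m (\<gamma> k)) \<and>
      (\<forall>k. completely_nondegenerate m (\<gamma> k) \<and> spectrum_mat (\<gamma> k) = spectrum_mat (\<gamma> (- k))) \<and>
      (\<forall>k. \<forall>i<m. \<forall>j<m. cmod (\<gamma> k $$ (i, j) - \<beta> k $$ (i, j)) \<le> real m * \<omega>)"
      using cont per unit card symm dist unfolding completely_nondegenerate_def
      by (intro exI[of _ \<gamma>] conjI allI impI) blast+
  qed (rule \<delta>)
qed

section \<open>Lipschitz approximation by unitary matrices\<close>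

text \<open>Boundedness is included so that the class is closed under products.\<close>

definition lip_bounded :: "(real^2 \<Rightarrow> complex) \<Rightarrow> bool" where
  "lip_bounded f \<longleftrightarrow> (\<exists>B. \<forall>k. cmod (f k) \<le> B) \<and> (\<exists>L. \<forall>k k'. cmod (f k - f k') \<le> L * dist k k')"

lemma lip_boundedE:
  assumes "lip_bounded f"
  obtains B L where "0 \<le> B" "0 \<le> L" "\<And>k. cmod (f k) \<le> B" "\<And>k k'. cmod (f k - f k') \<le> L * dist k k'"
proof -
  obtain B L where B: "\<And>k. cmod (f k) \<le> B" and L: "\<And>k k'. cmod (f k - f k') \<le> L * dist k k'"
    using assms by (auto simp: lip_bounded_def)
  have "L * dist k k' \<le> max L 0 * dist k k'" for k k' :: "real^2"
    by (intro mult_right_mono) auto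
  then show ?thesis
    using that[of B "max L 0"] B L order_trans[OF norm_ge_zero B] by (meson max.cobounded2 order_trans)
qed

lemma lip_bounded_const: "lip_bounded (\<lambda>k. c)"
  unfolding lip_bounded_def by (intro conjI exI[of _ "cmod c"] exI[of _ 0]) auto

lemma lip_bounded_add:
  assumes "lip_bounded f" "lip_bounded g"
  shows "lip_bounded (\<lambda>k. f k + g k)"
proof -
  obtain B L where f: "0 \<le> B" "0 \<le> L" "\<And>k. cmod (f k) \<le> B" "\<And>k k'. cmod (f k - f k') \<le> L * dist k k'"
    using lip_boundedE[OF assms(1)] by blast
  obtain B' L' where g: "0 \<le> B'" "0 \<le> L'" "\<And>k. cmod (g k) \<le> B'" "\<And>k k'. cmod (g k - g k') \<le> L' * dist k k'"
    using lip_boundedE[OF assms(2)] by blast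
  have "cmod (f k + g k) \<le> B + B'" for k
    using norm_triangle_ineq[of "f k" "g k"] f(3)[of k] g(3)[of k] by linarith
  moreover have "cmod (f k + g k - (f k' + g k')) \<le> (L + L') * dist k k'" for k k'
    using norm_triangle_ineq[of "f k - f k'" "g k - g k'"] f(4)[of k k'] g(4)[of k k']
    by (simp add: algebra_simps)
  ultimately show ?thesis unfolding lip_bounded_def by blast
qed

lemma lip_bounded_mult:
  assumes "lip_bounded f" "lip_bounded g"
  shows "lip_bounded (\<lambda>k. f k * g k)"
proof -
  obtain B L where f: "0 \<le> B" "0 \<le> L" "\<And>k. cmod (f k) \<le> B" "\<And>k k'. cmod (f k - f k') \<le> L * dist k k'"
    using lip_boundedE[OF assms(1)] by blast
  obtain B' L' where g: "0 \<le> B'" "0 \<le> L'" "\<And>k. cmod (g k) \<le> B'" "\<And>k k'. cmod (g k - g k') \<le> L' * dist k k'"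
    using lip_boundedE[OF assms(2)] by blast
  have "cmod (f k * g k) \<le> B * B'" for k
    unfolding norm_mult using f g by (intro mult_mono) auto
  moreover have "cmod (f k * g k - f k' * g k') \<le> (B * L' + L * B') * dist k k'" for k k'
  proof -
    have "f k * g k - f k' * g k' = f k * (g k - g k') + (f k - f k') * g k'"
      by (simp add: algebra_simps)
    then have "cmod (f k * g k - f k' * g k') \<le> cmod (f k) * cmod (g k - g k') + cmod (f k - f k') * cmod (g k')"
      by (metis norm_mult norm_triangle_ineq)
    also have "\<dots> \<le> B * (L' * dist k k') + (L * dist k k') * B'"
      using f g by (intro add_mono mult_mono) auto
    finally show ?thesis by (simp add: algebra_simps)
  qed
  ultimately show ?thesis unfolding lip_bounded_def by blast
qed

lemma lip_bounded_cnj: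
  assumes "lip_bounded f"
  shows "lip_bounded (\<lambda>k. cnj (f k))"
  using assms by (simp add: lip_bounded_def flip: complex_cnj_diff)

lemma lip_bounded_diff:
  assumes "lip_bounded f" "lip_bounded g"
  shows "lip_bounded (\<lambda>k. f k - g k)"
  using lip_bounded_add[OF assms(1) lip_bounded_mult[OF lip_bounded_const[of "-1"] assms(2)]] by simp

lemma lip_bounded_sum:
  assumes "\<And>i. i \<in> A \<Longrightarrow> lip_bounded (f i)"
  shows "lip_bounded (\<lambda>k. \<Sum>i\<in>A. f i k)"
  using assms by (induction A rule: infinite_finite_induct) (auto intro: lip_bounded_add lip_bounded_const)

text \<open>With \<open>a\<close> and \<open>b\<close> the two square roots, both at least 1/2, one
  has \<open>1/a - 1/b = (b - a) / (a * b)\<close> and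
  \<open>(b - a) * (a + b) = N k' - N k\<close>. The bounds \<open>a * b \<ge> 1/4\<close> and
  \<open>a + b \<ge> 1\<close> give the constant 4.\<close>

lemma lip_bounded_inverse_sqrt:
  assumes N: "lip_bounded (\<lambda>k. complex_of_real (N k))" and low: "\<And>k. 1 / 4 \<le> N k"
  shows "lip_bounded (\<lambda>k. complex_of_real (1 / sqrt (N k)))"
proof -
  obtain B L where "0 \<le> B" and L: "0 \<le> L"
    and "\<And>k. cmod (complex_of_real (N k)) \<le> B"
    and L': "\<And>k k'. cmod (complex_of_real (N k) - complex_of_real (N k')) \<le> L * dist k k'"
    using lip_boundedE[OF N] by blast
  have s: "1 / 2 \<le> sqrt (N k)" for k
    using low[of k] by (intro real_le_rsqrt) (simp add: power2_eq_square)
  have sp: "0 < sqrt (N k)" for k using low[of k] by simp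
  have "1 / sqrt (N k) \<le> 2" for k
    using s[of k] sp[of k] by (simp add: pos_divide_le_eq)
  moreover have "0 \<le> 1 / sqrt (N k)" for k using sp[of k] by simp
  ultimately have "cmod (complex_of_real (1 / sqrt (N k))) \<le> 2" for k
    by (simp only: norm_of_real abs_of_nonneg)
  moreover have "cmod (complex_of_real (1 / sqrt (N k)) - complex_of_real (1 / sqrt (N k'))) \<le> 4 * L * dist k k'" for k k'
  proof -
    define a b where "a = sqrt (N k)" and "b = sqrt (N k')"
    have ab: "1 / 2 \<le> a" "1 / 2 \<le> b" "0 < a" "0 < b" using s sp by (auto simp: a_def b_def)
    have sq: "N k = a * a" "N k' = b * b" using low[of k] low[of k'] by (auto simp: a_def b_def)
    have "1 / 4 \<le> a * b" using mult_mono[OF ab(1,2)] ab by simp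
    then have "\<bar>b - a\<bar> \<le> 4 * \<bar>b - a\<bar> * (a * b)"
      using mult_left_mono[of "1 / 4" "a * b" "\<bar>b - a\<bar>"] by simp
    also have "\<dots> \<le> 4 * \<bar>b - a\<bar> * (a * b) * (a + b)"
      using ab mult_left_mono[of 1 "a + b" "4 * \<bar>b - a\<bar> * (a * b)"] by simp
    also have "\<bar>b - a\<bar> * (a + b) = \<bar>(b - a) * (a + b)\<bar>" using ab by (simp add: abs_mult)
    then have "4 * \<bar>b - a\<bar> * (a * b) * (a + b) = 4 * \<bar>(b - a) * (a + b)\<bar> * (a * b)" by simp
    also have "(b - a) * (a + b) = N k' - N k" by (simp add: sq algebra_simps)
    finally have "\<bar>b - a\<bar> / (a * b) \<le> 4 * \<bar>N k' - N k\<bar>"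
      using ab by (simp add: divide_le_eq)
    moreover have "1 / a - 1 / b = (b - a) / (a * b)" using ab by (simp add: divide_simps)
    ultimately have "\<bar>1 / a - 1 / b\<bar> \<le> 4 * \<bar>N k' - N k\<bar>" using ab by (simp add: abs_mult)
    also have "\<bar>N k' - N k\<bar> \<le> L * dist k k'"
      using L'[of k k'] by (simp add: norm_minus_commute flip: of_real_diff)
    finally have "\<bar>1 / a - 1 / b\<bar> \<le> 4 * L * dist k k'" by simp
    then show ?thesis unfolding a_def b_def by (simp only: norm_of_real flip: of_real_diff)
  qed
  ultimately show ?thesis unfolding lip_bounded_def by blast
qed

lemma lip_bounded_imp_continuous_on:
  assumes "lip_bounded f"
  shows "continuous_on UNIV f"
proof -
  obtain B L where "0 \<le> L" "\<And>k k'. cmod (f k - f k') \<le> L * dist k k'"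
    using lip_boundedE[OF assms] by metis
  then have "L-lipschitz_on UNIV f" by (intro lipschitz_onI) (auto simp: dist_norm)
  then show ?thesis by (rule lipschitz_on_continuous_on)
qed

section \<open>Lipschitz approximation of periodic functions\<close>

lemma periodic_bounded_uniformly_continuous:
  fixes f :: "real^2 \<Rightarrow> real"
  assumes cont: "continuous_on UNIV f" and per: "Z2_periodic f"
  shows "\<exists>B. \<forall>k. \<bar>f k\<bar> \<le> B"
    and "e > 0 \<Longrightarrow> \<exists>d>0. \<forall>k k'. dist k k' < d \<longrightarrow> \<bar>f k - f k'\<bar> < e"
proof -
  have red: "\<exists>z :: real^2. (\<forall>x. f (x + z) = f x) \<and> norm (k + z) \<le> 2" for k
  proof -
    obtain z :: "real^2" where "\<And>i. z $ i \<in> \<int>" "\<And>i. 0 \<le> (k + z) $ i" "\<And>i. (k + z) $ i < 1"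
      using Z2_periodic_fundamental_domain[of k] by metis
    moreover from this have "norm (k + z) \<le> 2" by (intro bounded_unit_square)
    ultimately show ?thesis using per unfolding Z2_periodic_def by blast
  qed
  have comp: "compact (f ` cball 0 2)"
    by (intro compact_continuous_image continuous_on_subset[OF cont]) auto
  then obtain B where B: "\<And>x. x \<in> cball 0 2 \<Longrightarrow> \<bar>f x\<bar> \<le> B"
    using compact_imp_bounded[OF comp] unfolding bounded_iff by force
  have "\<bar>f k\<bar> \<le> B" for k
    using red[of k] B by (metis mem_cball_0)
  then show "\<exists>B. \<forall>k. \<bar>f k\<bar> \<le> B" by blast
  assume e: "e > 0"
  \<comment> \<open>One integer translation has to serve both points: \<open>k + z\<close> lies in
    the ball of radius 2, and \<open>k'\<close> is within distance 1 of \<open>k\<close>.\<close>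
  have "uniformly_continuous_on (cball 0 3) f"
    by (intro compact_uniformly_continuous continuous_on_subset[OF cont]) auto
  then obtain d where d: "d > 0" "\<And>x x'. x \<in> cball 0 3 \<Longrightarrow> x' \<in> cball 0 3 \<Longrightarrow> dist x' x < d \<Longrightarrow> dist (f x') (f x) < e"
    using e by (metis uniformly_continuous_onE)
  show "\<exists>d>0. \<forall>k k'. dist k k' < d \<longrightarrow> \<bar>f k - f k'\<bar> < e"
  proof (intro exI[of _ "min d 1"] conjI allI impI)
    fix k k' :: "real^2" assume lt: "dist k k' < min d 1"
    obtain z where z: "\<And>x. f (x + z) = f x" "norm (k + z) \<le> 2" using red[of k] by blast
    have "norm (k' + z) \<le> norm (k + z) + norm (k' - k)"
      using norm_triangle_ineq[of "k + z" "k' - k"] by (simp add: algebra_simps)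
    then have "norm (k' + z) \<le> 3" using z(2) lt by (simp add: dist_norm norm_minus_commute)
    then have "dist (f (k + z)) (f (k' + z)) < e"
      using z(2) lt by (intro d(2)) auto
    then show "\<bar>f k - f k'\<bar> < e" by (simp add: z(1) dist_real_def)
  qed (use d in auto)
qed

text \<open>Inf-convolution with a multiple of the distance preserves periodicity and makes the function
  Lipschitz.\<close>

lemma periodic_lipschitz_approx_real:
  fixes f :: "real^2 \<Rightarrow> real"
  assumes cont: "continuous_on UNIV f" and per: "Z2_periodic f" and e: "e > 0"
  obtains g where "Z2_periodic g" "lip_bounded (\<lambda>k. complex_of_real (g k))" "\<And>k. \<bar>g k - f k\<bar> \<le> e"
proof -
  obtain B where B: "\<And>k. \<bar>f k\<bar> \<le> B" using periodic_bounded_uniformly_continuous(1)[OF cont per] by blast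
  obtain d where d: "d > 0" "\<And>k k'. dist k k' < d \<Longrightarrow> \<bar>f k - f k'\<bar> < e"
    using periodic_bounded_uniformly_continuous(2)[OF cont per e] by blast
  \<comment> \<open>With this slope the penalty beyond distance \<open>d\<close> exceeds the largest
    possible oscillation \<open>2 * B\<close>, so only points closer than \<open>d\<close> can lower
    the infimum noticeably.\<close>
  define n where "n = 2 * B / d"
  have B0: "0 \<le> B" using B[of 0] by linarith
  then have n: "0 \<le> n" "n * d = 2 * B" using d by (auto simp: n_def)
  define g where "g k = (INF x. f x + n * dist k x)" for k
  have bdd: "bdd_below (range (\<lambda>x. f x + n * dist k x))" for k
  proof (rule bdd_belowI)
    fix y assume "y \<in> range (\<lambda>x. f x + n * dist k x)"
    then obtain x where "y = f x + n * dist k x" by blast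
    moreover have "0 \<le> n * dist k x" using n by simp
    ultimately show "- B \<le> y" using B[of x] by linarith
  qed
  have le: "g k \<le> f x + n * dist k x" for k x
    unfolding g_def by (rule cINF_lower[OF bdd]) simp
  have ge: "c \<le> g k" if "\<And>x. c \<le> f x + n * dist k x" for c k
    unfolding g_def by (rule cINF_greatest) (use that in auto)
  have up: "g k \<le> f k" for k using le[of k k] by simp
  have low: "f k - e \<le> g k" for k
  proof (rule ge)
    fix x
    show "f k - e \<le> f x + n * dist k x"
    proof (cases "dist k x < d")
      case True
      have "0 \<le> n * dist k x" using n by simp
      then show ?thesis using d(2)[OF True] by linarith
    next
      case False
      then have "n * d \<le> n * dist k x" using n by (intro mult_left_mono) auto
      then show ?thesis using n(2) B[of k] B[of x] e by linarith
    qed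
  qed
  have lip: "g k \<le> g k' + n * dist k k'" for k k'
  proof -
    have "g k - n * dist k k' \<le> g k'"
    proof (rule ge)
      fix x
      have "n * dist k x \<le> n * (dist k k' + dist k' x)"
        using n by (intro mult_left_mono dist_triangle) auto
      then show "g k - n * dist k k' \<le> f x + n * dist k' x"
        using le[of k x] by (simp add: algebra_simps)
    qed
    then show ?thesis by simp
  qed
  have shift: "g (k + z) \<le> g k" if z: "\<And>i. z $ i \<in> \<int>" for k z :: "real^2"
  proof (rule ge)
    fix x
    have "g (k + z) \<le> f (x + z) + n * dist (k + z) (x + z)" by (rule le)
    then show "g (k + z) \<le> f x + n * dist k x" using per z by (simp add: Z2_periodic_def)
  qed
  have "Z2_periodic g"
    unfolding Z2_periodic_def
  proof (intro allI impI antisym)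
    fix k z :: "real^2" assume z: "\<forall>i. z $ i \<in> \<int>"
    then show "g (k + z) \<le> g k" by (intro shift) auto
    show "g k \<le> g (k + z)" using shift[of "- z" "k + z"] z by simp
  qed
  moreover have "lip_bounded (\<lambda>k. complex_of_real (g k))"
    unfolding lip_bounded_def
  proof (intro conjI exI allI)
    fix k k'
    have "\<bar>g k\<bar> \<le> B + e" using up[of k] low[of k] B[of k] e by linarith
    then show "cmod (complex_of_real (g k)) \<le> B + e" by (simp only: norm_of_real)
    have "\<bar>g k - g k'\<bar> \<le> n * dist k k'"
      using lip[of k k'] lip[of k' k] by (simp add: dist_commute abs_le_iff algebra_simps)
    then show "cmod (complex_of_real (g k) - complex_of_real (g k')) \<le> n * dist k k'"
      by (simp flip: of_real_diff)
  qed
  moreover have "\<bar>g k - f k\<bar> \<le> e" for k using up[of k] low[of k] e by linarith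
  ultimately show ?thesis using that by blast
qed

lemma periodic_lipschitz_approx:
  fixes f :: "real^2 \<Rightarrow> complex"
  assumes cont: "continuous_on UNIV f" and per: "Z2_periodic f" and e: "e > 0"
  obtains g where "Z2_periodic g" "lip_bounded g" "\<And>k. cmod (g k - f k) \<le> e"
proof -
  have "Z2_periodic (\<lambda>k. Re (f k))" "Z2_periodic (\<lambda>k. Im (f k))"
    using per by (auto simp: Z2_periodic_def)
  moreover have "continuous_on UNIV (\<lambda>k. Re (f k))" "continuous_on UNIV (\<lambda>k. Im (f k))"
    by (intro continuous_intros cont)+
  moreover have "e / 2 > 0" using e by simp
  ultimately obtain a b where a: "Z2_periodic a" "lip_bounded (\<lambda>k. complex_of_real (a k))" "\<And>k. \<bar>a k - Re (f k)\<bar> \<le> e / 2"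
    and b: "Z2_periodic b" "lip_bounded (\<lambda>k. complex_of_real (b k))" "\<And>k. \<bar>b k - Im (f k)\<bar> \<le> e / 2"
    using periodic_lipschitz_approx_real by metis
  show ?thesis
  proof (rule that[of "\<lambda>k. complex_of_real (a k) + \<i> * complex_of_real (b k)"])
    show "Z2_periodic (\<lambda>k. complex_of_real (a k) + \<i> * complex_of_real (b k))"
      using a(1) b(1) by (auto simp: Z2_periodic_def)
    show "lip_bounded (\<lambda>k. complex_of_real (a k) + \<i> * complex_of_real (b k))"
      by (intro lip_bounded_add lip_bounded_mult lip_bounded_const a b)
    fix k
    have "cmod (complex_of_real (a k) + \<i> * complex_of_real (b k) - f k) \<le> \<bar>a k - Re (f k)\<bar> + \<bar>b k - Im (f k)\<bar>"
      by (rule order_trans[OF cmod_le]) simp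
    then show "cmod (complex_of_real (a k) + \<i> * complex_of_real (b k) - f k) \<le> e"
      using a(3)[of k] b(3)[of k] by linarith
  qed
qed

text \<open>Approximating the entries by Lipschitz functions spoils unitarity; orthonormalising
  column by column restores it, by operations that preserve both periodicity and the bounded
  Lipschitz property. The accuracy is universally quantified in the induction because the earlier
  columns must be far more accurate than the new one.\<close>

lemma gram_schmidt_lipschitz:
  assumes \<alpha>: "mat_continuous m \<alpha>" "Z2_periodic \<alpha>" "\<And>k. unitary_mat m (\<alpha> k)"
    and "j \<le> m" "0 < \<delta>"
  shows "\<exists>u. (\<forall>i<j. \<forall>l<m. lip_bounded (u i l) \<and> Z2_periodic (u i l) \<and> (\<forall>k. cmod (u i l k - \<alpha> k $$ (l, i)) \<le> \<delta>)) \<and>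
    (\<forall>i<j. \<forall>i'<j. \<forall>k. (\<Sum>l<m. cnj (u i l k) * u i' l k) = (if i = i' then 1 else 0))"
  using assms(4,5)
proof (induction j arbitrary: \<delta>)
  case 0
  then show ?case by simp
next
  case (Suc j)
  have j: "j < m" using Suc.prems by simp
  \<comment> \<open>Inputs accurate to \<eta> give projection coefficients of size at most
    \<open>2 * m * \<eta>\<close>, so \<open>v\<close> is within
    \<open>c * \<eta> = \<kappa>\<close> of column \<open>j\<close>. Then \<open>N\<close> is within
    \<open>3 * m * \<kappa>\<close> of 1, \<open>1 / sqrt N\<close> within
    \<open>6 * m * \<kappa>\<close>, and, as \<open>v\<close> has entries at most 2,
    \<open>w\<close> is within \<open>13 * (m + 1) * \<kappa>\<close>. \<open>D\<close> collects
    these factors; the minimum with 1 in \<eta> keeps \<open>N\<close> above 1/4.\<close>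
  define c where "c = 1 + 2 * real m * real m"
  define D where "D = 13 * (real m + 1) * c"
  have cD: "1 \<le> c" "13 \<le> D"
  proof -
    show c: "1 \<le> c" by (simp add: c_def)
    have "13 * 1 * 1 \<le> D" unfolding D_def using c by (intro mult_mono) auto
    then show "13 \<le> D" by simp
  qed
  define \<eta> where "\<eta> = min \<delta> 1 / D"
  have eta: "0 < \<eta>" "D * \<eta> = min \<delta> 1" using Suc.prems cD by (auto simp: \<eta>_def)
  define \<kappa> where "\<kappa> = c * \<eta>"
  have kap: "0 < \<kappa>" "13 * (real m + 1) * \<kappa> \<le> \<delta>" "13 * (real m + 1) * \<kappa> \<le> 1"
    using eta cD by (auto simp: \<kappa>_def D_def algebra_simps)
  have mk: "0 \<le> real m * \<kappa>" using kap by simp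
  have "13 * (real m * \<kappa>) + 13 * \<kappa> \<le> 1" using kap(3) by (simp add: algebra_simps)
  then have kap1: "\<kappa> \<le> 1" "3 * (real m * \<kappa>) \<le> 3 / 4"
    using kap(1) mk by linarith+
  obtain u where u: "\<And>i l. i < j \<Longrightarrow> l < m \<Longrightarrow> lip_bounded (u i l)"
      "\<And>i l. i < j \<Longrightarrow> l < m \<Longrightarrow> Z2_periodic (u i l)"
      "\<And>i l k. i < j \<Longrightarrow> l < m \<Longrightarrow> cmod (u i l k - \<alpha> k $$ (l, i)) \<le> \<eta>"
    and orth: "\<And>i i' k. i < j \<Longrightarrow> i' < j \<Longrightarrow> (\<Sum>l<m. cnj (u i l k) * u i' l k) = (if i = i' then 1 else 0)"
    using Suc.IH[OF Suc_leD[OF Suc.prems(1)] eta(1)] by blast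
  have "\<exists>g. Z2_periodic g \<and> lip_bounded g \<and> (\<forall>k. cmod (g k - \<alpha> k $$ (l, j)) \<le> \<eta>)" if "l < m" for l
  proof -
    have "continuous_on UNIV (\<lambda>k. \<alpha> k $$ (l, j))" using \<alpha>(1) that j by (simp add: mat_continuous_def)
    moreover have "Z2_periodic (\<lambda>k. \<alpha> k $$ (l, j))" using \<alpha>(2) by (simp add: Z2_periodic_def)
    ultimately show ?thesis using periodic_lipschitz_approx eta(1) by metis
  qed
  then obtain x where x: "\<And>l. l < m \<Longrightarrow> Z2_periodic (x l)" "\<And>l. l < m \<Longrightarrow> lip_bounded (x l)"
    "\<And>l k. l < m \<Longrightarrow> cmod (x l k - \<alpha> k $$ (l, j)) \<le> \<eta>" by metis
  have \<alpha>1: "cmod (\<alpha> k $$ (l, i)) \<le> 1" if "l < m" "i < m" for k l i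
    using unitary_mat_entry_le_1[OF \<alpha>(3) that] .
  have u1: "cmod (u i l k) \<le> 1" if il: "i < j" "l < m" for i l k
  proof -
    have "(\<Sum>l<m. complex_of_real ((cmod (u i l k))\<^sup>2)) = 1"
      using orth[OF il(1) il(1), of k] by (simp add: mult.commute complex_norm_square[symmetric] flip: of_real_power)
    then have "(\<Sum>l<m. (cmod (u i l k))\<^sup>2) = 1"
      by (metis of_real_eq_1_iff of_real_sum)
    moreover have "(cmod (u i l k))\<^sup>2 \<le> (\<Sum>l<m. (cmod (u i l k))\<^sup>2)"
      using il by (intro member_le_sum) auto
    ultimately show ?thesis by (simp add: power_le_one_iff)
  qed
  define co where "co i k = (\<Sum>l<m. cnj (u i l k) * x l k)" for i k
  define v where "v l k = x l k - (\<Sum>i<j. co i k * u i l k)" for l k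
  define N where "N k = (\<Sum>l<m. (cmod (v l k))\<^sup>2)" for k
  define w where "w l k = v l k * complex_of_real (1 / sqrt (N k))" for l k
  \<comment> \<open>The coefficient is small because the exact columns \<open>i\<close> and
    \<open>j\<close> of \<alpha> are orthogonal.\<close>
  have co_le: "cmod (co i k) \<le> 2 * real m * \<eta>" if i: "i < j" for i k
  proof -
    have "co i k = (\<Sum>l<m. cnj (u i l k) * (x l k - \<alpha> k $$ (l, j)) + cnj (u i l k - \<alpha> k $$ (l, i)) * \<alpha> k $$ (l, j))
        + (\<Sum>l<m. cnj (\<alpha> k $$ (l, i)) * \<alpha> k $$ (l, j))"
      unfolding co_def sum.distrib[symmetric] by (intro sum.cong) (auto simp: algebra_simps)
    also have "(\<Sum>l<m. cnj (\<alpha> k $$ (l, i)) * \<alpha> k $$ (l, j)) = 0"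
      using unitary_matD(2)[OF \<alpha>(3), of i j] i j by simp
    finally have "cmod (co i k) \<le> (\<Sum>l<m. cmod (cnj (u i l k) * (x l k - \<alpha> k $$ (l, j)) + cnj (u i l k - \<alpha> k $$ (l, i)) * \<alpha> k $$ (l, j)))"
      by (simp only: add_0_right norm_sum)
    also have "\<dots> \<le> (\<Sum>l<m. 2 * \<eta>)"
    proof (rule sum_mono)
      fix l assume "l \<in> {..<m}"
      then have l: "l < m" by simp
      have "cmod (cnj (u i l k) * (x l k - \<alpha> k $$ (l, j))) \<le> 1 * \<eta>"
        unfolding norm_mult using u1[OF i l] x(3)[OF l] by (intro mult_mono) auto
      moreover have "cmod (cnj (u i l k - \<alpha> k $$ (l, i)) * \<alpha> k $$ (l, j)) \<le> \<eta> * 1"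
        unfolding norm_mult complex_mod_cnj using u(3)[OF i l] \<alpha>1[OF l j] eta by (intro mult_mono) auto
      ultimately show "cmod (cnj (u i l k) * (x l k - \<alpha> k $$ (l, j)) + cnj (u i l k - \<alpha> k $$ (l, i)) * \<alpha> k $$ (l, j)) \<le> 2 * \<eta>"
        by (intro norm_triangle_le) simp
    qed
    finally show ?thesis by simp
  qed
  have v_near: "cmod (v l k - \<alpha> k $$ (l, j)) \<le> \<kappa>" if l: "l < m" for l k
  proof -
    have "cmod (\<Sum>i<j. co i k * u i l k) \<le> (\<Sum>i<j. 2 * real m * \<eta> * 1)"
    proof (rule order_trans[OF norm_sum sum_mono])
      fix i assume "i \<in> {..<j}"
      then show "cmod (co i k * u i l k) \<le> 2 * real m * \<eta> * 1"
        unfolding norm_mult using co_le u1 l eta by (intro mult_mono) auto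
    qed
    also have "\<dots> = real j * (2 * real m * \<eta>)" by simp
    also have "\<dots> \<le> real m * (2 * real m * \<eta>)" using j eta by (intro mult_right_mono) auto
    finally have sle: "cmod (\<Sum>i<j. co i k * u i l k) \<le> real m * (2 * real m * \<eta>)" .
    have "v l k - \<alpha> k $$ (l, j) = (x l k - \<alpha> k $$ (l, j)) - (\<Sum>i<j. co i k * u i l k)"
      by (simp add: v_def)
    then have veq: "cmod (v l k - \<alpha> k $$ (l, j)) = cmod ((x l k - \<alpha> k $$ (l, j)) - (\<Sum>i<j. co i k * u i l k))"
      by (simp only:)
    from sle veq have "cmod (v l k - \<alpha> k $$ (l, j)) \<le> \<eta> + real m * (2 * real m * \<eta>)"
      using norm_triangle_ineq4[of "x l k - \<alpha> k $$ (l, j)" "\<Sum>i<j. co i k * u i l k"] x(3)[OF l, of k] by linarith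
    then show ?thesis by (simp add: \<kappa>_def c_def algebra_simps)
  qed
  have v2: "cmod (v l k) \<le> 2" if l: "l < m" for l k
    using norm_triangle_ineq[of "v l k - \<alpha> k $$ (l, j)" "\<alpha> k $$ (l, j)"] v_near[OF l, of k] \<alpha>1[OF l j, of k] kap1(1) by simp
  have N1: "\<bar>N k - 1\<bar> \<le> 3 * (real m * \<kappa>)" for k
  proof -
    have "(\<Sum>l<m. complex_of_real ((cmod (\<alpha> k $$ (l, j)))\<^sup>2)) = 1"
      using unitary_matD(2)[OF \<alpha>(3) j j] by (simp add: mult.commute complex_norm_square[symmetric] flip: of_real_power)
    then have "(\<Sum>l<m. (cmod (\<alpha> k $$ (l, j)))\<^sup>2) = 1"
      by (metis of_real_eq_1_iff of_real_sum)
    then have "N k - 1 = (\<Sum>l<m. (cmod (v l k))\<^sup>2 - (cmod (\<alpha> k $$ (l, j)))\<^sup>2)"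
      by (simp add: N_def sum_subtractf)
    also have "\<bar>\<dots>\<bar> \<le> (\<Sum>l<m. 3 * \<kappa>)"
    proof (rule order_trans[OF sum_abs sum_mono])
      fix l assume "l \<in> {..<m}"
      then have l: "l < m" by simp
      have "(cmod (v l k))\<^sup>2 - (cmod (\<alpha> k $$ (l, j)))\<^sup>2 = (cmod (v l k) + cmod (\<alpha> k $$ (l, j))) * (cmod (v l k) - cmod (\<alpha> k $$ (l, j)))"
        by (simp add: power2_eq_square algebra_simps)
      also have "\<bar>\<dots>\<bar> \<le> 3 * \<kappa>"
        unfolding abs_mult using v2[OF l, of k] \<alpha>1[OF l j, of k] v_near[OF l, of k]
          norm_triangle_ineq3[of "v l k" "\<alpha> k $$ (l, j)"]
        by (intro mult_mono) auto
      finally show "\<bar>(cmod (v l k))\<^sup>2 - (cmod (\<alpha> k $$ (l, j)))\<^sup>2\<bar> \<le> 3 * \<kappa>" .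
    qed
    finally show ?thesis by simp
  qed
  have N4: "1 / 4 \<le> N k" for k using kap1(2) N1[of k] by linarith
  then have s: "1 / 2 \<le> sqrt (N k)" for k
    by (intro real_le_rsqrt) (simp add: power2_eq_square)
  have sN: "\<bar>1 / sqrt (N k) - 1\<bar> \<le> 6 * (real m * \<kappa>)" for k
  proof -
    define r where "r = sqrt (N k)"
    have r: "1 / 2 \<le> r" "0 < r" "r * r = N k" using s[of k] N4[of k] by (auto simp: r_def)
    have "1 / r - 1 = (1 - r) / r" using r by (simp add: divide_simps)
    then have "\<bar>1 / r - 1\<bar> = \<bar>1 - r\<bar> / r" using r by simp
    also have "\<dots> \<le> \<bar>1 - r\<bar> / (1 / 2)" using r by (intro divide_left_mono) auto
    finally have *: "\<bar>1 / r - 1\<bar> \<le> 2 * \<bar>1 - r\<bar>" by simp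
    have "\<bar>1 - r\<bar> \<le> \<bar>1 - r\<bar> * (1 + r)" using r mult_left_mono[of 1 "1 + r" "\<bar>1 - r\<bar>"] by simp
    also have "\<bar>1 - r\<bar> * (1 + r) = \<bar>(1 - r) * (1 + r)\<bar>" using r by (simp add: abs_mult)
    also have "(1 - r) * (1 + r) = 1 - N k" using r by (simp add: algebra_simps)
    also have "\<bar>1 - N k\<bar> \<le> 3 * (real m * \<kappa>)" using N1[of k] by (simp only: abs_minus_commute)
    finally have "2 * \<bar>1 - r\<bar> \<le> 2 * (3 * (real m * \<kappa>))" by (rule mult_left_mono) simp
    then have "2 * \<bar>1 - r\<bar> \<le> 6 * (real m * \<kappa>)" by (simp only: mult.assoc[symmetric])
    then show ?thesis using * unfolding r_def by (rule order_trans[rotated])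
  qed
  have w_near: "cmod (w l k - \<alpha> k $$ (l, j)) \<le> \<delta>" if l: "l < m" for l k
  proof -
    have "w l k - \<alpha> k $$ (l, j) = v l k * complex_of_real (1 / sqrt (N k) - 1) + (v l k - \<alpha> k $$ (l, j))"
      by (simp add: w_def algebra_simps)
    then have "cmod (w l k - \<alpha> k $$ (l, j)) \<le> cmod (v l k) * \<bar>1 / sqrt (N k) - 1\<bar> + cmod (v l k - \<alpha> k $$ (l, j))"
      by (metis norm_mult norm_of_real norm_triangle_ineq)
    also have "\<dots> \<le> 2 * (6 * (real m * \<kappa>)) + \<kappa>"
      using v2[OF l] sN v_near[OF l] by (intro add_mono mult_mono) auto
    also have "\<dots> \<le> 13 * (real m + 1) * \<kappa>" using kap(1) mk by (simp add: algebra_simps)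
    finally show ?thesis using kap(2) by simp
  qed
  have co_lip: "lip_bounded (co i)" if "i < j" for i
    unfolding co_def using that by (intro lip_bounded_sum lip_bounded_mult lip_bounded_cnj u x) auto
  have v_lip: "lip_bounded (v l)" if "l < m" for l
    unfolding v_def using that by (intro lip_bounded_diff lip_bounded_sum lip_bounded_mult u x co_lip) auto
  have "lip_bounded (\<lambda>k. \<Sum>l<m. v l k * cnj (v l k))"
    by (intro lip_bounded_sum lip_bounded_mult lip_bounded_cnj v_lip) auto
  then have "lip_bounded (\<lambda>k. complex_of_real (N k))"
    by (simp add: N_def complex_norm_square[symmetric] flip: of_real_power)
  then have w_lip: "lip_bounded (w l)" if "l < m" for l
    unfolding w_def using that N4 by (intro lip_bounded_mult v_lip lip_bounded_inverse_sqrt)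
  have w_per: "Z2_periodic (w l)" if l: "l < m" for l
    unfolding Z2_periodic_def
  proof (intro allI impI)
    fix k z :: "real^2" assume z: "\<forall>i. z $ i \<in> \<int>"
    have "x l (k + z) = x l k" if "l < m" for l using x(1)[OF that] z by (simp add: Z2_periodic_def)
    moreover have "u i l (k + z) = u i l k" if "i < j" "l < m" for i l
      using u(2)[OF that] z by (simp add: Z2_periodic_def)
    ultimately have "v l (k + z) = v l k" if "l < m" for l
      using that by (simp add: v_def co_def)
    then show "w l (k + z) = w l k" using l by (simp add: w_def N_def)
  qed
  have v_orth: "(\<Sum>l<m. cnj (u i l k) * v l k) = 0" if i: "i < j" for i k
  proof -
    have "(\<Sum>l<m. cnj (u i l k) * v l k) = co i k - (\<Sum>l<m. \<Sum>i'<j. co i' k * (cnj (u i l k) * u i' l k))"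
      by (simp add: v_def co_def algebra_simps sum_subtractf sum_distrib_left)
    also have "(\<Sum>l<m. \<Sum>i'<j. co i' k * (cnj (u i l k) * u i' l k)) = (\<Sum>i'<j. co i' k * (\<Sum>l<m. cnj (u i l k) * u i' l k))"
      by (subst sum.swap) (simp add: sum_distrib_left)
    also have "\<dots> = (\<Sum>i'<j. if i' = i then co i k else 0)"
      using i by (intro sum.cong) (auto simp: orth)
    also have "\<dots> = co i k" using i by simp
    finally show ?thesis by simp
  qed
  have uw: "(\<Sum>l<m. cnj (u i l k) * w l k) = 0" if "i < j" for i k
  proof -
    have "(\<Sum>l<m. cnj (u i l k) * w l k) = (\<Sum>l<m. cnj (u i l k) * v l k) * complex_of_real (1 / sqrt (N k))"
      unfolding sum_distrib_right by (simp add: w_def mult.assoc)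
    then show ?thesis using v_orth[OF that] by simp
  qed
  then have wu: "(\<Sum>l<m. cnj (w l k) * u i l k) = 0" if "i < j" for i k
  proof -
    have "cnj (\<Sum>l<m. cnj (u i l k) * w l k) = (\<Sum>l<m. cnj (w l k) * u i l k)"
      by (simp add: mult.commute)
    then show ?thesis using uw[OF that, of k] by simp
  qed
  have ww: "(\<Sum>l<m. cnj (w l k) * w l k) = 1" for k
  proof -
    have "(\<Sum>l<m. cnj (w l k) * w l k) = (\<Sum>l<m. complex_of_real ((cmod (v l k))\<^sup>2)) * complex_of_real ((1 / sqrt (N k)) * (1 / sqrt (N k)))"
      unfolding sum_distrib_right of_real_mult complex_norm_square by (intro sum.cong) (auto simp: w_def algebra_simps)
    also have "(1 / sqrt (N k)) * (1 / sqrt (N k)) = 1 / N k" using N4[of k] by simp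
    also have "(\<Sum>l<m. complex_of_real ((cmod (v l k))\<^sup>2)) = complex_of_real (N k)" by (simp add: N_def)
    also have "complex_of_real (N k) * complex_of_real (1 / N k) = 1"
      using N4[of k] by (simp flip: of_real_mult)
    finally show ?thesis .
  qed
  define u' where "u' = u(j := w)"
  have "(\<forall>i<Suc j. \<forall>l<m. lip_bounded (u' i l) \<and> Z2_periodic (u' i l) \<and> (\<forall>k. cmod (u' i l k - \<alpha> k $$ (l, i)) \<le> \<delta>))"
  proof (intro allI impI)
    fix i l assume il: "i < Suc j" "l < m"
    have "\<eta> \<le> D * \<eta>" using cD eta(1) mult_right_mono[of 1 D \<eta>] by simp
    then have "\<eta> \<le> \<delta>" using eta by simp
    then show "lip_bounded (u' i l) \<and> Z2_periodic (u' i l) \<and> (\<forall>k. cmod (u' i l k - \<alpha> k $$ (l, i)) \<le> \<delta>)"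
      using il u[of i l] w_lip w_per w_near by (cases "i = j") (auto simp: u'_def intro: order_trans)
  qed
  moreover have "(\<forall>i<Suc j. \<forall>i'<Suc j. \<forall>k. (\<Sum>l<m. cnj (u' i l k) * u' i' l k) = (if i = i' then 1 else 0))"
  proof (intro allI impI)
    fix i i' k assume "i < Suc j" "i' < Suc j"
    then show "(\<Sum>l<m. cnj (u' i l k) * u' i' l k) = (if i = i' then 1 else 0)"
      using orth uw wu ww by (cases "i = j"; cases "i' = j") (auto simp: u'_def less_Suc_eq)
  qed
  ultimately show ?case by blast
qed

lemma lipschitz_unitary_approx:
  assumes \<alpha>: "mat_continuous m \<alpha>" "Z2_periodic \<alpha>" "\<And>k. unitary_mat m (\<alpha> k)" and \<delta>: "0 < \<delta>"
  obtains \<beta> where "Z2_periodic \<beta>" "\<And>k. unitary_mat m (\<beta> k)"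
    "\<And>i j. i < m \<Longrightarrow> j < m \<Longrightarrow> lip_bounded (\<lambda>k. \<beta> k $$ (i, j))"
    "\<And>k i j. i < m \<Longrightarrow> j < m \<Longrightarrow> cmod (\<beta> k $$ (i, j) - \<alpha> k $$ (i, j)) \<le> \<delta>"
proof -
  obtain u where u: "\<And>i l. i < m \<Longrightarrow> l < m \<Longrightarrow> lip_bounded (u i l)"
      "\<And>i l. i < m \<Longrightarrow> l < m \<Longrightarrow> Z2_periodic (u i l)"
      "\<And>i l k. i < m \<Longrightarrow> l < m \<Longrightarrow> cmod (u i l k - \<alpha> k $$ (l, i)) \<le> \<delta>"
    and orth: "\<And>i i' k. i < m \<Longrightarrow> i' < m \<Longrightarrow> (\<Sum>l<m. cnj (u i l k) * u i' l k) = (if i = i' then 1 else 0)"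
    using gram_schmidt_lipschitz[OF \<alpha> order_refl \<delta>] by blast
  define \<beta> where "\<beta> k = mat m m (\<lambda>(l, i). u i l k)" for k
  show ?thesis
  proof (rule that[of \<beta>])
    show "Z2_periodic \<beta>"
      using u(2) by (auto simp: Z2_periodic_def \<beta>_def intro!: eq_matI)
    show "unitary_mat m (\<beta> k)" for k
      using orth by (simp add: unitary_mat_iff \<beta>_def)
    show "lip_bounded (\<lambda>k. \<beta> k $$ (i, j))" "\<And>k. cmod (\<beta> k $$ (i, j) - \<alpha> k $$ (i, j)) \<le> \<delta>"
      if "i < m" "j < m" for i j
      using u that by (auto simp: \<beta>_def)
  qed
qed

section \<open>Generic perturbation\<close>

text \<open>Reduced echelon form, with pivots of maximal modulus, of the plane spanned by \<open>u\<close> and \<open>v\<close>: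
  this parametrises planes by finitely many bounded charts.\<close>

lemma plane_bounded_chart:
  fixes u v :: "nat \<Rightarrow> complex"
  assumes uu: "(\<Sum>l<m. cnj (u l) * u l) = 1" and vv: "(\<Sum>l<m. cnj (v l) * v l) = 1"
    and uv: "(\<Sum>l<m. cnj (u l) * v l) = 0"
  obtains p q a b c d where "p < m" "q < m" "p \<noteq> q"
    "a * u p + b * v p = 1" "a * u q + b * v q = 0" "c * u p + d * v p = 0" "c * u q + d * v q = 1"
    "\<And>l. l < m \<Longrightarrow> cmod (a * u l + b * v l) \<le> 2" "\<And>l. l < m \<Longrightarrow> cmod (c * u l + d * v l) \<le> 2"
proof -
  have m: "0 < m" using uu by (cases m) auto
  have max: "\<exists>p<m. \<forall>l<m. cmod (f l) \<le> cmod (f p)" for f :: "nat \<Rightarrow> complex"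
  proof -
    have "Max ((\<lambda>l. cmod (f l)) ` {..<m}) \<in> (\<lambda>l. cmod (f l)) ` {..<m}"
      using m by (intro Max_in) auto
    then obtain p where "p < m" "Max ((\<lambda>l. cmod (f l)) ` {..<m}) = cmod (f p)" by auto
    then show ?thesis by (metis Max_ge finite_imageI finite_lessThan imageI lessThan_iff)
  qed
  obtain p where p: "p < m" "\<And>l. l < m \<Longrightarrow> cmod (u l) \<le> cmod (u p)" using max by blast
  have up: "u p \<noteq> 0"
  proof
    assume "u p = 0"
    then have "u l = 0" if "l < m" for l using p(2)[OF that] by simp
    then show False using uu by simp
  qed
  \<comment> \<open>Elimination of the entry at \<open>p\<close>. The remainder \<open>w\<close> is
    not zero since \<open>u\<close> and \<open>v\<close> are independent, so a second pivot
    \<open>q\<close> exists and differs from \<open>p\<close>.\<close>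
  define r where "r = v p / u p"
  define w where "w l = v l - r * u l" for l
  obtain q where q: "q < m" "\<And>l. l < m \<Longrightarrow> cmod (w l) \<le> cmod (w q)" using max by blast
  have wq: "w q \<noteq> 0"
  proof
    assume "w q = 0"
    then have "w l = 0" if "l < m" for l using q(2)[OF that] by simp
    then have vl: "v l = r * u l" if "l < m" for l using that by (simp add: w_def)
    have "(\<Sum>l<m. cnj (u l) * v l) = r * (\<Sum>l<m. cnj (u l) * u l)"
      by (simp add: vl sum_distrib_left algebra_simps)
    then have "r = 0" using uu uv by simp
    then show False using vl vv by simp
  qed
  have wp: "w p = 0" using up by (simp add: w_def r_def)
  have pq: "p \<noteq> q" using wp wq by auto
  define c where "c = - r / w q"
  define d where "d = 1 / w q"
  define a where "a = 1 / u p - u q / u p * c"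
  define b where "b = - (u q / u p) * d"
  have cd: "c * u l + d * v l = w l / w q" for l
    by (simp add: c_def d_def w_def diff_divide_distrib)
  have ab: "a * u l + b * v l = u l / u p - u q / u p * (w l / w q)" for l
    unfolding cd[symmetric] by (simp add: a_def b_def algebra_simps)
  have le1: "cmod (w l / w q) \<le> 1" if "l < m" for l
    using q(2)[OF that] wq by (simp add: norm_divide)
  have le2: "cmod (u l / u p) \<le> 1" if "l < m" for l
    using p(2)[OF that] up by (simp add: norm_divide)
  show ?thesis
  proof (rule that[of p q a b c d])
    fix l assume l: "l < m"
    have "cmod (u q / u p * (w l / w q)) \<le> 1 * 1"
      unfolding norm_mult using le1[OF l] le2[OF q(1)] by (intro mult_mono) auto
    then show "cmod (a * u l + b * v l) \<le> 2"
      unfolding ab using norm_triangle_ineq4[of "u l / u p" "u q / u p * (w l / w q)"] le2[OF l] by linarith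
    show "cmod (c * u l + d * v l) \<le> 2" unfolding cd using le1[OF l] by linarith
  qed (use p q pq up wq wp in \<open>auto simp: ab cd\<close>)
qed

text \<open>With \<open>T = 1 - \<i>H\<close> the matrix is the adjoint of \<open>T\<close> times
  the inverse of \<open>T\<close>. As \<open>H\<close> is hermitian, the squared norm of
  \<open>T y\<close> is that of \<open>y\<close> plus that of \<open>H y\<close>; so
  \<open>T\<close> is invertible with a contractive inverse, and normality of \<open>T\<close> makes
  the product unitary. The last conclusion writes \<open>w\<close> and \<open>A w\<close> through a
  common vector \<open>y\<close>, which turns statements about \<open>A\<close> into statements
  linear in \<open>H\<close>.\<close>

lemma cayley_transform:
  fixes H :: "nat \<Rightarrow> nat \<Rightarrow> complex"
  assumes herm: "\<And>i j. i < m \<Longrightarrow> j < m \<Longrightarrow> H j i = cnj (H i j)"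
    and small: "\<And>i j. i < m \<Longrightarrow> j < m \<Longrightarrow> cmod (H i j) \<le> \<rho>"
  obtains A where "unitary_mat m A"
    "\<And>i j. i < m \<Longrightarrow> j < m \<Longrightarrow> cmod (A $$ (i, j) - (if i = j then 1 else 0)) \<le> 2 * real m * \<rho>"
    "\<And>w. \<exists>y. (\<forall>i<m. w i = y i - \<i> * (\<Sum>l<m. H i l * y l)) \<and>
      (\<forall>i<m. (\<Sum>l<m. A $$ (i, l) * w l) = y i + \<i> * (\<Sum>l<m. H i l * y l)) \<and>
      (\<forall>i<m. (cmod (y i))\<^sup>2 \<le> (\<Sum>l<m. (cmod (w l))\<^sup>2))"
proof -
  have hc: "cnj (H i j) = H j i" if "i < m" "j < m" for i j
    using herm[OF that] by simp
  define T where "T = mat m m (\<lambda>(i, j). (if i = j then 1 else 0) - \<i> * H i j)"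
  have T: "T \<in> carrier_mat m m" by (simp add: T_def)
  have Ty: "(\<Sum>l<m. T $$ (i, l) * y l) = y i - \<i> * (\<Sum>l<m. H i l * y l)" if i: "i < m" for i y
  proof -
    have "(\<Sum>l<m. T $$ (i, l) * y l) = (\<Sum>l<m. (if l = i then y i else 0) - \<i> * (H i l * y l))"
      using i by (intro sum.cong) (auto simp: T_def algebra_simps)
    then show ?thesis using i by (simp add: sum_subtractf sum_distrib_left)
  qed
  have Te: "T $$ (i, l) = (if i = l then 1 else 0) - \<i> * H i l" if "i < m" "l < m" for i l
    using that by (simp add: T_def)
  have aTe: "mat_adjoint T $$ (i, l) = (if i = l then 1 else 0) + \<i> * H i l" if "i < m" "l < m" for i l
    unfolding mat_adjoint_entry[OF T that] using that by (simp add: T_def hc)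
  have Tay: "(\<Sum>l<m. mat_adjoint T $$ (i, l) * y l) = y i + \<i> * (\<Sum>l<m. H i l * y l)" if i: "i < m" for i y
  proof -
    have "(\<Sum>l<m. mat_adjoint T $$ (i, l) * y l) = (\<Sum>l<m. (if l = i then y i else 0) + \<i> * (H i l * y l))"
      using i by (intro sum.cong) (auto simp: aTe algebra_simps)
    then show ?thesis using i by (simp add: sum.distrib sum_distrib_left)
  qed
  have bound: "(\<Sum>l<m. (cmod (y l))\<^sup>2) \<le> (\<Sum>i<m. (cmod (\<Sum>l<m. T $$ (i, l) * y l))\<^sup>2)" for y
  proof -
    define h where "h i = (\<Sum>l<m. H i l * y l)" for i
    define S where "S = (\<Sum>i<m. cnj (y i) * h i)"
    have "cnj S = (\<Sum>i<m. \<Sum>l<m. y i * (H l i * cnj (y l)))"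
      by (simp add: S_def h_def sum_distrib_left hc)
    also have "\<dots> = (\<Sum>l<m. \<Sum>i<m. y i * (H l i * cnj (y l)))" by (rule sum.swap)
    also have "\<dots> = S" by (simp add: S_def h_def sum_distrib_left algebra_simps)
    finally have "Im S = 0" by (metis Reals_cnj_iff complex_is_Real_iff)
    have eq: "(cmod (y i - \<i> * h i))\<^sup>2 = (cmod (y i))\<^sup>2 + (cmod (h i))\<^sup>2 + 2 * Im (cnj (y i) * h i)" for i
      unfolding cmod_power2 by (simp add: power2_eq_square algebra_simps)
    have "(\<Sum>i<m. (cmod (\<Sum>l<m. T $$ (i, l) * y l))\<^sup>2) = (\<Sum>i<m. (cmod (y i - \<i> * h i))\<^sup>2)"
      using Ty by (simp add: h_def)
    also have "\<dots> = (\<Sum>i<m. (cmod (y i))\<^sup>2) + (\<Sum>i<m. (cmod (h i))\<^sup>2) + 2 * Im S"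
      by (simp add: eq sum.distrib S_def sum_distrib_left)
    also have "\<dots> \<ge> (\<Sum>i<m. (cmod (y i))\<^sup>2)" using \<open>Im S = 0\<close> by (simp add: sum_nonneg)
    finally show ?thesis .
  qed
  have "det T \<noteq> 0"
  proof
    assume "det T = 0"
    then obtain y where y: "y \<in> carrier_vec m" "y \<noteq> 0\<^sub>v m" "T *\<^sub>v y = 0\<^sub>v m"
      using det_0_iff_vec_prod_zero[OF T] by blast
    have "(\<Sum>l<m. T $$ (i, l) * y $ l) = 0" if i: "i < m" for i
    proof -
      have "(T *\<^sub>v y) $ i = (\<Sum>l<m. T $$ (i, l) * y $ l)"
        using T y(1) i by (simp add: mult_mat_vec_def scalar_prod_def atLeast0LessThan)
      then show ?thesis using y(3) i by simp
    qed
    then have "(\<Sum>l<m. (cmod (y $ l))\<^sup>2) \<le> 0" using bound[of "\<lambda>l. y $ l"] by simp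
    moreover have "0 \<le> (cmod (y $ l))\<^sup>2" for l by simp
    ultimately have "(\<Sum>l<m. (cmod (y $ l))\<^sup>2) = 0" by (meson antisym sum_nonneg)
    then have "y $ l = 0" if "l < m" for l using that by (subst (asm) sum_nonneg_eq_0_iff) auto
    then have "y = 0\<^sub>v m" using y(1) by (intro eq_vecI) auto
    then show False using y(2) by simp
  qed
  then have "T \<in> Units (ring_mat TYPE(complex) m ())"
    by (rule det_non_zero_imp_unit[OF T])
  then obtain B where B: "B \<in> carrier_mat m m" "B * T = 1\<^sub>m m" "T * B = 1\<^sub>m m"
    by (auto simp: Units_def ring_mat_def)
  note aT = mat_adjoint_carrier[OF T] and aB = mat_adjoint_carrier[OF B(1)]
  define A where "A = mat_adjoint T * B"
  have A: "A \<in> carrier_mat m m" unfolding A_def using aT B by auto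
  have comm: "T * mat_adjoint T = mat_adjoint T * T"
  proof (rule eq_matI)
    fix i j assume "i < dim_row (mat_adjoint T * T)" "j < dim_col (mat_adjoint T * T)"
    then have ij: "i < m" "j < m" using T aT by auto
    have "(T * mat_adjoint T) $$ (i, j) = mat_adjoint T $$ (i, j) - \<i> * (\<Sum>l<m. H i l * mat_adjoint T $$ (l, j))"
      using ij by (simp add: mult_entry[OF T aT] Ty[OF ij(1)])
    also have "\<dots> = (mat_adjoint T * T) $$ (i, j)"
    proof -
      have e: "mat_adjoint T $$ (l, j) = (if l = j then 1 else 0) + \<i> * H l j"
        "T $$ (l, j) = (if l = j then 1 else 0) - \<i> * H l j" if "l < m" for l
        using that ij by (simp_all add: aTe Te)
      have "(mat_adjoint T * T) $$ (i, j) = T $$ (i, j) + \<i> * (\<Sum>l<m. H i l * T $$ (l, j))"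
        using ij by (simp add: mult_entry[OF aT T] Tay[OF ij(1)])
      then show ?thesis
        using ij by (simp add: e algebra_simps sum.distrib sum_subtractf sum_distrib_left
            if_distrib[of "\<lambda>x. _ * x"] cong: if_cong)
    qed
    finally show "(T * mat_adjoint T) $$ (i, j) = (mat_adjoint T * T) $$ (i, j)" .
  qed (use T aT in auto)
  have "mat_adjoint A * A = mat_adjoint B * (T * mat_adjoint T) * B"
    unfolding A_def mat_adjoint_mult[OF aT B(1)] mat_adjoint_adjoint
    using T aT B aB by (simp add: assoc_mult_mat[of _ m m _ m _ m] mult_carrier_mat[of _ m m _ m])
  also have "\<dots> = (mat_adjoint B * mat_adjoint T) * (T * B)"
    unfolding comm using T aT B(1) aB by (simp add: assoc_mult_mat[of _ m m _ m _ m] mult_carrier_mat[of _ m m _ m])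
  also have "mat_adjoint B * mat_adjoint T = mat_adjoint (T * B)"
    by (rule mat_adjoint_mult[OF T B(1), symmetric])
  also have "mat_adjoint (T * B) * (T * B) = 1\<^sub>m m"
    unfolding B(3) using mat_adjoint_carrier[of "1\<^sub>m m :: complex mat" m m]
    by (intro eq_matI) (auto simp: mat_adjoint_entry[of _ m m])
  finally have AA: "mat_adjoint A * A = 1\<^sub>m m" .
  have unit: "unitary_mat m A"
    unfolding unitary_mat_def
    using A AA mat_mult_left_right_inverse[OF mat_adjoint_carrier[OF A] A AA] by blast
  have sol: "\<exists>y. (\<forall>i<m. y i = (\<Sum>l<m. B $$ (i, l) * w l)) \<and> (\<forall>i<m. w i = y i - \<i> * (\<Sum>l<m. H i l * y l)) \<and>
      (\<forall>i<m. (\<Sum>l<m. A $$ (i, l) * w l) = y i + \<i> * (\<Sum>l<m. H i l * y l)) \<and>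
      (\<forall>i<m. (cmod (y i))\<^sup>2 \<le> (\<Sum>l<m. (cmod (w l))\<^sup>2))" for w
  proof -
    define y where "y i = (\<Sum>l<m. B $$ (i, l) * w l)" for i
    have assoc: "(\<Sum>l<m. X $$ (i, l) * y l) = (\<Sum>l<m. (X * B) $$ (i, l) * w l)"
      if i: "i < m" and X: "X \<in> carrier_mat m m" for X i
    proof -
      have "(\<Sum>l<m. X $$ (i, l) * y l) = (\<Sum>l<m. \<Sum>k<m. X $$ (i, l) * B $$ (l, k) * w k)"
        by (simp add: y_def sum_distrib_left mult.assoc)
      also have "\<dots> = (\<Sum>k<m. \<Sum>l<m. X $$ (i, l) * B $$ (l, k) * w k)" by (rule sum.swap)
      also have "\<dots> = (\<Sum>k<m. (X * B) $$ (i, k) * w k)"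
        using i by (simp add: mult_entry[OF X B(1)] sum_distrib_right)
      finally show ?thesis .
    qed
    have Tw: "(\<Sum>l<m. T $$ (i, l) * y l) = w i" if i: "i < m" for i
    proof -
      have "(\<Sum>l<m. T $$ (i, l) * y l) = (\<Sum>l<m. if l = i then w i else 0)"
        unfolding assoc[OF i T] B(3) using i by (intro sum.cong) auto
      then show ?thesis using i by simp
    qed
    have "(cmod (y i))\<^sup>2 \<le> (\<Sum>l<m. (cmod (w l))\<^sup>2)" if i: "i < m" for i
    proof -
      have "(cmod (y i))\<^sup>2 \<le> (\<Sum>l<m. (cmod (y l))\<^sup>2)"
        using i by (intro member_le_sum) auto
      also have "\<dots> \<le> (\<Sum>i<m. (cmod (\<Sum>l<m. T $$ (i, l) * y l))\<^sup>2)" by (rule bound)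
      also have "\<dots> = (\<Sum>l<m. (cmod (w l))\<^sup>2)" using Tw by simp
      finally show ?thesis .
    qed
    moreover have "w i = y i - \<i> * (\<Sum>l<m. H i l * y l)" if "i < m" for i
      using Tw[OF that] Ty[OF that, of y] by simp
    moreover have "(\<Sum>l<m. A $$ (i, l) * w l) = y i + \<i> * (\<Sum>l<m. H i l * y l)" if "i < m" for i
      using assoc[OF that aT] Tay[OF that, of y] by (simp add: A_def)
    ultimately show ?thesis using y_def by blast
  qed
  show ?thesis
  proof (rule that[OF unit])
    fix i j assume ij: "i < m" "j < m"
    \<comment> \<open>For a basis vector \<open>w\<close> the two Cayley relations give column
      \<open>j\<close> of \<open>A - 1\<close> as \<open>2 * \<i> * H y\<close> with entries of
      \<open>y\<close> at most 1.\<close>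
    define w where "w l = (if l = j then 1 else 0 :: complex)" for l
    obtain y where y: "\<forall>i<m. w i = y i - \<i> * (\<Sum>l<m. H i l * y l)"
      "\<forall>i<m. (\<Sum>l<m. A $$ (i, l) * w l) = y i + \<i> * (\<Sum>l<m. H i l * y l)"
      "\<forall>i<m. (cmod (y i))\<^sup>2 \<le> (\<Sum>l<m. (cmod (w l))\<^sup>2)" using sol[of w] by blast
    have sel: "(\<Sum>l<m. g l * w l) = g j" for g
      using ij by (simp add: w_def if_distrib[of "\<lambda>x. _ * x"] cong: if_cong)
    have "(\<Sum>l<m. (cmod (w l))\<^sup>2) = (\<Sum>l<m. if l = j then 1 else 0)"
      by (intro sum.cong) (auto simp: w_def)
    then have "(\<Sum>l<m. (cmod (w l))\<^sup>2) = 1" using ij by simp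
    then have y1: "cmod (y l) \<le> 1" if "l < m" for l using y(3) that by (simp add: power_le_one_iff)
    have "w i = y i - \<i> * (\<Sum>l<m. H i l * y l)" "A $$ (i, j) = y i + \<i> * (\<Sum>l<m. H i l * y l)"
      using y(1,2) ij sel[of "\<lambda>l. A $$ (i, l)"] by auto
    then have "A $$ (i, j) - w i = 2 * \<i> * (\<Sum>l<m. H i l * y l)" by (simp add: algebra_simps)
    then have "cmod (A $$ (i, j) - w i) = 2 * cmod (\<Sum>l<m. H i l * y l)"
      by (simp add: norm_mult)
    also have "cmod (\<Sum>l<m. H i l * y l) \<le> (\<Sum>l<m. \<rho> * 1)"
    proof (rule order_trans[OF norm_sum sum_mono])
      fix l assume "l \<in> {..<m}"
      then show "cmod (H i l * y l) \<le> \<rho> * 1"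
        unfolding norm_mult using small[OF ij(1), of l] y1[of l]
        by (intro mult_mono) (auto intro: order_trans[OF norm_ge_zero])
    qed
    finally show "cmod (A $$ (i, j) - (if i = j then 1 else 0)) \<le> 2 * real m * \<rho>"
      by (simp add: w_def mult.assoc)
  next
    fix w show "\<exists>y. (\<forall>i<m. w i = y i - \<i> * (\<Sum>l<m. H i l * y l)) \<and>
      (\<forall>i<m. (\<Sum>l<m. A $$ (i, l) * w l) = y i + \<i> * (\<Sum>l<m. H i l * y l)) \<and>
      (\<forall>i<m. (cmod (y i))\<^sup>2 \<le> (\<Sum>l<m. (cmod (w l))\<^sup>2))" using sol[of w] by blast
  qed
qed

text \<open>Diagonal dominance: adding the two estimates gives
  \<open>cmod a + cmod b \<le> 2 * e + (cmod a + cmod b) / 2\<close>.\<close>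

lemma near_identity_2x2_bound:
  fixes a b :: complex
  assumes "cmod (a * s + b * t) \<le> e" "cmod (a * s' + b * t') \<le> e"
    and "cmod (s - 1) \<le> 1 / 4" "cmod t \<le> 1 / 4" "cmod s' \<le> 1 / 4" "cmod (t' - 1) \<le> 1 / 4"
  shows "cmod a \<le> 4 * e" "cmod b \<le> 4 * e"
proof -
  have tri: "cmod (x - y - z) \<le> cmod x + cmod y + cmod z" for x y z :: complex
    using norm_triangle_ineq4[of "x - y" z] norm_triangle_ineq4[of x y] by linarith
  have eqs: "(a * s + b * t) - a * (s - 1) - b * t = a" "(a * s' + b * t') - a * s' - b * (t' - 1) = b"
    by (simp_all add: algebra_simps)
  have "cmod a \<le> cmod (a * s + b * t) + cmod (a * (s - 1)) + cmod (b * t)"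
    using tri[of "a * s + b * t" "a * (s - 1)" "b * t"] unfolding eqs .
  moreover have "cmod (a * (s - 1)) \<le> cmod a * (1 / 4)" "cmod (b * t) \<le> cmod b * (1 / 4)"
    unfolding norm_mult using assms by (intro mult_left_mono; simp)+
  moreover have "cmod b \<le> cmod (a * s' + b * t') + cmod (a * s') + cmod (b * (t' - 1))"
    using tri[of "a * s' + b * t'" "a * s'" "b * (t' - 1)"] unfolding eqs .
  moreover have "cmod (a * s') \<le> cmod a * (1 / 4)" "cmod (b * (t' - 1)) \<le> cmod b * (1 / 4)"
    unfolding norm_mult using assms by (intro mult_left_mono; simp)+
  ultimately have "cmod a + cmod b \<le> 4 * e" using assms(1,2) by linarith
  then show "cmod a \<le> 4 * e" "cmod b \<le> 4 * e" using norm_ge_zero[of a] norm_ge_zero[of b] by linarith+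
qed

text \<open>The quantitative codimension count: the \<open>4 * m - 4\<close> real parameters of a
  hermitian matrix in rows and columns \<open>p\<close>, \<open>q\<close> are controlled by its
  action on two vectors close to unit vectors in those positions. A row outside
  \<open>{p, q}\<close> has only two entries to determine, and the 2 x 2 estimate bounds them. By
  hermitian symmetry rows \<open>p\<close> and \<open>q\<close> are then small off the 2 x 2 block;
  moving that part (at most \<open>m\<close> terms of size \<open>4 * e * 3\<close>) to the
  right-hand side, the same estimate bounds the block.\<close>

lemma hermitian_small_on_plane:
  fixes K :: "nat \<Rightarrow> nat \<Rightarrow> complex"
  assumes herm: "\<And>i j. i < m \<Longrightarrow> j < m \<Longrightarrow> K j i = cnj (K i j)"
    and pq: "p < m" "q < m" "p \<noteq> q"
    and zero: "\<And>i j. i < m \<Longrightarrow> j < m \<Longrightarrow> i \<notin> {p, q} \<Longrightarrow> j \<notin> {p, q} \<Longrightarrow> K i j = 0"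
    and e: "\<And>i. i < m \<Longrightarrow> cmod (\<Sum>l<m. K i l * y l) \<le> e" "\<And>i. i < m \<Longrightarrow> cmod (\<Sum>l<m. K i l * y' l) \<le> e"
    and y: "cmod (y p - 1) \<le> 1 / 4" "cmod (y q) \<le> 1 / 4" "cmod (y' p) \<le> 1 / 4" "cmod (y' q - 1) \<le> 1 / 4"
    and y3: "\<And>l. l < m \<Longrightarrow> cmod (y l) \<le> 3" "\<And>l. l < m \<Longrightarrow> cmod (y' l) \<le> 3"
    and ij: "i < m" "j < m"
  shows "cmod (K i j) \<le> 4 * ((12 * real m + 1) * e)"
proof -
  have e0: "0 \<le> e" using e(1)[OF pq(1)] order_trans[OF norm_ge_zero] by blast
  have big: "4 * e \<le> 4 * ((12 * real m + 1) * e)"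
    using e0 mult_right_mono[of 1 "12 * real m + 1" e] by simp
  have split: "(\<Sum>l<m. K i l * x l) = (K i p * x p + K i q * x q) + (\<Sum>l\<in>{..<m} - {p, q}. K i l * x l)" for i x
  proof -
    have "(\<Sum>l<m. K i l * x l) = (\<Sum>l\<in>{..<m} - {p, q}. K i l * x l) + (\<Sum>l\<in>{p, q}. K i l * x l)"
      using pq by (intro sum.subset_diff) auto
    then show ?thesis using pq by simp
  qed
  have outer: "cmod (K i p) \<le> 4 * e" "cmod (K i q) \<le> 4 * e" if i: "i < m" "i \<notin> {p, q}" for i
  proof -
    have "(\<Sum>l\<in>{..<m} - {p, q}. K i l * x l) = 0" for x
      using i zero by (intro sum.neutral) auto
    then have "cmod (K i p * y p + K i q * y q) \<le> e" "cmod (K i p * y' p + K i q * y' q) \<le> e"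
      using e[OF i(1)] by (simp_all add: split)
    then show "cmod (K i p) \<le> 4 * e" "cmod (K i q) \<le> 4 * e"
      using near_identity_2x2_bound[OF _ _ y] by blast+
  qed
  have inner: "cmod (K i p) \<le> 4 * ((12 * real m + 1) * e)" "cmod (K i q) \<le> 4 * ((12 * real m + 1) * e)"
    if i: "i \<in> {p, q}" for i
  proof -
    have im: "i < m" using i pq by auto
    have rest: "cmod (\<Sum>l\<in>{..<m} - {p, q}. K i l * x l) \<le> 12 * real m * e" if x: "\<forall>l<m. cmod (x l) \<le> 3" for x
    proof -
      have "cmod (\<Sum>l\<in>{..<m} - {p, q}. K i l * x l) \<le> (\<Sum>l\<in>{..<m} - {p, q}. (4 * e) * 3)"
      proof (rule order_trans[OF norm_sum sum_mono])
        fix l assume l: "l \<in> {..<m} - {p, q}"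
        then have "cmod (K i l) = cmod (K l i)" using herm[of l i] im by simp
        also have "\<dots> \<le> 4 * e" using outer[of l] l i by auto
        finally show "cmod (K i l * x l) \<le> (4 * e) * 3"
          unfolding norm_mult using x l e0 by (intro mult_mono) auto
      qed
      also have "\<dots> = real (card ({..<m} - {p, q})) * (12 * e)" by simp
      also have "\<dots> \<le> real m * (12 * e)"
        using e0 card_mono[of "{..<m}" "{..<m} - {p, q}"] by (intro mult_right_mono) auto
      finally show ?thesis by simp
    qed
    have E: "cmod (K i p * x p + K i q * x q) \<le> (12 * real m + 1) * e"
      if x: "\<forall>l<m. cmod (x l) \<le> 3" "cmod (\<Sum>l<m. K i l * x l) \<le> e" for x
    proof -
      have "K i p * x p + K i q * x q = (\<Sum>l<m. K i l * x l) - (\<Sum>l\<in>{..<m} - {p, q}. K i l * x l)"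
        by (simp add: split)
      then have "cmod (K i p * x p + K i q * x q) \<le> cmod (\<Sum>l<m. K i l * x l) + cmod (\<Sum>l\<in>{..<m} - {p, q}. K i l * x l)"
        by (metis norm_triangle_ineq4)
      then show ?thesis using rest[OF x(1)] x(2) by (simp add: algebra_simps)
    qed
    show "cmod (K i p) \<le> 4 * ((12 * real m + 1) * e)" "cmod (K i q) \<le> 4 * ((12 * real m + 1) * e)"
      using near_identity_2x2_bound[OF E[OF _ e(1)[OF im]] E[OF _ e(2)[OF im]] y] y3 by blast+
  qed
  show ?thesis
  proof (cases "i \<in> {p, q}")
    case True
    show ?thesis
    proof (cases "j \<in> {p, q}")
      case True
      then show ?thesis using inner[OF \<open>i \<in> {p, q}\<close>] by auto
    next
      case False
      have "cmod (K i j) = cmod (K j i)" using herm[of j i] ij by simp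
      also have "\<dots> \<le> 4 * e" using outer[OF ij(2) False] True by auto
      finally show ?thesis using big by linarith
    qed
  next
    case i: False
    show ?thesis
    proof (cases "j \<in> {p, q}")
      case True
      then have "cmod (K i j) \<le> 4 * e" using outer[OF ij(1) i] by auto
      then show ?thesis using big by linarith
    next
      case False
      then show ?thesis using zero[OF ij i] big e0 by simp
    qed
  qed
qed

text \<open>Here \<open>w\<close> is an eigenvector, for the eigenvalue \<open>z\<close>, of \<open>B\<close> times the Cayley transform of the
  hermitian matrix \<open>H\<close>, and \<open>y = (1 - \<i>H)\<inverse> w\<close>; so \<open>w\<close> and \<open>z\<close> determine both \<open>y\<close> and \<open>H y\<close>.\<close>

definition cayley_eigenvector ::
    "nat \<Rightarrow> complex mat \<Rightarrow> (nat \<Rightarrow> nat \<Rightarrow> complex) \<Rightarrow> complex \<Rightarrow> (nat \<Rightarrow> complex) \<Rightarrow> (nat \<Rightarrow> complex) \<Rightarrow> bool" where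
  "cayley_eigenvector m B H z w y \<longleftrightarrow> (\<forall>i<m.
     w i = y i - \<i> * (\<Sum>l<m. H i l * y l) \<and>
     z * (\<Sum>l<m. cnj (B $$ (l, i)) * w l) = y i + \<i> * (\<Sum>l<m. H i l * y l) \<and>
     cmod (w i) \<le> 2 \<and> cmod (y i - w i) \<le> 1 / 4)"

text \<open>A multiple eigenvalue has a plane of eigenvectors, and
  \<open>plane_bounded_chart\<close> picks a normalised basis of it. Writing
  \<open>B A w = z w\<close> as \<open>A w = z\<close> times the adjoint of \<open>B\<close> applied
  to \<open>w\<close> eliminates \<open>A\<close> from the Cayley relations. Entries of
  \<open>w\<close> are at most 2, so those of \<open>y\<close> are at most \<open>2 * m\<close>, and
  the bound on \<rho> makes \<open>y - w = \<i> H y\<close> at most 1/4.\<close>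

lemma degenerate_witness:
  assumes B: "unitary_mat m B" and A: "unitary_mat m A" and m: "0 < m"
    and small: "\<And>i j. i < m \<Longrightarrow> j < m \<Longrightarrow> cmod (H i j) \<le> \<rho>" and \<rho>: "\<rho> \<le> 1 / (8 * (real m * real m))"
    and cay: "\<And>w. \<exists>y. (\<forall>i<m. w i = y i - \<i> * (\<Sum>l<m. H i l * y l)) \<and>
      (\<forall>i<m. (\<Sum>l<m. A $$ (i, l) * w l) = y i + \<i> * (\<Sum>l<m. H i l * y l)) \<and>
      (\<forall>i<m. (cmod (y i))\<^sup>2 \<le> (\<Sum>l<m. (cmod (w l))\<^sup>2))"
    and deg: "\<not> completely_nondegenerate m (B * A)"
  shows "\<exists>p q z w w' y y'. p < m \<and> q < m \<and> p \<noteq> q \<and> cmod z = 1 \<and> w p = 1 \<and> w q = 0 \<and> w' p = 0 \<and> w' q = 1 \<and>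
    cayley_eigenvector m B H z w y \<and> cayley_eigenvector m B H z w' y'"
proof -
  define U where "U = B * A"
  have U: "unitary_mat m U" unfolding U_def by (rule unitary_mat_mult[OF B A])
  define V where "V = eig_vecs m U"
  define d where "d = eig_vals m U"
  have V: "unitary_mat m V" unfolding V_def by (rule unitary_eig_vecs[OF U])
  have UV: "conj_diag m V d = U" unfolding V_def d_def by (rule conj_diag_eig[OF U])
  have "\<not> inj_on d {..<m}" using deg inj_on_eig_vals_iff[OF U] by (simp add: d_def U_def)
  then obtain i j where ij: "i < m" "j < m" "i \<noteq> j" "d i = d j" by (auto simp: inj_on_def)
  define z where "z = d i"
  have z1: "cmod z = 1" using norm_eig_vals[OF U ij(1)] by (simp add: z_def d_def)
  define u v where "u l = V $$ (l, i)" and "v l = V $$ (l, j)" for l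
  have eig: "(\<Sum>l<m. U $$ (r, l) * u l) = z * u r" "(\<Sum>l<m. U $$ (r, l) * v l) = z * v r" if "r < m" for r
    using conj_diag_eigen[OF V that ij(1), of d] conj_diag_eigen[OF V that ij(2), of d] ij(4)
    by (simp_all add: UV u_def v_def z_def)
  obtain p q a b c e where pq: "p < m" "q < m" "p \<noteq> q"
    and piv: "a * u p + b * v p = 1" "a * u q + b * v q = 0" "c * u p + e * v p = 0" "c * u q + e * v q = 1"
    and le: "\<And>l. l < m \<Longrightarrow> cmod (a * u l + b * v l) \<le> 2" "\<And>l. l < m \<Longrightarrow> cmod (c * u l + e * v l) \<le> 2"
  proof (rule plane_bounded_chart[where m = m and u = u and v = v])
    show "(\<Sum>l<m. cnj (u l) * u l) = 1" "(\<Sum>l<m. cnj (v l) * v l) = 1" "(\<Sum>l<m. cnj (u l) * v l) = 0"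
      using unitary_matD(2)[OF V] ij by (simp_all add: u_def v_def)
  qed blast
  have Aw: "(\<Sum>l<m. A $$ (r, l) * w l) = z * (\<Sum>l<m. cnj (B $$ (l, r)) * w l)"
    if r: "r < m" and w: "\<forall>r<m. (\<Sum>l<m. U $$ (r, l) * w l) = z * w r" for r w
  proof -
    note Bc = unitary_matD(1)[OF B] and Uc = unitary_matD(1)[OF U] and Ac = unitary_matD(1)[OF A]
    have "A = mat_adjoint B * U" unfolding U_def by (rule mult_adjoint_cancel(1)[OF B Ac, symmetric])
    then have "A $$ (r, l) = (\<Sum>k<m. cnj (B $$ (k, r)) * U $$ (k, l))" if "l < m" for l
      using mult_entry[OF mat_adjoint_carrier[OF Bc] Uc r that] r by (simp add: mat_adjoint_entry[OF Bc])
    then have "(\<Sum>l<m. A $$ (r, l) * w l) = (\<Sum>l<m. \<Sum>k<m. cnj (B $$ (k, r)) * (U $$ (k, l) * w l))"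
      by (simp add: sum_distrib_right mult.assoc)
    also have "\<dots> = (\<Sum>k<m. cnj (B $$ (k, r)) * (\<Sum>l<m. U $$ (k, l) * w l))"
      by (subst sum.swap) (simp add: sum_distrib_left)
    also have "\<dots> = z * (\<Sum>l<m. cnj (B $$ (l, r)) * w l)"
      using w by (simp add: sum_distrib_left mult.left_commute)
    finally show ?thesis .
  qed
  have wit: "\<exists>y. cayley_eigenvector m B H z w y"
    if w: "\<forall>r<m. (\<Sum>l<m. U $$ (r, l) * w l) = z * w r" and w2: "\<forall>l<m. cmod (w l) \<le> 2" for w
  proof -
    obtain y where y: "\<forall>i<m. w i = y i - \<i> * (\<Sum>l<m. H i l * y l)"
      "\<forall>i<m. (\<Sum>l<m. A $$ (i, l) * w l) = y i + \<i> * (\<Sum>l<m. H i l * y l)"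
      "\<forall>i<m. (cmod (y i))\<^sup>2 \<le> (\<Sum>l<m. (cmod (w l))\<^sup>2)" using cay[of w] by blast
    have "(cmod (y l))\<^sup>2 \<le> (2 * real m)\<^sup>2" if l: "l < m" for l
    proof -
      have "(\<Sum>l<m. (cmod (w l))\<^sup>2) \<le> (\<Sum>l<m. 2\<^sup>2)"
        using w2 by (intro sum_mono power_mono) auto
      also have "\<dots> = 4 * (real m * 1)" by simp
      also have "\<dots> \<le> 4 * (real m * real m)" using m by (intro mult_left_mono) auto
      finally show ?thesis using y(3) l by (fastforce simp: power2_eq_square)
    qed
    then have y2: "cmod (y l) \<le> 2 * real m" if "l < m" for l
      using that by (meson norm_ge_zero power2_le_imp_le mult_nonneg_nonneg of_nat_0_le_iff zero_le_numeral)
    have "cmod (y i - w i) \<le> 1 / 4" if i: "i < m" for i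
    proof -
      have \<rho>0: "0 \<le> \<rho>" using small[OF m m] norm_ge_zero order_trans by blast
      have "y i - w i = \<i> * (\<Sum>l<m. H i l * y l)" using y(1) i by simp
      then have "cmod (y i - w i) = cmod (\<Sum>l<m. H i l * y l)" by (simp add: norm_mult)
      also have "\<dots> \<le> (\<Sum>l<m. \<rho> * (2 * real m))"
        using small[OF i] y2 \<rho>0 by (intro order_trans[OF norm_sum sum_mono]) (auto simp: norm_mult intro!: mult_mono)
      also have "\<dots> = \<rho> * (2 * (real m * real m))" by simp
      also have "\<dots> \<le> 1 / (8 * (real m * real m)) * (2 * (real m * real m))"
        using \<rho> by (intro mult_right_mono) auto
      also have "\<dots> = 1 / 4" using m by simp
      finally show ?thesis .
    qed
    then have "cayley_eigenvector m B H z w y"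
      unfolding cayley_eigenvector_def using y w2 Aw[OF _ w] by auto
    then show ?thesis by blast
  qed
  have lin: "(\<Sum>l<m. U $$ (r, l) * (s * u l + t * v l)) = z * (s * u r + t * v r)" if "r < m" for r s t
  proof -
    have "(\<Sum>l<m. U $$ (r, l) * (s * u l + t * v l)) = s * (\<Sum>l<m. U $$ (r, l) * u l) + t * (\<Sum>l<m. U $$ (r, l) * v l)"
      by (simp add: sum_distrib_left sum.distrib algebra_simps)
    then show ?thesis using eig[OF that] by (simp add: algebra_simps)
  qed
  obtain y where y: "cayley_eigenvector m B H z (\<lambda>l. a * u l + b * v l) y"
    using wit[of "\<lambda>l. a * u l + b * v l"] lin le by blast
  obtain y' where y': "cayley_eigenvector m B H z (\<lambda>l. c * u l + e * v l) y'"
    using wit[of "\<lambda>l. c * u l + e * v l"] lin le by blast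
  show ?thesis
    by (rule exI[of _ p], rule exI[of _ q], rule exI[of _ z], rule exI[of _ "\<lambda>l. a * u l + b * v l"],
        rule exI[of _ "\<lambda>l. c * u l + e * v l"], rule exI[of _ y], rule exI[of _ y'])
       (use pq piv z1 y y' in simp)
qed

text \<open>With \<open>g\<close> the right multiple of \<open>w\<close> occurring in the second
  relation, \<open>2 * y = w + g\<close> and \<open>2 * \<i> * H y = g - w\<close>. So
  \<open>y\<close> and \<open>H y\<close> are Lipschitz functions of \<open>w\<close>,
  \<open>z\<close> and \<open>B\<close>, and
  \<open>(H - H') y = (H y - H' y') - H' (y - y')\<close>. The constants are 5m for
  \<open>g\<close>, 3m for \<open>y\<close> and \<open>H y\<close>, and finally
  \<open>3 * m + 3 * m * m \<le> 6 * m * m\<close>.\<close>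

lemma cayley_eigenvector_close:
  assumes wit: "cayley_eigenvector m B H z w y" and wit': "cayley_eigenvector m B' H' z' w' y'"
    and B: "unitary_mat m B" "unitary_mat m B'" and z: "cmod z = 1" "cmod z' = 1" and m: "0 < m"
    and small: "\<And>i j. i < m \<Longrightarrow> j < m \<Longrightarrow> cmod (H' i j) \<le> 1"
    and close: "\<And>i j. i < m \<Longrightarrow> j < m \<Longrightarrow> cmod (B $$ (i, j) - B' $$ (i, j)) \<le> e"
      "\<And>i. i < m \<Longrightarrow> cmod (w i - w' i) \<le> e" "cmod (z - z') \<le> e"
    and i: "i < m"
  shows "cmod (\<Sum>l<m. (H i l - H' i l) * y l) \<le> 6 * (real m * real m) * e"
proof -
  have e: "0 \<le> e" using close(3) norm_ge_zero order_trans by blast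
  have m1: "1 \<le> real m" using m by simp
  define g where "g i = z * (\<Sum>l<m. cnj (B $$ (l, i)) * w l)" for i
  define g' where "g' i = z' * (\<Sum>l<m. cnj (B' $$ (l, i)) * w' l)" for i
  define h where "h i = (\<Sum>l<m. H i l * y l)" for i
  define h' where "h' i = (\<Sum>l<m. H' i l * y' l)" for i
  have W: "w i = y i - \<i> * h i" "g i = y i + \<i> * h i" "w' i = y' i - \<i> * h' i" "g' i = y' i + \<i> * h' i"
    "cmod (w i) \<le> 2" "cmod (w' i) \<le> 2" if "i < m" for i
  proof -
    note 1 = wit[unfolded cayley_eigenvector_def, rule_format, OF that, folded h_def g_def]
    note 2 = wit'[unfolded cayley_eigenvector_def, rule_format, OF that, folded h'_def g'_def]
    show "w i = y i - \<i> * h i" "g i = y i + \<i> * h i" "cmod (w i) \<le> 2"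
      by (fact conjunct1[OF 1], fact conjunct1[OF conjunct2[OF 1]], fact conjunct1[OF conjunct2[OF conjunct2[OF 1]]])
    show "w' i = y' i - \<i> * h' i" "g' i = y' i + \<i> * h' i" "cmod (w' i) \<le> 2"
      by (fact conjunct1[OF 2], fact conjunct1[OF conjunct2[OF 2]], fact conjunct1[OF conjunct2[OF conjunct2[OF 2]]])
  qed
  have tri: "cmod (a + b + c) \<le> cmod a + cmod b + cmod c" for a b c :: complex
    using norm_triangle_ineq[of "a + b" c] norm_triangle_ineq[of a b] by linarith
  have gg: "cmod (g i - g' i) \<le> 5 * real m * e" if i: "i < m" for i
  proof -
    have "g i - g' i = (\<Sum>l<m. (z - z') * cnj (B $$ (l, i)) * w l + z' * cnj (B $$ (l, i) - B' $$ (l, i)) * w l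
        + z' * cnj (B' $$ (l, i)) * (w l - w' l))"
      unfolding g_def g'_def sum_distrib_left sum_subtractf[symmetric]
      by (intro sum.cong) (auto simp: algebra_simps)
    also have "cmod \<dots> \<le> (\<Sum>l<m. 5 * e)"
    proof (rule order_trans[OF norm_sum sum_mono])
      fix l assume "l \<in> {..<m}"
      then have l: "l < m" by simp
      have "cmod ((z - z') * cnj (B $$ (l, i)) * w l) \<le> e * 1 * 2"
        unfolding norm_mult complex_mod_cnj using close(3) unitary_mat_entry_le_1[OF B(1) l i] W(5)[OF l] e
        by (intro mult_mono) auto
      moreover have "cmod (z' * cnj (B $$ (l, i) - B' $$ (l, i)) * w l) \<le> 1 * e * 2"
        unfolding norm_mult complex_mod_cnj using close(1)[OF l i] z W(5)[OF l] e by (intro mult_mono) auto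
      moreover have "cmod (z' * cnj (B' $$ (l, i)) * (w l - w' l)) \<le> 1 * 1 * e"
        unfolding norm_mult complex_mod_cnj using close(2)[OF l] unitary_mat_entry_le_1[OF B(2) l i] z e
        by (intro mult_mono) auto
      ultimately show "cmod ((z - z') * cnj (B $$ (l, i)) * w l + z' * cnj (B $$ (l, i) - B' $$ (l, i)) * w l
        + z' * cnj (B' $$ (l, i)) * (w l - w' l)) \<le> 5 * e"
        using tri[of "(z - z') * cnj (B $$ (l, i)) * w l" "z' * cnj (B $$ (l, i) - B' $$ (l, i)) * w l"
            "z' * cnj (B' $$ (l, i)) * (w l - w' l)"] by linarith
    qed
    finally show ?thesis by simp
  qed
  have me: "e \<le> real m * e" using m1 e mult_right_mono[of 1 "real m" e] by simp
  have half: "cmod (y i - y' i) \<le> 3 * real m * e" "cmod (h i - h' i) \<le> 3 * real m * e" if i: "i < m" for i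
  proof -
    have "2 * (y i - y' i) = (w i - w' i) + (g i - g' i)"
      unfolding W(1-4)[OF i] by (simp add: algebra_simps)
    then have "2 * cmod (y i - y' i) = cmod ((w i - w' i) + (g i - g' i))"
      by (metis norm_mult norm_numeral)
    also have "\<dots> \<le> cmod (w i - w' i) + cmod (g i - g' i)" by (rule norm_triangle_ineq)
    finally show "cmod (y i - y' i) \<le> 3 * real m * e" using close(2)[OF i] gg[OF i] me by linarith
    have "2 * \<i> * (h i - h' i) = (g i - g' i) - (w i - w' i)"
      unfolding W(1-4)[OF i] by (simp add: algebra_simps)
    then have "cmod (2 * \<i> * (h i - h' i)) = cmod ((g i - g' i) - (w i - w' i))" by (rule arg_cong)
    then have "2 * cmod (h i - h' i) = cmod ((g i - g' i) - (w i - w' i))" by (simp add: norm_mult)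
    also have "\<dots> \<le> cmod (g i - g' i) + cmod (w i - w' i)" by (rule norm_triangle_ineq4)
    finally show "cmod (h i - h' i) \<le> 3 * real m * e" using close(2)[OF i] gg[OF i] me by linarith
  qed
  have "(\<Sum>l<m. (H i l - H' i l) * y l) = (h i - h' i) - (\<Sum>l<m. H' i l * (y l - y' l))"
    by (simp add: h_def h'_def algebra_simps sum_subtractf)
  then have "cmod (\<Sum>l<m. (H i l - H' i l) * y l) \<le> cmod (h i - h' i) + cmod (\<Sum>l<m. H' i l * (y l - y' l))"
    by (simp add: norm_triangle_ineq4)
  moreover have "cmod (\<Sum>l<m. H' i l * (y l - y' l)) \<le> (\<Sum>l<m. 1 * (3 * real m * e))"
  proof (rule order_trans[OF norm_sum sum_mono])
    fix l assume "l \<in> {..<m}"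
    then have l: "l < m" by simp
    show "cmod (H' i l * (y l - y' l)) \<le> 1 * (3 * real m * e)"
      unfolding norm_mult by (rule mult_mono) (use small[OF i l] half(1)[OF l] in auto)
  qed
  then have "cmod (\<Sum>l<m. H' i l * (y l - y' l)) \<le> 3 * (real m * real m) * e" by simp
  moreover have "3 * real m * e \<le> 3 * (real m * real m) * e"
    using m1 e mult_right_mono[of 1 "real m" "real m * e"] by (simp add: algebra_simps)
  ultimately show ?thesis using half(2)[OF i] by linarith
qed

text \<open>For \<open>i < j\<close> the positions \<open>(i, j)\<close> and \<open>(j, i)\<close>
  of \<open>a\<close> hold the real and the imaginary part of one entry, so the \<open>m * m\<close>
  integers are exactly the real coordinates of a hermitian matrix.\<close>

definition grid_hermitian :: "real \<Rightarrow> (nat \<times> nat \<Rightarrow> nat) \<Rightarrow> nat \<Rightarrow> nat \<Rightarrow> complex" where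
  "grid_hermitian \<kappa> a i j = complex_of_real \<kappa> * (if i < j then of_nat (a (i, j)) + \<i> * of_nat (a (j, i))
     else if i = j then of_nat (a (i, i)) else of_nat (a (j, i)) - \<i> * of_nat (a (i, j)))"

lemma grid_hermitian_cnj: "grid_hermitian \<kappa> a j i = cnj (grid_hermitian \<kappa> a i j)"
  by (auto simp: grid_hermitian_def)

lemma grid_hermitian_norm:
  assumes "0 \<le> \<kappa>" "a (i, j) \<le> N" "a (j, i) \<le> N"
  shows "cmod (grid_hermitian \<kappa> a i j) \<le> \<kappa> * (2 * real N)"
proof -
  have *: "cmod (of_nat x + \<i> * of_nat y) \<le> 2 * real N" "cmod (of_nat x - \<i> * of_nat y) \<le> 2 * real N"
    if "x \<le> N" "y \<le> N" for x y
    using that norm_triangle_ineq[of "of_nat x" "\<i> * of_nat y :: complex"]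
      norm_triangle_ineq4[of "of_nat x" "\<i> * of_nat y :: complex"] by (auto simp: norm_mult)
  have "cmod (of_nat (a (i, i)) :: complex) \<le> 2 * real N" if "i = j" using assms that by simp
  then show ?thesis
    unfolding grid_hermitian_def norm_mult using assms * by (auto intro!: mult_mono)
qed

lemma grid_hermitian_diff:
  assumes "0 \<le> \<kappa>"
    and ij: "cmod (grid_hermitian \<kappa> a i j - grid_hermitian \<kappa> b i j) \<le> e"
      "cmod (grid_hermitian \<kappa> a j i - grid_hermitian \<kappa> b j i) \<le> e"
  shows "\<kappa> * \<bar>real (a (i, j)) - real (b (i, j))\<bar> \<le> e"
proof -
  have "\<bar>Re (grid_hermitian \<kappa> a i j - grid_hermitian \<kappa> b i j)\<bar> \<le> e"
    "\<bar>Im (grid_hermitian \<kappa> a j i - grid_hermitian \<kappa> b j i)\<bar> \<le> e"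
    using ij abs_Re_le_cmod abs_Im_le_cmod order_trans by blast+
  moreover have "Re (grid_hermitian \<kappa> a i j - grid_hermitian \<kappa> b i j) = \<kappa> * (real (a (i, j)) - real (b (i, j)))"
    if "i \<le> j" using that by (auto simp: grid_hermitian_def algebra_simps)
  moreover have "Im (grid_hermitian \<kappa> a j i - grid_hermitian \<kappa> b j i) = \<kappa> * (real (a (i, j)) - real (b (i, j)))"
    if "j < i" using that by (auto simp: grid_hermitian_def algebra_simps)
  ultimately show ?thesis using assms(1) by (cases "i \<le> j") (auto simp: abs_mult)
qed

text \<open>Position among \<open>N\<close> equal cells of the interval from -4 to 4. One interval
  serves all parameters: arguments (pi is below 4), parts of numbers of modulus at most 2, and
  coordinates in the unit square.\<close>

definition cell :: "nat \<Rightarrow> real \<Rightarrow> nat" where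
  "cell N x = nat \<lfloor>real N * (x + 4) / 8\<rfloor>"

lemma cell_less:
  assumes "0 < N" "- 4 \<le> x" "x < 4"
  shows "cell N x < N"
proof -
  have "real N * (x + 4) < real N * 8" using assms by (intro mult_strict_left_mono) auto
  then have "real N * (x + 4) / 8 < real N" by simp
  then have "\<lfloor>real N * (x + 4) / 8\<rfloor> < int N" by (simp add: floor_less_iff)
  then show ?thesis using assms(1) unfolding cell_def by linarith
qed

lemma cell_eq_imp_close:
  assumes N: "0 < N" and x: "- 4 \<le> x" and y: "- 4 \<le> y" and eq: "cell N x = cell N y"
  shows "\<bar>x - y\<bar> \<le> 8 / real N"
proof -
  have "0 \<le> real N * (x + 4) / 8" "0 \<le> real N * (y + 4) / 8" using x y by auto
  then have "\<lfloor>real N * (x + 4) / 8\<rfloor> = \<lfloor>real N * (y + 4) / 8\<rfloor>"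
    using eq unfolding cell_def by (simp add: eq_nat_nat_iff)
  then have "\<bar>real N * (x + 4) / 8 - real N * (y + 4) / 8\<bar> \<le> 1" by linarith
  moreover have "real N * (x + 4) / 8 - real N * (y + 4) / 8 = real N * (x - y) / 8"
    by (simp add: field_simps)
  ultimately have "real N * \<bar>x - y\<bar> / 8 \<le> 1" by (simp add: abs_mult)
  then show ?thesis using N by (simp add: field_simps)
qed

text \<open>Pinning one position to 0 saves a factor \<open>N\<close>, whereas the choice of the
  pair and the residues modulo \<open>M\<close> cost a factor independent of \<open>N\<close>; the
  remaining power of \<open>N\<close> cancels.\<close>

lemma code_counting:
  fixes code :: "(nat \<times> nat \<Rightarrow> nat) \<Rightarrow> (nat \<times> nat) \<times> (nat \<times> nat \<Rightarrow> nat) \<times> (nat \<times> nat \<Rightarrow> nat)"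
  defines "I \<equiv> \<lambda>m :: nat. {..<m} \<times> {..<m}"
  assumes N: "0 < N" and m: "0 < m"
    and inj: "inj_on code (PiE (I m) (\<lambda>_. {..<N}))"
    and range: "code ` (PiE (I m) (\<lambda>_. {..<N})) \<subseteq>
      (SIGMA pq : I m. PiE (I m) (\<lambda>x. if x = (snd pq, snd pq) then {0} else {..<N}) \<times> PiE (I m) (\<lambda>_. {..<M}))"
  shows "N \<le> m * m * M ^ (m * m)"
proof -
  have fin: "finite (I m)" and cI: "card (I m) = m * m" by (auto simp: I_def)
  have c1: "card (PiE (I m) (\<lambda>x. if x = (snd pq, snd pq) then {0} else {..<N})) = N ^ (m * m - 1)" if "pq \<in> I m" for pq
  proof -
    have mem: "(snd pq, snd pq) \<in> I m" using that by (auto simp: I_def)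
    have "card (PiE (I m) (\<lambda>x. if x = (snd pq, snd pq) then {0} else {..<N}))
        = (\<Prod>x\<in>I m. card (if x = (snd pq, snd pq) then {0} else {..<N}))"
      by (rule card_PiE[OF fin])
    also have "\<dots> = (\<Prod>x\<in>I m - {(snd pq, snd pq)}. card (if x = (snd pq, snd pq) then {0} else {..<N}))"
      by (subst prod.remove[OF fin mem]) simp
    also have "\<dots> = (\<Prod>x\<in>I m - {(snd pq, snd pq)}. N)" by (intro prod.cong) auto
    also have "\<dots> = N ^ (m * m - 1)" using mem fin by (simp add: cI)
    finally show ?thesis .
  qed
  have c2: "card (PiE (I m) (\<lambda>_. {..<M})) = M ^ (m * m)" using fin by (simp add: card_PiE cI)
  let ?T = "SIGMA pq : I m. PiE (I m) (\<lambda>x. if x = (snd pq, snd pq) then {0} else {..<N}) \<times> PiE (I m) (\<lambda>_. {..<M})"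
  have finT: "finite ?T" using fin by (intro finite_SigmaI finite_cartesian_product finite_PiE) auto
  have "N ^ (m * m) = card (PiE (I m) (\<lambda>_. {..<N}))" using fin by (simp add: card_PiE cI)
  also have "\<dots> \<le> card ?T" by (rule card_inj_on_le[OF inj range finT])
  also have "\<dots> = (\<Sum>pq\<in>I m. card (PiE (I m) (\<lambda>x. if x = (snd pq, snd pq) then {0} else {..<N}) \<times>
      PiE (I m) (\<lambda>_. {..<M})))"
    using fin by (intro card_SigmaI ballI finite_cartesian_product finite_PiE) auto
  also have "\<dots> = (\<Sum>pq\<in>I m. N ^ (m * m - 1) * M ^ (m * m))"
    by (rule sum.cong) (simp_all only: card_cartesian_product c1 c2)
  also have "\<dots> = (m * m * M ^ (m * m)) * N ^ (m * m - 1)" by (simp add: cI)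
  finally have "N * N ^ (m * m - 1) \<le> (m * m * M ^ (m * m)) * N ^ (m * m - 1)"
    using m by (simp add: power_eq_if)
  then show ?thesis using N by simp
qed

text \<open>A bad grid point is recovered, up to boundedly many choices, from discretised values of \<open>k\<close>
  (two real parameters), the eigenvalue (one), the plane of eigenvectors (\<open>4 (m - 2)\<close>) and the
  entries of the hermitian matrix off two rows and columns (\<open>(m - 2)\<^sup>2\<close>): in total \<open>m\<^sup>2 - 1\<close>
  parameters, one fewer than the grid has.  The position \<open>(q, q)\<close> of the code is left unused.\<close>

theorem generic_perturbation:
  fixes \<alpha> :: "real^2 \<Rightarrow> complex mat"
  assumes m: "0 < m" and per: "Z2_periodic \<alpha>" and U: "\<And>k. unitary_mat m (\<alpha> k)"
    and lip: "\<And>i j. i < m \<Longrightarrow> j < m \<Longrightarrow> lip_bounded (\<lambda>k. \<alpha> k $$ (i, j))" and \<delta>: "0 < \<delta>"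
  shows "\<exists>A. unitary_mat m A \<and> (\<forall>i<m. \<forall>j<m. cmod (A $$ (i, j) - (if i = j then 1 else 0)) \<le> \<delta>) \<and>
    (\<forall>k. completely_nondegenerate m (\<alpha> k * A))"
proof (rule ccontr)
  assume neg: "\<not> ?thesis"
  \<comment> \<open>The first bound keeps the Cayley transform within \<delta> of the identity, the
    second is the smallness asked for by \<open>degenerate_witness\<close>.\<close>
  define \<rho> where "\<rho> = min (\<delta> / (2 * real m)) (1 / (8 * (real m * real m)))"
  have rho: "0 < \<rho>" "2 * real m * \<rho> \<le> \<delta>" "\<rho> \<le> 1 / (8 * (real m * real m))"
  proof -
    show "0 < \<rho>" using \<delta> m by (simp add: \<rho>_def)
    have "\<rho> \<le> \<delta> / (2 * real m)" by (simp add: \<rho>_def)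
    then show "2 * real m * \<rho> \<le> \<delta>" using m by (simp add: field_simps)
  qed (simp add: \<rho>_def)
  have rho1: "\<rho> \<le> 1"
  proof -
    have "1 / (8 * (real m * real m)) \<le> 1 / 1"
      using m mult_mono[of 1 "real m" 1 "real m"] by (intro divide_left_mono) auto
    then show ?thesis using rho(3) by simp
  qed
  obtain L where L: "0 \<le> L" "\<And>i j k k'. i < m \<Longrightarrow> j < m \<Longrightarrow> cmod (\<alpha> k $$ (i, j) - \<alpha> k' $$ (i, j)) \<le> L * dist k k'"
  proof -
    have "\<exists>L. 0 \<le> L \<and> (\<forall>k k'. cmod (\<alpha> k $$ p - \<alpha> k' $$ p) \<le> L * dist k k')" if "p \<in> {..<m} \<times> {..<m}" for p
    proof -
      define i j where "i = fst p" and "j = snd p"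
      have p: "p = (i, j)" "i < m" "j < m" using that by (auto simp: i_def j_def)
      obtain B L where "0 \<le> B" "0 \<le> L" "\<And>k. cmod (\<alpha> k $$ (i, j)) \<le> B"
        "\<And>k k'. cmod (\<alpha> k $$ (i, j) - \<alpha> k' $$ (i, j)) \<le> L * dist k k'"
        using lip_boundedE[OF lip[OF p(2,3)]] by blast
      then show ?thesis unfolding p(1) by blast
    qed
    then obtain l where l: "\<And>p. p \<in> {..<m} \<times> {..<m} \<Longrightarrow> 0 \<le> l p"
      "\<And>p k k'. p \<in> {..<m} \<times> {..<m} \<Longrightarrow> cmod (\<alpha> k $$ p - \<alpha> k' $$ p) \<le> l p * dist k k'" by metis
    show ?thesis
    proof (rule that[of "\<Sum>p\<in>{..<m} \<times> {..<m}. l p"])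
      show "0 \<le> (\<Sum>p\<in>{..<m} \<times> {..<m}. l p)" using l(1) by (rule sum_nonneg)
      fix i j and k k' :: "real^2" assume ij: "i < m" "j < m"
      have "l (i, j) \<le> (\<Sum>p\<in>{..<m} \<times> {..<m}. l p)" using ij l(1) by (intro member_le_sum) auto
      then have "l (i, j) * dist k k' \<le> (\<Sum>p\<in>{..<m} \<times> {..<m}. l p) * dist k k'" by (intro mult_right_mono) auto
      then show "cmod (\<alpha> k $$ (i, j) - \<alpha> k' $$ (i, j)) \<le> (\<Sum>p\<in>{..<m} \<times> {..<m}. l p) * dist k k'"
        using l(2)[of "(i, j)" k k'] ij by auto
    qed
  qed
  \<comment> \<open>Two grid points with the same code give hermitian matrices whose entries differ
    by at most \<open>C * t\<close>, with \<open>t = 16 * (L + 1) / N\<close>. Dividing by the grid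
    spacing \<open>\<rho> / (2 * N)\<close> cancels \<open>N\<close> and leaves \<open>R\<close>.
    Thus \<open>M\<close> can be fixed before \<open>N\<close>, and \<open>N\<close> then taken one
    beyond the bound of \<open>code_counting\<close>.\<close>
  define C where "C = 4 * ((12 * real m + 1) * (6 * (real m * real m)))"
  define R where "R = C * (32 * (L + 1)) / \<rho>"
  obtain M :: nat where M: "R < real M" using reals_Archimedean2 by blast
  define N where "N = Suc (m * m * M ^ (m * m))"
  have N: "0 < N" by (simp add: N_def)
  define \<kappa> where "\<kappa> = \<rho> / (2 * real N)"
  have kap: "0 < \<kappa>" "\<kappa> * (2 * real N) = \<rho>" using rho N by (auto simp: \<kappa>_def)
  define I where "I = {..<m} \<times> {..<m}"
  define G where "G = PiE I (\<lambda>_. {..<N})"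
  define H where "H = grid_hermitian \<kappa>"
  have aN: "a (i, j) < N" if "a \<in> G" "i < m" "j < m" for a i j
    using that by (auto simp: G_def I_def PiE_iff)
  have H_small: "cmod (H a i j) \<le> \<rho>" if "a \<in> G" "i < m" "j < m" for a i j
    using grid_hermitian_norm[of \<kappa> a i j N] aN[OF that] aN[OF that(1,3,2)] kap unfolding H_def by simp
  define wit where "wit a p q k z w w' y y' \<longleftrightarrow> p < m \<and> q < m \<and> p \<noteq> q \<and> cmod z = 1 \<and>
      w p = 1 \<and> w q = 0 \<and> w' p = 0 \<and> w' q = 1 \<and> (\<forall>i. 0 \<le> k $ i) \<and> (\<forall>i. k $ i < 1) \<and>
      cayley_eigenvector m (\<alpha> k) (H a) z w y \<and> cayley_eigenvector m (\<alpha> k) (H a) z w' y'"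
    for a p q z w w' y y' and k :: "real^2"
  have "\<exists>p q k z w w' y y'. wit a p q k z w w' y y'" if a: "a \<in> G" for a
  proof -
    have herm: "H a j i = cnj (H a i j)" for i j unfolding H_def by (rule grid_hermitian_cnj)
    obtain A where A: "unitary_mat m A"
      "\<And>i j. i < m \<Longrightarrow> j < m \<Longrightarrow> cmod (A $$ (i, j) - (if i = j then 1 else 0)) \<le> 2 * real m * \<rho>"
      and cay: "\<And>w. \<exists>y. (\<forall>i<m. w i = y i - \<i> * (\<Sum>l<m. H a i l * y l)) \<and>
      (\<forall>i<m. (\<Sum>l<m. A $$ (i, l) * w l) = y i + \<i> * (\<Sum>l<m. H a i l * y l)) \<and>
      (\<forall>i<m. (cmod (y i))\<^sup>2 \<le> (\<Sum>l<m. (cmod (w l))\<^sup>2))"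
      using cayley_transform[of m "H a" \<rho>, OF herm H_small[OF a]] by blast
    have "\<forall>i<m. \<forall>j<m. cmod (A $$ (i, j) - (if i = j then 1 else 0)) \<le> \<delta>"
      using A(2) rho(2) by (meson order_trans)
    then obtain k where k: "\<not> completely_nondegenerate m (\<alpha> k * A)" using neg A(1) by blast
    obtain x :: "real^2" where x: "\<And>i. x $ i \<in> \<int>" "\<And>i. 0 \<le> (k + x) $ i" "\<And>i. (k + x) $ i < 1"
      using Z2_periodic_fundamental_domain[of k] by metis
    have "\<alpha> (k + x) = \<alpha> k" using per x(1) by (simp add: Z2_periodic_def)
    then have "\<not> completely_nondegenerate m (\<alpha> (k + x) * A)" using k by simp
    from degenerate_witness[OF U A(1) m H_small[OF a] rho(3) cay this]
    show ?thesis unfolding wit_def using x by blast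
  qed
  then obtain p q k z w w' y y' where
    "\<And>a. a \<in> G \<Longrightarrow> wit a (p a) (q a) (k a) (z a) (w a) (w' a) (y a) (y' a)" by metis
  then have pq: "p a < m" "q a < m" "p a \<noteq> q a" and z1: "cmod (z a) = 1"
    and piv: "w a (p a) = 1" "w a (q a) = 0" "w' a (p a) = 0" "w' a (q a) = 1"
    and k01: "\<And>i. 0 \<le> k a $ i" "\<And>i. k a $ i < 1"
    and ev: "cayley_eigenvector m (\<alpha> (k a)) (H a) (z a) (w a) (y a)"
      "cayley_eigenvector m (\<alpha> (k a)) (H a) (z a) (w' a) (y' a)" if "a \<in> G" for a
    using that unfolding wit_def by blast+
  \<comment> \<open>The rows and columns of the pivots are overwritten by the witness: the
    coordinates of \<open>k\<close> at \<open>(p, p)\<close> and \<open>(p, q)\<close>, the argument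
    of \<open>z\<close> at \<open>(q, p)\<close>, and for each other index \<open>i\<close> the real
    and imaginary parts of \<open>w i\<close> at \<open>(i, p)\<close> and \<open>(p, i)\<close>,
    those of \<open>w' i\<close> at \<open>(i, q)\<close> and \<open>(q, i)\<close>. All other
    positions keep the grid coordinate itself.\<close>
  define e where "e a x = (case x of (i, j) \<Rightarrow>
      if i \<in> {p a, q a} \<and> j \<in> {p a, q a} then
        (if j = p a then (if i = p a then cell N (k a $ 1) else cell N (Arg (z a)))
         else if i = p a then cell N (k a $ 2) else 0)
      else if j = p a then cell N (Re (w a i)) else if i = p a then cell N (Im (w a j))
      else if j = q a then cell N (Re (w' a i)) else if i = q a then cell N (Im (w' a j))
      else a (i, j))" for a x
  \<comment> \<open>The second component determines each coordinate of \<open>a\<close> up to an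
    error below \<open>M\<close>; the residues remove this remaining ambiguity.\<close>
  define code where "code a = ((p a, q a), restrict (e a) I, restrict (\<lambda>x. a x mod M) I)" for a
  have w2: "cmod (w a i) \<le> 2" "cmod (w' a i) \<le> 2" if "a \<in> G" "i < m" for a i
    using ev[OF that(1)] that(2) unfolding cayley_eigenvector_def by blast+
  have parts: "- 4 \<le> Re x" "Re x < 4" "- 4 \<le> Im x" "Im x < 4" if "cmod x \<le> 2" for x
    using abs_Re_le_cmod[of x] abs_Im_le_cmod[of x] that by linarith+
  have Arg4: "- 4 \<le> Arg x" "Arg x < 4" for x
    using Arg_bounded[of x] pi_less_4 by linarith+
  have k4: "- 4 \<le> k a $ i" "k a $ i < 4" if "a \<in> G" for a i
    using k01[OF that, of i] by linarith+
  have Rpos: "0 \<le> R" unfolding R_def C_def using L(1) rho(1) by simp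
  then have Mpos: "0 < M" using M by (cases M) auto
  have "inj_on code G"
  proof (rule inj_onI)
    fix a b assume a: "a \<in> G" and b: "b \<in> G" and eq: "code a = code b"
    have pqe: "p b = p a" "q b = q a" using eq by (auto simp: code_def)
    have ee: "e a (i, j) = e b (i, j)" if "i < m" "j < m" for i j
    proof -
      have "restrict (e a) I (i, j) = restrict (e b) I (i, j)" using eq by (simp add: code_def)
      then show ?thesis using that by (simp add: I_def)
    qed
    have mods: "a (i, j) mod M = b (i, j) mod M" if "i < m" "j < m" for i j
    proof -
      have "restrict (\<lambda>x. a x mod M) I (i, j) = restrict (\<lambda>x. b x mod M) I (i, j)" using eq by (simp add: code_def)
      then show ?thesis using that by (simp add: I_def)
    qed
    note pqa = pq[OF a]
    \<comment> \<open>A common accuracy for all reconstructed data: two cell widths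
      \<open>8 / N\<close> for complex numbers and for the distance in \<open>k\<close>, the latter
      multiplied by the Lipschitz constant \<open>L\<close> for the matrices.\<close>
    define t where "t = 16 * (L + 1) / real N"
    have t16: "16 / real N \<le> t" "L * (16 / real N) \<le> t"
      unfolding t_def using L(1) N by (simp_all add: divide_simps algebra_simps)
    have t8: "8 / real N \<le> t" using t16(1) divide_right_mono[of 8 16 "real N"] by simp
    have kk: "\<bar>k a $ 1 - k b $ 1\<bar> \<le> 8 / real N" "\<bar>k a $ 2 - k b $ 2\<bar> \<le> 8 / real N"
      using ee[OF pqa(1) pqa(1)] ee[OF pqa(1) pqa(2)] pqa k4[OF a] k4[OF b]
      by (auto simp: e_def pqe intro!: cell_eq_imp_close[OF N])
    have \<alpha>\<alpha>: "cmod (\<alpha> (k a) $$ (i, j) - \<alpha> (k b) $$ (i, j)) \<le> t" if "i < m" "j < m" for i j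
    proof -
      have "dist (k a) (k b) \<le> (\<Sum>i\<in>UNIV. \<bar>(k a - k b) $ i\<bar>)"
        unfolding dist_norm by (rule norm_le_l1_cart)
      also have "\<dots> \<le> 16 / real N" using kk by (simp add: UNIV_2)
      finally have "L * dist (k a) (k b) \<le> L * (16 / real N)" using L(1) by (intro mult_left_mono)
      then show ?thesis using L(2)[OF that, of "k a" "k b"] t16(2) by linarith
    qed
    have zz: "cmod (z a - z b) \<le> t"
    proof -
      have "cell N (Arg (z a)) = cell N (Arg (z b))"
        using ee[OF pqa(2) pqa(1)] pqa by (auto simp: e_def pqe)
      then have "\<bar>Arg (z a) - Arg (z b)\<bar> \<le> 8 / real N" using Arg4 by (intro cell_eq_imp_close[OF N])
      then have "cmod (cis (Arg (z a)) - cis (Arg (z b))) \<le> t"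
        using norm_cis_diff_le[of "Arg (z a)" "Arg (z b)"] t8 by linarith
      then show ?thesis using z1[OF a] z1[OF b] by (simp add: cis_Arg_unit)
    qed
    have complex_close: "cmod (x - x') \<le> t"
      if "cell N (Re x) = cell N (Re x')" "cell N (Im x) = cell N (Im x')" "cmod x \<le> 2" "cmod x' \<le> 2" for x x'
    proof -
      have "\<bar>Re x - Re x'\<bar> \<le> 8 / real N" "\<bar>Im x - Im x'\<bar> \<le> 8 / real N"
        using that parts by (auto intro!: cell_eq_imp_close[OF N])
      moreover have "cmod (x - x') \<le> \<bar>Re x - Re x'\<bar> + \<bar>Im x - Im x'\<bar>"
        using cmod_le[of "x - x'"] by simp
      ultimately show ?thesis using t16(1) by linarith
    qed
    have t0: "0 \<le> t" using L(1) by (simp add: t_def)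
    have ww: "cmod (w a i - w b i) \<le> t" "cmod (w' a i - w' b i) \<le> t" if i: "i < m" for i
    proof -
      show "cmod (w a i - w b i) \<le> t"
      proof (cases "i \<in> {p a, q a}")
        case True
        then show ?thesis using piv[OF a] piv[OF b] t0 by (auto simp: pqe)
      next
        case False
        then show ?thesis
          using ee[OF i pqa(1)] ee[OF pqa(1) i] w2(1)[OF a i] w2(1)[OF b i]
          by (intro complex_close) (auto simp: e_def pqe)
      qed
      show "cmod (w' a i - w' b i) \<le> t"
      proof (cases "i \<in> {p a, q a}")
        case True
        then show ?thesis using piv[OF a] piv[OF b] t0 by (auto simp: pqe)
      next
        case False
        then show ?thesis
          using ee[OF i pqa(2)] ee[OF pqa(2) i] w2(2)[OF a i] w2(2)[OF b i] pqa(3)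
          by (intro complex_close) (auto simp: e_def pqe split: if_splits)
      qed
    qed
    define K where "K i j = H a i j - H b i j" for i j
    have K_herm: "K j i = cnj (K i j)" for i j
      unfolding K_def H_def using grid_hermitian_cnj[of \<kappa>] by (metis complex_cnj_diff)
    have zero: "K i j = 0" if "i < m" "j < m" "i \<notin> {p a, q a}" "j \<notin> {p a, q a}" for i j
    proof -
      have "a (i', j') = b (i', j')" if "i' \<in> {i, j}" "j' \<in> {i, j}" for i' j'
      proof -
        have "i' < m" "j' < m" "i' \<notin> {p a, q a}" "j' \<notin> {p a, q a}"
          using that \<open>i < m\<close> \<open>j < m\<close> \<open>i \<notin> {p a, q a}\<close> \<open>j \<notin> {p a, q a}\<close> by auto
        then show ?thesis using ee[of i' j'] by (auto simp: e_def pqe)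
      qed
      then show ?thesis by (simp add: K_def H_def grid_hermitian_def)
    qed
    have H1: "cmod (H b i j) \<le> 1" if "i < m" "j < m" for i j
      using H_small[OF b that] rho1 by linarith
    have Ky: "cmod (\<Sum>l<m. K i l * y a l) \<le> 6 * (real m * real m) * t"
      "cmod (\<Sum>l<m. K i l * y' a l) \<le> 6 * (real m * real m) * t" if i: "i < m" for i
      unfolding K_def
      using cayley_eigenvector_close[OF ev(1)[OF a] ev(1)[OF b] U U z1[OF a] z1[OF b] m H1 \<alpha>\<alpha> ww(1) zz i]
        cayley_eigenvector_close[OF ev(2)[OF a] ev(2)[OF b] U U z1[OF a] z1[OF b] m H1 \<alpha>\<alpha> ww(2) zz i] by blast+
    have near: "cmod (y a i - w a i) \<le> 1 / 4" "cmod (y' a i - w' a i) \<le> 1 / 4" if "i < m" for i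
      using ev[OF a] that unfolding cayley_eigenvector_def by blast+
    have y3: "cmod (y a i) \<le> 3" "cmod (y' a i) \<le> 3" if i: "i < m" for i
      using norm_triangle_ineq2[of "y a i" "w a i"] norm_triangle_ineq2[of "y' a i" "w' a i"]
        near[OF i] w2[OF a i] by linarith+
    have K_small: "cmod (K i j) \<le> C * t" if ij: "i < m" "j < m" for i j
    proof -
      have "cmod (K i j) \<le> 4 * ((12 * real m + 1) * (6 * (real m * real m) * t))"
        by (rule hermitian_small_on_plane[of m K "p a" "q a" "y a" _ "y' a"])
           (insert pqa zero Ky near[OF pqa(1)] near[OF pqa(2)] y3 ij,
            simp_all only: piv[OF a] diff_0_right K_herm[symmetric] not_False_eq_True)
      then show ?thesis by (simp add: C_def mult.assoc)
    qed
    have aR: "\<bar>real (a (i, j)) - real (b (i, j))\<bar> \<le> R" if ij: "i < m" "j < m" for i j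
    proof -
      have "\<kappa> * \<bar>real (a (i, j)) - real (b (i, j))\<bar> \<le> C * t"
        using K_small[OF ij] K_small[OF ij(2,1)] kap(1) unfolding K_def H_def by (intro grid_hermitian_diff) auto
      also have "C * t = \<kappa> * R"
        using rho(1) N by (simp add: t_def R_def \<kappa>_def field_simps)
      finally show ?thesis using kap(1) by simp
    qed
    show "a = b"
    proof (rule PiE_ext)
      show "a \<in> PiE I (\<lambda>_. {..<N})" "b \<in> PiE I (\<lambda>_. {..<N})" using a b by (auto simp: G_def)
      fix x assume "x \<in> I"
      then obtain i j where x: "x = (i, j)" "i < m" "j < m" by (auto simp: I_def)
      have "\<bar>real (a (i, j)) - real (b (i, j))\<bar> < real M" using aR[OF x(2,3)] M by linarith
      then have "\<bar>int (a (i, j)) - int (b (i, j))\<bar> < int M" by linarith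
      moreover have "int M dvd int (a (i, j)) - int (b (i, j))"
        using mods[OF x(2,3)] by (simp add: mod_eq_dvd_iff[symmetric] flip: zmod_int)
      then have "\<bar>int M\<bar> \<le> \<bar>int (a (i, j)) - int (b (i, j))\<bar>" if "int (a (i, j)) - int (b (i, j)) \<noteq> 0"
        using that by (intro dvd_imp_le_int)
      ultimately have "int (a (i, j)) - int (b (i, j)) = 0" by linarith
      then show "a x = b x" using x by simp
    qed
  qed
  moreover have "code ` G \<subseteq> (SIGMA pq : I. PiE I (\<lambda>x. if x = (snd pq, snd pq) then {0} else {..<N}) \<times> PiE I (\<lambda>_. {..<M}))"
  proof (rule image_subsetI)
    fix a assume a: "a \<in> G"
    note pqa = pq[OF a]
    have "e a x \<in> (if x = (q a, q a) then {0} else {..<N})" if x: "x \<in> I" for x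
    proof -
      obtain i j where x: "x = (i, j)" "i < m" "j < m" using x by (auto simp: I_def)
      have "cell N (k a $ i') < N" for i' using k4[OF a] by (intro cell_less[OF N]) auto
      moreover have "cell N (Arg (z a)) < N" using Arg4 by (intro cell_less[OF N]) auto
      moreover have "cell N (Re (w a l)) < N" "cell N (Im (w a l)) < N" "cell N (Re (w' a l)) < N" "cell N (Im (w' a l)) < N"
        if "l < m" for l using parts[OF w2(1)[OF a that]] parts[OF w2(2)[OF a that]] by (auto intro: cell_less[OF N])
      moreover note aN[OF a x(2,3)] pqa
      ultimately show ?thesis using x by (auto simp: e_def)
    qed
    then show "code a \<in> (SIGMA pq : I. PiE I (\<lambda>x. if x = (snd pq, snd pq) then {0} else {..<N}) \<times> PiE I (\<lambda>_. {..<M}))"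
      using pqa Mpos by (auto simp: code_def I_def)
  qed
  ultimately have "N \<le> m * m * M ^ (m * m)"
    unfolding G_def I_def by (rule code_counting[OF N m])
  then show False by (simp add: N_def)
qed

text \<open>Since \<epsilon> is invertible, the relation says that \<open>\<alpha> k\<close> is
  similar to the transpose of \<open>\<alpha> (- k)\<close>, and transposition preserves the
  characteristic polynomial.\<close>

lemma matching_family_char_poly:
  assumes eps: "\<epsilon> = 1\<^sub>m m \<or> (even m \<and> \<epsilon> = J_mat m)" and match: "matching_family m \<epsilon> \<alpha>"
  shows "char_poly (\<alpha> k) = char_poly (\<alpha> (- k))"
proof -
  have "\<exists>E \<in> carrier_mat m m. \<epsilon> \<in> carrier_mat m m \<and> E * \<epsilon> = 1\<^sub>m m \<and> \<epsilon> * E = 1\<^sub>m m"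
    using eps
  proof
    assume "\<epsilon> = 1\<^sub>m m"
    then show ?thesis by (intro bexI[of _ "1\<^sub>m m"]) auto
  next
    assume J: "even m \<and> \<epsilon> = J_mat m"
    define h where "h = m div 2"
    have m: "m = h + h" using J by (auto simp: h_def)
    \<comment> \<open>The inverse of J is - J.\<close>
    define E where "E = four_block_mat (0\<^sub>m h h) (- (1\<^sub>m h)) (1\<^sub>m h) (0\<^sub>m h h :: complex mat)"
    have e: "\<epsilon> = four_block_mat (0\<^sub>m h h) (1\<^sub>m h) (- (1\<^sub>m h)) (0\<^sub>m h h)"
      using J by (simp add: J_mat_def h_def Let_def)
    have neg0: "- 0\<^sub>m h h = (0\<^sub>m h h :: complex mat)" by (intro eq_matI) auto
    have "\<epsilon> \<in> carrier_mat m m" "E \<in> carrier_mat m m" unfolding e E_def m by auto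
    moreover have "E * \<epsilon> = 1\<^sub>m m" "\<epsilon> * E = 1\<^sub>m m"
      unfolding e E_def m
      by (subst mult_four_block_mat[of _ h h _ h _ h _ _ h _ h]; simp add: neg0)+
    ultimately show ?thesis by blast
  qed
  then obtain E where E: "E \<in> carrier_mat m m" "\<epsilon> \<in> carrier_mat m m" "E * \<epsilon> = 1\<^sub>m m" "\<epsilon> * E = 1\<^sub>m m"
    by blast
  have ak: "\<alpha> k \<in> carrier_mat m m" for k
    using match by (simp add: matching_family_def unitary_mat_def)
  have rel: "\<epsilon> * \<alpha> k = transpose_mat (\<alpha> (- k)) * \<epsilon>" using match by (simp add: matching_family_def)
  have t: "transpose_mat (\<alpha> (- k)) \<in> carrier_mat m m" using ak by simp
  have "\<alpha> k = E * (\<epsilon> * \<alpha> k)" using E ak[of k] by (simp add: assoc_mult_mat[of E m m \<epsilon> m "\<alpha> k" m, symmetric])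
  also have "\<dots> = E * transpose_mat (\<alpha> (- k)) * \<epsilon>"
    unfolding rel using E t by (simp add: assoc_mult_mat[of E m m _ m \<epsilon> m])
  finally have "similar_mat_wit (\<alpha> k) (transpose_mat (\<alpha> (- k))) E \<epsilon>"
    using E ak t by (intro similar_mat_witI[of _ _ m]) auto
  then have "char_poly (\<alpha> k) = char_poly (transpose_mat (\<alpha> (- k)))"
    by (intro char_poly_similar) (auto simp: similar_mat_def)
  then show ?thesis using char_poly_transpose_mat[OF ak] by simp
qed

section \<open>Assembly of the error estimates\<close>

lemma mat_norm_le:
  assumes "X \<in> carrier_mat m m" "0 \<le> c" "\<And>i j. i < m \<Longrightarrow> j < m \<Longrightarrow> cmod (X $$ (i, j)) \<le> c"
  shows "mat_norm X \<le> real m * c"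
proof -
  have "(\<Sum>i<m. \<Sum>j<m. (cmod (X $$ (i, j)))\<^sup>2) \<le> (\<Sum>i<m. \<Sum>j<m. c\<^sup>2)"
    using assms by (intro sum_mono power_mono) auto
  also have "\<dots> = (real m * c)\<^sup>2" by (simp add: power2_eq_square algebra_simps)
  finally have "sqrt (\<Sum>i<m. \<Sum>j<m. (cmod (X $$ (i, j)))\<^sup>2) \<le> real m * c"
    using assms(2) by (intro real_le_lsqrt) (auto intro!: sum_nonneg)
  then show ?thesis using assms(1) by (simp add: mat_norm_def)
qed

text \<open>The threshold \<delta> of the symmetrisation comes first, as it prescribes how close to
  \<alpha> the non-degenerate family has to be. For \<open>m = 0\<close> the spectrum is empty and
  \<alpha> itself serves.\<close>

lemma symmetric_nondegenerate_approx:
  assumes cont: "mat_continuous m \<alpha>" and per: "Z2_periodic \<alpha>" and U: "\<And>k. unitary_mat m (\<alpha> k)"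
    and sym: "\<And>k. char_poly (\<alpha> k) = char_poly (\<alpha> (- k))" and e: "0 < e"
  shows "\<exists>\<gamma>. mat_continuous m \<gamma> \<and> Z2_periodic \<gamma> \<and> (\<forall>k. unitary_mat m (\<gamma> k)) \<and>
    (\<forall>k. mat_norm (\<gamma> k - \<alpha> k) \<le> e) \<and>
    (\<forall>k. completely_nondegenerate m (\<gamma> k) \<and> spectrum_mat (\<gamma> k) = spectrum_mat (\<gamma> (- k)))"
proof (cases "m = 0")
  case True
  have "\<alpha> k \<in> carrier_mat m m" for k using U unitary_matD(1) by blast
  then have "mat_norm (\<alpha> k - \<alpha> k) \<le> e" for k using e True by (simp add: mat_norm_def)
  moreover have "spectrum_mat (\<alpha> k) = {}" for k using spectrum_eq_eig_vals[OF U] True by simp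
  ultimately show ?thesis
    using cont per U True by (intro exI[of _ \<alpha>]) (auto simp: completely_nondegenerate_def)
next
  case False
  then have m: "0 < m" by simp
  \<comment> \<open>The final error is at most \<open>m * (m * \<omega> + \<mu>)\<close>; \<omega>
    and \<mu> are sized so that each part contributes at most \<open>e / 2\<close>.\<close>
  define \<omega> where "\<omega> = e / (2 * (real m * real m))"
  have om: "0 < \<omega>" using e m by (simp add: \<omega>_def)
  obtain \<delta> where \<delta>: "0 < \<delta>" and adjust: "\<And>\<beta>. mat_continuous m \<beta> \<Longrightarrow> Z2_periodic \<beta> \<Longrightarrow> \<forall>k. unitary_mat m (\<beta> k) \<Longrightarrow>
    \<forall>k. completely_nondegenerate m (\<beta> k) \<Longrightarrow>
    \<forall>k. \<forall>i<m. \<forall>j<m. cmod (\<alpha> k $$ (i, j) - \<beta> k $$ (i, j)) < \<delta> \<Longrightarrow>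
    \<exists>\<gamma>. mat_continuous m \<gamma> \<and> Z2_periodic \<gamma> \<and> (\<forall>k. unitary_mat m (\<gamma> k)) \<and>
      (\<forall>k. completely_nondegenerate m (\<gamma> k) \<and> spectrum_mat (\<gamma> k) = spectrum_mat (\<gamma> (- k))) \<and>
      (\<forall>k. \<forall>i<m. \<forall>j<m. cmod (\<gamma> k $$ (i, j) - \<beta> k $$ (i, j)) \<le> real m * \<omega>)"
    using symmetric_spectrum_adjustment[OF m om cont per U sym] by blast
  \<comment> \<open>Half of \<mu> goes to the Lipschitz approximation, half to the factor
    \<open>A\<close>, whose entrywise error is multiplied by \<open>m\<close> in the product.
    Halving \<delta> yields the strict inequality that the adjustment asks for.\<close>
  define \<mu> where "\<mu> = min (\<delta> / 2) (e / (2 * real m))"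
  have mu: "0 < \<mu>" "\<mu> < \<delta>" "\<mu> \<le> e / (2 * real m)" using \<delta> e m by (auto simp: \<mu>_def)
  obtain \<beta>1 where \<beta>1: "Z2_periodic \<beta>1" "\<And>k. unitary_mat m (\<beta>1 k)"
    "\<And>i j. i < m \<Longrightarrow> j < m \<Longrightarrow> lip_bounded (\<lambda>k. \<beta>1 k $$ (i, j))"
    "\<And>k i j. i < m \<Longrightarrow> j < m \<Longrightarrow> cmod (\<beta>1 k $$ (i, j) - \<alpha> k $$ (i, j)) \<le> \<mu> / 2"
    using lipschitz_unitary_approx[OF cont per U, of "\<mu> / 2"] mu(1) by auto
  have "0 < \<mu> / (2 * real m)" using mu m by simp
  then obtain A where A: "unitary_mat m A"
    "\<And>i j. i < m \<Longrightarrow> j < m \<Longrightarrow> cmod (A $$ (i, j) - (if i = j then 1 else 0)) \<le> \<mu> / (2 * real m)"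
    and nd: "\<And>k. completely_nondegenerate m (\<beta>1 k * A)"
    using generic_perturbation[OF m \<beta>1(1,2,3)] by blast
  note Ac = unitary_matD(1)[OF A(1)] and bc = unitary_matD(1)[OF \<beta>1(2)]
  define \<beta> where "\<beta> k = \<beta>1 k * A" for k
  have ent: "\<beta> k $$ (i, j) = (\<Sum>l<m. \<beta>1 k $$ (i, l) * A $$ (l, j))" if "i < m" "j < m" for k i j
    unfolding \<beta>_def by (rule mult_entry[OF bc Ac that])
  have U\<beta>: "unitary_mat m (\<beta> k)" for k unfolding \<beta>_def by (rule unitary_mat_mult[OF \<beta>1(2) A(1)])
  have cont\<beta>: "mat_continuous m \<beta>"
    unfolding mat_continuous_def
  proof (intro allI impI)
    fix i j assume ij: "i < m" "j < m"
    have "continuous_on UNIV (\<lambda>k. \<Sum>l<m. \<beta>1 k $$ (i, l) * A $$ (l, j))"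
      using ij by (intro continuous_intros lip_bounded_imp_continuous_on \<beta>1(3)) auto
    then show "continuous_on UNIV (\<lambda>k. \<beta> k $$ (i, j))" by (simp add: ent ij)
  qed
  have per\<beta>: "Z2_periodic \<beta>" using \<beta>1(1) by (simp add: Z2_periodic_def \<beta>_def)
  have close: "cmod (\<beta> k $$ (i, j) - \<alpha> k $$ (i, j)) \<le> \<mu>" if ij: "i < m" "j < m" for k i j
  proof -
    have "(\<Sum>l<m. \<beta>1 k $$ (i, l) * (if l = j then 1 else 0)) = \<beta>1 k $$ (i, j)"
      using ij by (simp add: if_distrib[of "\<lambda>x. _ * x"] cong: if_cong)
    then have "\<beta> k $$ (i, j) - \<beta>1 k $$ (i, j) = (\<Sum>l<m. \<beta>1 k $$ (i, l) * (A $$ (l, j) - (if l = j then 1 else 0)))"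
      by (simp only: ent[OF ij] right_diff_distrib sum_subtractf)
    also have "cmod \<dots> \<le> (\<Sum>l<m. 1 * (\<mu> / (2 * real m)))"
    proof (rule order_trans[OF norm_sum sum_mono])
      fix l assume "l \<in> {..<m}"
      then have l: "l < m" by simp
      show "cmod (\<beta>1 k $$ (i, l) * (A $$ (l, j) - (if l = j then 1 else 0))) \<le> 1 * (\<mu> / (2 * real m))"
        unfolding norm_mult using unitary_mat_entry_le_1[OF \<beta>1(2) ij(1) l] A(2)[OF l ij(2)]
        by (intro mult_mono) auto
    qed
    also have "\<dots> = \<mu> / 2" using m by simp
    finally show ?thesis
      using \<beta>1(4)[OF ij, of k] norm_triangle_ineq[of "\<beta> k $$ (i, j) - \<beta>1 k $$ (i, j)" "\<beta>1 k $$ (i, j) - \<alpha> k $$ (i, j)"]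
      by simp
  qed
  have "cmod (\<alpha> k $$ (i, j) - \<beta> k $$ (i, j)) < \<delta>" if "i < m" "j < m" for k i j
    using close[OF that, of k] mu(2) by (simp add: norm_minus_commute)
  then obtain \<gamma> where \<gamma>: "mat_continuous m \<gamma>" "Z2_periodic \<gamma>" "\<forall>k. unitary_mat m (\<gamma> k)"
    "\<forall>k. completely_nondegenerate m (\<gamma> k) \<and> spectrum_mat (\<gamma> k) = spectrum_mat (\<gamma> (- k))"
    "\<forall>k. \<forall>i<m. \<forall>j<m. cmod (\<gamma> k $$ (i, j) - \<beta> k $$ (i, j)) \<le> real m * \<omega>"
    using adjust[OF cont\<beta> per\<beta>] U\<beta> nd unfolding \<beta>_def[symmetric] by blast
  have "mat_norm (\<gamma> k - \<alpha> k) \<le> e" for k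
  proof -
    have carr: "\<gamma> k \<in> carrier_mat m m" "\<alpha> k \<in> carrier_mat m m" using \<gamma>(3) U unitary_matD(1) by blast+
    have "mat_norm (\<gamma> k - \<alpha> k) \<le> real m * (real m * \<omega> + \<mu>)"
    proof (rule mat_norm_le)
      fix i j assume ij: "i < m" "j < m"
      have "cmod (\<gamma> k $$ (i, j) - \<alpha> k $$ (i, j)) \<le> real m * \<omega> + \<mu>"
        using norm_triangle_ineq[of "\<gamma> k $$ (i, j) - \<beta> k $$ (i, j)" "\<beta> k $$ (i, j) - \<alpha> k $$ (i, j)"]
          close[OF ij, of k] \<gamma>(5)[rule_format, OF ij, of k] by simp
      then show "cmod ((\<gamma> k - \<alpha> k) $$ (i, j)) \<le> real m * \<omega> + \<mu>" using carr ij by simp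
    qed (use carr om mu in auto)
    also have "\<dots> \<le> real m * (real m * \<omega> + e / (2 * real m))"
      using mu(3) by (intro mult_left_mono add_left_mono) auto
    also have "\<dots> = e" using m by (simp add: \<omega>_def field_simps)
    finally show ?thesis .
  qed
  then show ?thesis using \<gamma>(1-4) by blast
qed

theorem theorem4p3:
  fixes m :: nat and \<epsilon> :: "complex mat" and \<alpha> :: "real^2 \<Rightarrow> complex mat"
  assumes eps: "\<epsilon> = 1\<^sub>m m \<or> (even m \<and> \<epsilon> = J_mat m)"
    and match: "matching_family m \<epsilon> \<alpha>"
  shows "\<exists>\<alpha>h :: nat \<Rightarrow> real^2 \<Rightarrow> complex mat.
           (\<forall>n. mat_continuous m (\<alpha>h n) \<and> Z2_periodic (\<alpha>h n) \<and> (\<forall>k. unitary_mat m (\<alpha>h n k))) \<and>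
           (\<lambda>n. SUP k. mat_norm (\<alpha>h n k - \<alpha> k)) \<longlonglongrightarrow> 0 \<and>
           (\<forall>n k. completely_nondegenerate m (\<alpha>h n k) \<and>
                  spectrum_mat (\<alpha>h n k) = spectrum_mat (\<alpha>h n (- k)))"
proof -
  have \<alpha>: "mat_continuous m \<alpha>" "Z2_periodic \<alpha>" "\<And>k. unitary_mat m (\<alpha> k)"
    using match by (auto simp: matching_family_def)
  have "\<exists>\<gamma>. mat_continuous m \<gamma> \<and> Z2_periodic \<gamma> \<and> (\<forall>k. unitary_mat m (\<gamma> k)) \<and>
    (\<forall>k. mat_norm (\<gamma> k - \<alpha> k) \<le> inverse (real (Suc n))) \<and>
    (\<forall>k. completely_nondegenerate m (\<gamma> k) \<and> spectrum_mat (\<gamma> k) = spectrum_mat (\<gamma> (- k)))" for n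
    by (rule symmetric_nondegenerate_approx[OF \<alpha> matching_family_char_poly[OF eps match]]) simp
  then obtain \<alpha>h where h: "\<And>n. mat_continuous m (\<alpha>h n)" "\<And>n. Z2_periodic (\<alpha>h n)" "\<And>n k. unitary_mat m (\<alpha>h n k)"
    "\<And>n k. mat_norm (\<alpha>h n k - \<alpha> k) \<le> inverse (real (Suc n))"
    "\<And>n k. completely_nondegenerate m (\<alpha>h n k)" "\<And>n k. spectrum_mat (\<alpha>h n k) = spectrum_mat (\<alpha>h n (- k))"
    by metis
  have "(\<lambda>n. SUP k. mat_norm (\<alpha>h n k - \<alpha> k)) \<longlonglongrightarrow> 0"
  proof (rule tendsto_sandwich[OF _ _ tendsto_const LIMSEQ_inverse_real_of_nat])
    show "\<forall>\<^sub>F n in sequentially. 0 \<le> (SUP k. mat_norm (\<alpha>h n k - \<alpha> k))"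
    proof (intro always_eventually allI)
      fix n
      \<comment> \<open>A real supremum dominates the members of its family only when the family is
        bounded, so this comes before the lower bound 0.\<close>
      have "bdd_above (range (\<lambda>k. mat_norm (\<alpha>h n k - \<alpha> k)))"
        using h(4) by (intro bdd_aboveI2)
      moreover have "0 \<le> mat_norm (\<alpha>h n 0 - \<alpha> 0)" by (simp add: mat_norm_def sum_nonneg)
      ultimately show "0 \<le> (SUP k. mat_norm (\<alpha>h n k - \<alpha> k))" by (rule cSUP_upper2[OF _ UNIV_I])
    qed
    show "\<forall>\<^sub>F n in sequentially. (SUP k. mat_norm (\<alpha>h n k - \<alpha> k)) \<le> inverse (real (Suc n))"
      using h(4) by (intro always_eventually allI cSUP_least) auto
  qed
  then show ?thesis using h by blast
qed

end
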